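(* Let $M$ be an oriented smooth 4-manifold with (possibly empty) boundary, $\jmath:\partial M\hookrightarrow M$ the inclusion, and let $A_+^i,A_-^i\in\Omega^1(M,\mathfrak{so}(3))$ be two $SO(3)$-connections with curvatures $F_\pm^i=\mathrm{d}A_\pm^i+\frac12\epsilon^i{}_{jk}A_\pm^j\wedge A_\pm^k$ and covariant derivatives $D_\pm$. Consider the action $S(A_+,A_-)=\int_M F_{+i}\wedge F_-^i$. (1) $(A_+,A_-)$ is a stationary point of $S$ if and only if $$D_-F_+^i=0,\quad D_+F_-^i=0\ \text{ on } M,\qquad \jmath^*F_+^i=0,\quad \jmath^*F_-^i=0\ \text{ on }\partial M .$$ (2) Let $\alpha\in\mathbb{R}$ and put $e^i:=A_+^i-A_-^i$, $A^i:=\alpha A_-^i+(1-\alpha)A_+^i$, with $F^i$ and $D$ the curvature and covariant derivative of $A^i$. Then $$\begin{aligned}F_{-i}\wedge F_+^i=&\ \tfrac{(1-\alpha)^2+\alpha^2}{2}\,\epsilon_{ijk}e^i\wedge e^j\wedge F^k+\tfrac{\alpha(1-\alpha)(1-2\alpha)}{2}\,\epsilon_{ijk}De^i\wedge e^j\wedge e^k\\&+\alpha(\alpha-1)De_i\wedge De^i+(2\alpha-1)De_i\wedge F^i+F_i\wedge F^i .\end{aligned}$$ (3) In terms of $(e,A)$, the stationarity conditions of (1) are equivalent to $$\epsilon_{ijk}e^j\wedge F^k=0,\qquad \epsilon_{ijk}De^j\wedge e^k=0\quad\text{on }M,$$ $$\jmath^*\Big(De^i-\tfrac12(1-2\alpha)\epsilon^i{}_{jk}e^j\wedge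 e^k\Big)=0,\qquad \jmath^*\Big(F^i-\tfrac12\alpha(\alpha-1)\epsilon^i{}_{jk}e^j\wedge e^k\Big)=0\quad\text{on }\partial M.$$ In particular, for $\alpha=1/2$ the boundary conditions are $\jmath^*(De^i)=0$ and $\jmath^*\big(F_i+\frac18\epsilon_{ijk}e^j\wedge e^k\big)=0$, i.e. the field equations of 3-dimensional Euclidean general relativity on $\partial M$ with cosmological constant $\Lambda=1/4$.
   Context: Indices $i,j,k\in\{1,2,3\}$ are $\mathfrak{so}(3)\cong\mathbb{R}^3$ indices, raised and lowered with $\delta_{ij}$; $\epsilon_{ijk}$ is the Levi-Civita symbol; repeated indices are summed. For an $\mathfrak{so}(3)$-valued form $\phi^i$ and a connection $A^i$, $D\phi^i=\mathrm{d}\phi^i+\epsilon^i{}_{jk}A^j\wedge\phi^k$; $D_\pm$ uses $A_\pm$. All fields are smooth. A configuration is a stationary point of an action $\int_M \mathcal{L}$ if the first variation $\int_M\delta\mathcal{L}$ vanishes for all smooth compactly supported variations of the fields, where the variations are not required to vanish on $\partial M$. The field equations of 3-dimensional Euclidean general relativity with cosmological constant $\Lambda$, for a triad $e^i$ and a connection $A^i$ on a 3-manifold, are $De^i=0$ and $F_i+\frac{\Lambda}{2}\epsilon_{ijk}e^j\wedge e^k=0$. *)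

theory Defs
  imports
    "HOL-Analysis.Analysis"
    "HOL-Combinatorics.Permutations"
    "HOL-Library.Function_Algebras"
begin

section \<open>Smooth maps on subsets of Euclidean space\<close>

fun Ck_on :: "nat \<Rightarrow> (real^'n) set \<Rightarrow> (real^'n \<Rightarrow> 'b::real_normed_vector) \<Rightarrow> bool" where
  "Ck_on 0 U f \<longleftrightarrow> continuous_on U f"
| "Ck_on (Suc k) U f \<longleftrightarrow>
     (\<forall>x\<in>U. f differentiable (at x)) \<and> (\<forall>v. Ck_on k U (\<lambda>x. frechet_derivative f (at x) v))"

text \<open>Smoothness on an arbitrary set means local extendability to smooth maps on open sets;
  this matters at the boundary of the half-space.\<close>

definition smooth_on :: "(real^'n) set \<Rightarrow> (real^'n \<Rightarrow> 'b::real_normed_vector) \<Rightarrow> bool" where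
  "smooth_on S f \<longleftrightarrow>
     (\<forall>x\<in>S. \<exists>U g. open U \<and> x \<in> U \<and> (\<forall>k. Ck_on k U g) \<and> (\<forall>y\<in>U \<inter> S. g y = f y))"

section \<open>Smooth manifolds with boundary\<close>

text \<open>A chart is a pair of a domain and a coordinate map. Charts take values in a model set
  \<open>H\<close>: the closed half-space for manifolds with boundary, \<open>UNIV\<close> for manifolds without
  boundary. Derivatives are taken within \<open>H\<close>, so that they make sense, and are unique, at
  boundary points.\<close>

type_synonym ('a, 'n) chart = "'a set \<times> ('a \<Rightarrow> real^'n)"

definition chart_image :: "('a, 'n) chart \<Rightarrow> (real^'n) set" where
  "chart_image c = snd c ` fst c"

definition chart_inv :: "('a, 'n) chart \<Rightarrow> real^'n \<Rightarrow> 'a" where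
  "chart_inv c = inv_into (fst c) (snd c)"

definition local_rep :: "('a, 'm) chart \<Rightarrow> ('b, 'n) chart \<Rightarrow> ('a \<Rightarrow> 'b) \<Rightarrow> real^'m \<Rightarrow> real^'n" where
  "local_rep c d f = snd d \<circ> f \<circ> chart_inv c"

abbreviation transition :: "('a, 'n) chart \<Rightarrow> ('a, 'n) chart \<Rightarrow> real^'n \<Rightarrow> real^'n" where
  "transition c d \<equiv> local_rep c d id"

definition smooth_manifold :: "(real^'n) set \<Rightarrow> 'a topology \<Rightarrow> ('a, 'n) chart set \<Rightarrow> bool" where
  "smooth_manifold H X \<A> \<longleftrightarrow>
     Hausdorff_space X \<and> second_countable X \<and> (\<Union>c\<in>\<A>. fst c) = topspace X \<and>
     (\<forall>c\<in>\<A>. openin X (fst c) \<and> openin (top_of_set H) (chart_image c) \<and>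
        homeomorphic_map (subtopology X (fst c)) (top_of_set (chart_image c)) (snd c)) \<and>
     (\<forall>c\<in>\<A>. \<forall>d\<in>\<A>. smooth_on (snd c ` (fst c \<inter> fst d)) (transition c d))"

definition oriented_atlas :: "(real^'n) set \<Rightarrow> ('a, 'n) chart set \<Rightarrow> bool" where
  "oriented_atlas H \<A> \<longleftrightarrow>
     (\<forall>c\<in>\<A>. \<forall>d\<in>\<A>. \<forall>p\<in>fst c \<inter> fst d.
        0 < det (matrix (frechet_derivative (transition c d) (at (snd c p) within H))))"

definition half_space :: "(real^4) set" where
  "half_space = {x. 0 \<le> x $ 1}"

definition oriented_smooth_4_manifold :: "'a topology \<Rightarrow> ('a, 4) chart set \<Rightarrow> bool" where
  "oriented_smooth_4_manifold X \<A> \<longleftrightarrow>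
     smooth_manifold half_space X \<A> \<and> oriented_atlas half_space \<A>"

definition boundary_points :: "('a, 4) chart set \<Rightarrow> 'a set" where
  "boundary_points \<A> = {p. \<exists>c\<in>\<A>. p \<in> fst c \<and> snd c p $ 1 = 0}"

text \<open>The induced atlas of the boundary 3-manifold (model set \<open>UNIV\<close>): charts are
  restricted to boundary points and the vanishing first coordinate is dropped.\<close>

definition boundary_atlas :: "('a, 4) chart set \<Rightarrow> ('a, 3) chart set" where
  "boundary_atlas \<A> =
     (\<lambda>c. (fst c \<inter> boundary_points \<A>,
           \<lambda>p. vector [snd c p $ 2, snd c p $ 3, snd c p $ 4])) ` \<A>"

section \<open>Differential forms\<close>

text \<open>A form is given by its local representatives: \<open>\<omega> c x v\<close> is the value, in the chart \<open>c\<close> and at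
  the coordinate point \<open>x\<close>, on the vectors \<open>v 0, v 1, \<dots>\<close>, of which a \<open>k\<close>-form uses the first \<open>k\<close>.
  Values outside the charts of the atlas and their images carry no information, so equality
  of forms on a manifold is \<open>form_eq\<close> below. Sums of forms are pointwise.\<close>

type_synonym ('a, 'n) form = "('a, 'n) chart \<Rightarrow> real^'n \<Rightarrow> (nat \<Rightarrow> real^'n) \<Rightarrow> real"

definition alternating_form :: "nat \<Rightarrow> ((nat \<Rightarrow> real^'n) \<Rightarrow> real) \<Rightarrow> bool" where
  "alternating_form k w \<longleftrightarrow>
     (\<forall>v v'. (\<forall>i<k. v i = v' i) \<longrightarrow> w v = w v') \<and>
     (\<forall>v. \<forall>i<k. linear (\<lambda>u. w (v(i := u)))) \<and>
     (\<forall>v i j. i < j \<and> j < k \<and> v i = v j \<longrightarrow> w v = 0)"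

definition smooth_form :: "(real^'n) set \<Rightarrow> ('a, 'n) chart set \<Rightarrow> nat \<Rightarrow> ('a, 'n) form \<Rightarrow> bool" where
  "smooth_form H \<A> k \<omega> \<longleftrightarrow>
     (\<forall>c\<in>\<A>. (\<forall>x\<in>chart_image c. alternating_form k (\<omega> c x)) \<and>
             (\<forall>v. smooth_on (chart_image c) (\<lambda>x. \<omega> c x v))) \<and>
     (\<forall>c\<in>\<A>. \<forall>d\<in>\<A>. \<forall>p\<in>fst c \<inter> fst d. \<forall>v.
        \<omega> c (snd c p) v =
        \<omega> d (snd d p) (\<lambda>i. frechet_derivative (transition c d) (at (snd c p) within H) (v i)))"

definition form_eq :: "('a, 'n::finite) chart set \<Rightarrow> ('a, 'n) form \<Rightarrow> ('a, 'n) form \<Rightarrow> bool" where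
  "form_eq \<A> \<omega> \<eta> \<longleftrightarrow> (\<forall>c\<in>\<A>. \<forall>x\<in>chart_image c. \<forall>v. \<omega> c x v = \<eta> c x v)"

definition form_scale :: "real \<Rightarrow> ('a, 'n::finite) form \<Rightarrow> ('a, 'n) form" (infixr "\<odot>" 75) where
  "r \<odot> \<omega> = (\<lambda>c x v. r * \<omega> c x v)"

text \<open>Normalisation: \<open>(\<alpha> \<and> \<beta>)(u, v) = \<alpha>(u) \<beta>(v) - \<alpha>(v) \<beta>(u)\<close> for 1-forms.\<close>

definition wedge :: "nat \<Rightarrow> nat \<Rightarrow> ('a, 'n::finite) form \<Rightarrow> ('a, 'n) form \<Rightarrow> ('a, 'n) form" where
  "wedge k l \<omega> \<eta> = (\<lambda>c x v.
     (\<Sum>\<sigma> | \<sigma> permutes {..<k + l}.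
        of_int (sign \<sigma>) * \<omega> c x (\<lambda>i. v (\<sigma> i)) * \<eta> c x (\<lambda>i. v (\<sigma> (k + i))))
     / (fact k * fact l))"

definition ext_d :: "(real^'n) set \<Rightarrow> nat \<Rightarrow> ('a, 'n) form \<Rightarrow> ('a, 'n) form" where
  "ext_d H k \<omega> = (\<lambda>c x v.
     \<Sum>i\<le>k. (-1) ^ i *
       frechet_derivative (\<lambda>y. \<omega> c y (\<lambda>j. if j < i then v j else v (Suc j))) (at x within H) (v i))"

text \<open>Pullback along \<open>f\<close> from a manifold with model set \<open>H\<close> to one with atlas \<open>\<A>\<close>. For compatible
  local representatives the result does not depend on the choice of the target chart.\<close>

definition pullback ::
    "(real^'m) set \<Rightarrow> ('b, 'n::finite) chart set \<Rightarrow> ('a \<Rightarrow> 'b) \<Rightarrow> ('b, 'n) form \<Rightarrow> ('a, 'm) form" where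
  "pullback H \<A> f \<omega> = (\<lambda>c y v.
     let p = f (chart_inv c y); d = (SOME d. d \<in> \<A> \<and> p \<in> fst d)
     in \<omega> d (snd d p) (\<lambda>i. frechet_derivative (local_rep c d f) (at y within H) (v i)))"

definition boundary_pullback :: "('a, 4) chart set \<Rightarrow> ('a, 4) form \<Rightarrow> ('a, 3) form" where
  "boundary_pullback \<A> = pullback UNIV \<A> id"

section \<open>Integration of compactly supported 4-forms\<close>

definition form_support :: "'a topology \<Rightarrow> ('a, 'n::finite) chart set \<Rightarrow> ('a, 'n) form \<Rightarrow> 'a set" where
  "form_support X \<A> \<omega> =
     X closure_of {p. \<exists>c\<in>\<A>. p \<in> fst c \<and> (\<exists>v. \<omega> c (snd c p) v \<noteq> 0)}"

definition function_support :: "'a topology \<Rightarrow> ('a \<Rightarrow> real) \<Rightarrow> 'a set" where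
  "function_support X f = X closure_of {p \<in> topspace X. f p \<noteq> 0}"

definition smooth_function :: "('a, 'n::finite) chart set \<Rightarrow> ('a \<Rightarrow> real) \<Rightarrow> bool" where
  "smooth_function \<A> f \<longleftrightarrow> (\<forall>c\<in>\<A>. smooth_on (chart_image c) (f \<circ> chart_inv c))"

text \<open>Finite smooth partitions of unity on \<open>K\<close> subordinate to chart domains.\<close>

definition partition_of_unity_on ::
    "'a topology \<Rightarrow> ('a, 'n::finite) chart set \<Rightarrow> 'a set \<Rightarrow> ('a, 'n) chart set \<Rightarrow>
     (('a, 'n) chart \<Rightarrow> 'a \<Rightarrow> real) \<Rightarrow> bool" where
  "partition_of_unity_on X \<A> K C \<rho> \<longleftrightarrow>
     finite C \<and> C \<subseteq> \<A> \<and>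
     (\<forall>c\<in>C. smooth_function \<A> (\<rho> c) \<and> (\<forall>p\<in>topspace X. 0 \<le> \<rho> c p) \<and>
        compactin X (function_support X (\<rho> c)) \<and> function_support X (\<rho> c) \<subseteq> fst c) \<and>
     (\<forall>p\<in>K. (\<Sum>c\<in>C. \<rho> c p) = 1)"

text \<open>The standard frame \<open>e\<^sub>1, e\<^sub>2, e\<^sub>3, e\<^sub>4\<close> of \<open>\<real>\<^sup>4\<close> (in the index type, \<open>4 = 0\<close>).\<close>

definition std_frame :: "nat \<Rightarrow> real^4" where
  "std_frame i = axis (of_nat (Suc i)) 1"

definition form_integral :: "'a topology \<Rightarrow> ('a, 4) chart set \<Rightarrow> ('a, 4) form \<Rightarrow> real" where
  "form_integral X \<A> \<omega> =
     (THE I. \<exists>C \<rho>. partition_of_unity_on X \<A> (form_support X \<A> \<omega>) C \<rho> \<and>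
        I = (\<Sum>c\<in>C. integral (chart_image c) (\<lambda>x. \<rho> c (chart_inv c x) * \<omega> c x std_frame)))"

section \<open>Fields with values in so(3)\<close>

text \<open>Components are indexed by the type \<open>3\<close>, whose elements are \<open>1\<close>, \<open>2\<close> and \<open>3\<close> (\<open>= 0\<close>).\<close>

type_synonym ('a, 'n) so3_form = "3 \<Rightarrow> ('a, 'n) form"

definition so3_smooth_form :: "(real^'n) set \<Rightarrow> ('a, 'n) chart set \<Rightarrow> nat \<Rightarrow> ('a, 'n) so3_form \<Rightarrow> bool" where
  "so3_smooth_form H \<A> k \<phi> \<longleftrightarrow> (\<forall>i. smooth_form H \<A> k (\<phi> i))"

definition levi_civita :: "3 \<Rightarrow> 3 \<Rightarrow> 3 \<Rightarrow> real" where
  "levi_civita i j k =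
     (if (i, j, k) \<in> {(1, 2, 3), (2, 3, 1), (3, 1, 2)} then 1
      else if (i, j, k) \<in> {(1, 3, 2), (3, 2, 1), (2, 1, 3)} then -1 else 0)"

text \<open>\<open>eps_wedge k l \<phi> \<psi> i\<close> is \<open>\<epsilon>\<^sub>i\<^sub>j\<^sub>m \<phi>\<^sup>j \<and> \<psi>\<^sup>m\<close>, summed over \<open>j\<close> and \<open>m\<close>.\<close>

definition eps_wedge :: "nat \<Rightarrow> nat \<Rightarrow> ('a, 'n::finite) so3_form \<Rightarrow> ('a, 'n) so3_form \<Rightarrow> ('a, 'n) so3_form" where
  "eps_wedge k l \<phi> \<psi> =
     (\<lambda>i. \<Sum>j\<in>UNIV. \<Sum>m\<in>UNIV. levi_civita i j m \<odot> wedge k l (\<phi> j) (\<psi> m))"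

definition curvature :: "(real^'n) set \<Rightarrow> ('a, 'n) so3_form \<Rightarrow> ('a, 'n) so3_form" where
  "curvature H A = (\<lambda>i. ext_d H 1 (A i) + (1/2) \<odot> eps_wedge 1 1 A A i)"

definition cov_d :: "(real^'n) set \<Rightarrow> ('a, 'n) so3_form \<Rightarrow> nat \<Rightarrow> ('a, 'n) so3_form \<Rightarrow> ('a, 'n) so3_form" where
  "cov_d H A k \<phi> = (\<lambda>i. ext_d H k (\<phi> i) + eps_wedge 1 k A \<phi> i)"

section \<open>Stationary points\<close>

definition lagrangian :: "('a, 4) so3_form \<Rightarrow> ('a, 4) so3_form \<Rightarrow> ('a, 4) form" where
  "lagrangian A\<^sub>p A\<^sub>m =
     (\<Sum>i\<in>UNIV. wedge 2 2 (curvature half_space A\<^sub>p i) (curvature half_space A\<^sub>m i))"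

text \<open>The first variation of a Lagrangian in direction \<open>(a, b)\<close>. Compact support of \<open>a\<close> and \<open>b\<close> makes
  its integral finite even where the action itself diverges.\<close>

definition first_variation ::
    "(('a, 4) so3_form \<Rightarrow> ('a, 4) so3_form \<Rightarrow> ('a, 4) form) \<Rightarrow> ('a, 4) so3_form \<Rightarrow> ('a, 4) so3_form \<Rightarrow>
     ('a, 4) so3_form \<Rightarrow> ('a, 4) so3_form \<Rightarrow> ('a, 4) form" where
  "first_variation L A B a b = (\<lambda>c x v.
     deriv (\<lambda>t::real. L (\<lambda>i. A i + t \<odot> a i) (\<lambda>i. B i + t \<odot> b i) c x v) 0)"

definition variation :: "'a topology \<Rightarrow> ('a, 4) chart set \<Rightarrow> ('a, 4) so3_form \<Rightarrow> bool" where
  "variation X \<A> a \<longleftrightarrow>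
     so3_smooth_form half_space \<A> 1 a \<and> (\<forall>i. compactin X (form_support X \<A> (a i)))"

definition stationary ::
    "'a topology \<Rightarrow> ('a, 4) chart set \<Rightarrow> (('a, 4) so3_form \<Rightarrow> ('a, 4) so3_form \<Rightarrow> ('a, 4) form) \<Rightarrow>
     ('a, 4) so3_form \<Rightarrow> ('a, 4) so3_form \<Rightarrow> bool" where
  "stationary X \<A> L A B \<longleftrightarrow>
     (\<forall>a b. variation X \<A> a \<and> variation X \<A> b \<longrightarrow>
        form_integral X \<A> (first_variation L A B a b) = 0)"

section \<open>Three-dimensional Euclidean general relativity\<close>

text \<open>Field equations on a 3-manifold without boundary. As usual in the first-order formulation
  no nondegeneracy of the triad \<open>e\<close> is demanded.\<close>

definition gr3_field_equations ::
    "('a, 3) chart set \<Rightarrow> real \<Rightarrow> ('a, 3) so3_form \<Rightarrow> ('a, 3) so3_form \<Rightarrow> bool" where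
  "gr3_field_equations \<B> \<Lambda> e A \<longleftrightarrow>
     (\<forall>i. form_eq \<B> (cov_d UNIV A 1 e i) 0) \<and>
     (\<forall>i. form_eq \<B> (curvature UNIV A i + (\<Lambda> / 2) \<odot> eps_wedge 1 1 e e i) 0)"

end

theory Submission
  imports Defs
begin

text \<open>Write \<open>A\<^sub>+ = A + \<alpha> e\<close> and \<open>A\<^sub>- = A + (\<alpha> - 1) e\<close>. Since
  \<open>F(A + s e) = F + s De + s\<^sup>2/2 \<epsilon> e e\<close>, the decomposition of the Lagrangian is
  bilinear algebra, and by the Bianchi identity both field equations become linear combinations of
  \<open>\<epsilon> e F\<close> and \<open>\<epsilon> De e\<close>.

  For the stationary points, \<open>D a\<^sub>i \<and> F\<^sup>i = d(a\<^sub>i \<and> F\<^sup>i) + a\<^sub>i \<and> D F\<^sup>i\<close>. A partition of unity, together with the change of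
  variables formula, reduces the integral to variations supported in one chart, where Stokes'
  theorem on the half-space is obtained by letting \<open>t\<close> tend to \<open>0\<close> in
  \<open>(1/t) \<integral> (G(x + t u) - G x) dx\<close>: by translation invariance this is \<open>0\<close> for tangential \<open>u\<close>, and minus
  the average of \<open>G\<close> over a slab of thickness \<open>t\<close> for the normal \<open>u\<close>. Conversely, the equations are
  detected by test variations whose coefficient function is a bump times the very component of
  \<open>D F\<close> or \<open>F\<close> under test, so that the resulting integrand is a square.\<close>


section \<open>Smooth functions\<close>

text \<open>Three obstacles shape the development. Smoothness at a boundary point means
  extendability, so every rule for derivatives within the half-space is obtained from a local
  extension to an open set. The integral is a definite description, hence nothing can be computed
  before it is known to be independent of the partition of unity; orientation enters there, through
  positive Jacobians. Finally, chart independence of the exterior derivative is proved for 1-forms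
  only. The 3-forms D_- F_+ and D_+ F_- do not need it for 2-forms: by the Bianchi identity they are
  -\<epsilon> e F_+ and \<epsilon> e F_-, wedge products, and thus smooth 3-forms by algebra. These
  are the forms \<open>\<Theta>\<close> of the converse direction.

  A test variation produces a bulk integral and a boundary integral in one identity. They are
  separated by a weight that vanishes on the boundary, so the bulk equations come first; once these
  hold, the boundary integral stands alone. The equivalence in terms of (e, A) holds for every
  \<alpha> because both linear changes of unknowns involved are invertible whatever \<alpha>
  is.\<close>

lemma Ck_on_subset: "Ck_on k U f \<Longrightarrow> V \<subseteq> U \<Longrightarrow> Ck_on k V f"
  by (induction k arbitrary: f) (auto intro: continuous_on_subset)

lemma Ck_on_cong:
  assumes "open U" "\<And>x. x \<in> U \<Longrightarrow> f x = g x" "Ck_on k U f"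
  shows "Ck_on k U g"
  using assms(2,3)
proof (induction k arbitrary: f g)
  case 0
  then show ?case by (metis Ck_on.simps(1) continuous_on_cong)
next
  case (Suc k)
  have d: "f differentiable (at x)" if "x \<in> U" for x
    using Suc.prems(2) that by simp
  have "g differentiable (at x)" if "x \<in> U" for x
    using d[OF that] that assms(1) Suc.prems(1)
    by (meson differentiable_def has_derivative_transform_within_open)
  moreover have "Ck_on k U (\<lambda>x. frechet_derivative g (at x) v)" for v
  proof (rule Suc.IH)
    show "Ck_on k U (\<lambda>x. frechet_derivative f (at x) v)" using Suc.prems(2) by simp
    show "frechet_derivative f (at x) v = frechet_derivative g (at x) v" if "x \<in> U" for x
      using frechet_derivative_transform_within_open[OF d[OF that] assms(1) that] Suc.prems(1)
      by metis
  qed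
  ultimately show ?case by simp
qed

lemma Ck_on_SucD: "Ck_on (Suc k) U f \<Longrightarrow> Ck_on k U f"
proof (induction k arbitrary: f)
  case 0
  then show ?case
    by (auto intro!: continuous_at_imp_continuous_on differentiable_imp_continuous_within)
next
  case (Suc k)
  then show ?case by (metis Ck_on.simps(2))
qed

lemma Ck_on_has_derivative:
  "Ck_on (Suc k) U f \<Longrightarrow> x \<in> U \<Longrightarrow> (f has_derivative frechet_derivative f (at x)) (at x)"
  by (simp add: frechet_derivative_works)

lemma Ck_on_SucI:
  assumes "open U" "\<And>x. x \<in> U \<Longrightarrow> (f has_derivative f' x) (at x)"
    "\<And>v. Ck_on k U (\<lambda>x. f' x v)"
  shows "Ck_on (Suc k) U f"
proof -
  have "Ck_on k U (\<lambda>x. frechet_derivative f (at x) v)" for v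
    by (rule Ck_on_cong[OF assms(1) _ assms(3)[of v]]) (use assms(2) frechet_derivative_at in metis)
  then show ?thesis using assms(2) by (auto simp: differentiable_def)
qed

lemma Ck_on_const: "Ck_on k U (\<lambda>x. c)"
  by (induction k arbitrary: c) (auto simp: continuous_on_const)

lemma Ck_on_bounded_linear:
  assumes "open U" "bounded_linear L" "Ck_on k U f"
  shows "Ck_on k U (\<lambda>x. L (f x))"
  using assms(3)
proof (induction k arbitrary: f)
  case 0
  then show ?case using assms(2) by (simp add: bounded_linear.continuous_on)
next
  case (Suc k)
  show ?case
  proof (rule Ck_on_SucI[OF assms(1)])
    show "((\<lambda>x. L (f x)) has_derivative (\<lambda>v. L (frechet_derivative f (at x) v))) (at x)"
      if "x \<in> U" for x
      using bounded_linear.has_derivative[OF assms(2) Ck_on_has_derivative[OF Suc.prems that]] .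
    show "Ck_on k U (\<lambda>x. L (frechet_derivative f (at x) v))" for v
      using Suc by simp
  qed
qed

lemma Ck_on_linear:
  assumes "open U" "bounded_linear L"
  shows "Ck_on k U L"
proof (cases k)
  case 0
  then show ?thesis using assms(2) by (simp add: linear_continuous_on)
next
  case (Suc j)
  show ?thesis unfolding Suc
    by (rule Ck_on_SucI[OF assms(1)])
      (auto intro: Ck_on_const bounded_linear_imp_has_derivative assms(2))
qed

lemma Ck_on_add:
  assumes "open U" "Ck_on k U f" "Ck_on k U g"
  shows "Ck_on k U (\<lambda>x. f x + g x)"
  using assms(2,3)
proof (induction k arbitrary: f g)
  case 0
  then show ?case by (simp add: continuous_on_add)
next
  case (Suc k)
  show ?case
  proof (rule Ck_on_SucI[OF assms(1)])
    show "((\<lambda>x. f x + g x) has_derivative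
        (\<lambda>v. frechet_derivative f (at x) v + frechet_derivative g (at x) v)) (at x)"
      if "x \<in> U" for x
      using Ck_on_has_derivative[OF Suc.prems(1) that] Ck_on_has_derivative[OF Suc.prems(2) that]
      by (rule has_derivative_add)
  qed (use Suc in simp)
qed

lemma Ck_on_scaleR:
  fixes f :: "real^'n \<Rightarrow> real"
  assumes "open U" "Ck_on k U f" "Ck_on k U g"
  shows "Ck_on k U (\<lambda>x. f x *\<^sub>R g x)"
  using assms(2,3)
proof (induction k arbitrary: f g)
  case 0
  then show ?case by (simp add: continuous_on_scaleR)
next
  case (Suc k)
  show ?case
  proof (rule Ck_on_SucI[OF assms(1)])
    show "((\<lambda>x. f x *\<^sub>R g x) has_derivative
        (\<lambda>v. f x *\<^sub>R frechet_derivative g (at x) v + frechet_derivative f (at x) v *\<^sub>R g x)) (at x)"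
      if "x \<in> U" for x
      using Ck_on_has_derivative[OF Suc.prems(1) that] Ck_on_has_derivative[OF Suc.prems(2) that]
      by (rule has_derivative_scaleR)
    show "Ck_on k U (\<lambda>x. f x *\<^sub>R frechet_derivative g (at x) v + frechet_derivative f (at x) v *\<^sub>R g x)" for v
      by (intro Ck_on_add assms(1) Suc.IH) (use Suc.prems Ck_on_SucD in auto)
  qed
qed

lemma Ck_on_sum:
  assumes "open U" "finite I" "\<And>i. i \<in> I \<Longrightarrow> Ck_on k U (f i)"
  shows "Ck_on k U (\<lambda>x. \<Sum>i\<in>I. f i x)"
  using assms(2,3)
  by (induction I rule: finite_induct) (auto intro!: Ck_on_const Ck_on_add assms(1))

lemma linear_axis_expansion:
  fixes L :: "real^'n \<Rightarrow> 'b::real_vector"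
  assumes "linear L"
  shows "L v = (\<Sum>i\<in>UNIV. v $ i *\<^sub>R L (axis i 1))"
proof -
  have "L v = L (\<Sum>i\<in>UNIV. v $ i *\<^sub>R axis i 1)"
    by (simp add: basis_expansion flip: scalar_mult_eq_scaleR)
  also have "\<dots> = (\<Sum>i\<in>UNIV. v $ i *\<^sub>R L (axis i 1))"
    using assms by (simp add: linear_sum linear_scale)
  finally show ?thesis .
qed

text \<open>The chain rule yields the derivative of \<open>g\<close> in a direction that varies with
  \<open>x\<close>, whereas \<open>Ck_on\<close> speaks of fixed directions. Expanding that
  direction in the standard basis leaves products of components of the derivative of
  \<open>f\<close> with derivatives of \<open>g\<close> along fixed axes, to which the induction
  hypothesis applies.\<close>

lemma Ck_on_compose:
  fixes f :: "real^'m \<Rightarrow> real^'n"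
  assumes "open U" "open W" "f ` U \<subseteq> W" "Ck_on k U f" "Ck_on k W g"
  shows "Ck_on k U (\<lambda>x. g (f x))"
  using assms(4,5)
proof (induction k arbitrary: g)
  case 0
  then show ?case using assms(3) by (auto intro: continuous_on_compose2)
next
  case (Suc k)
  show ?case
  proof (rule Ck_on_SucI[OF assms(1)])
    fix x assume x: "x \<in> U"
    have g: "(g has_derivative frechet_derivative g (at (f x))) (at (f x))"
      using Ck_on_has_derivative[OF Suc.prems(2)] x assms(3) by blast
    have "((\<lambda>x. g (f x)) has_derivative
        (\<lambda>v. frechet_derivative g (at (f x)) (frechet_derivative f (at x) v))) (at x)"
      using has_derivative_compose[OF Ck_on_has_derivative[OF Suc.prems(1) x] g] .
    also have "(\<lambda>v. frechet_derivative g (at (f x)) (frechet_derivative f (at x) v)) =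
       (\<lambda>v. \<Sum>i\<in>UNIV. frechet_derivative f (at x) v $ i *\<^sub>R frechet_derivative g (at (f x)) (axis i 1))"
      by (intro ext linear_axis_expansion[OF has_derivative_linear[OF g]])
    finally show "((\<lambda>x. g (f x)) has_derivative
        (\<lambda>v. \<Sum>i\<in>UNIV. frechet_derivative f (at x) v $ i *\<^sub>R frechet_derivative g (at (f x)) (axis i 1))) (at x)" .
  next
    fix v
    show "Ck_on k U (\<lambda>x. \<Sum>i\<in>UNIV. frechet_derivative f (at x) v $ i *\<^sub>R frechet_derivative g (at (f x)) (axis i 1))"
    proof (intro Ck_on_sum Ck_on_scaleR assms(1))
      show "Ck_on k U (\<lambda>x. frechet_derivative f (at x) v $ i)" for i
        using Suc.prems(1) by (intro Ck_on_bounded_linear[OF assms(1) bounded_linear_vec_nth]) simp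
      show "Ck_on k U (\<lambda>x. frechet_derivative g (at (f x)) (axis i 1))" for i
        by (rule Suc.IH[where g="\<lambda>y. frechet_derivative g (at y) (axis i 1)"])
          (use Suc.prems Ck_on_SucD in auto)
    qed simp
  qed
qed

lemma Ck_on_inverse:
  fixes f :: "real^'n \<Rightarrow> real"
  assumes "open U" "\<And>x. x \<in> U \<Longrightarrow> f x \<noteq> 0" "Ck_on k U f"
  shows "Ck_on k U (\<lambda>x. inverse (f x))"
  using assms(3)
proof (induction k)
  case 0
  then show ?case using assms(2) by (simp add: continuous_on_inverse)
next
  case (Suc k)
  have mult: "Ck_on k U f \<Longrightarrow> Ck_on k U g \<Longrightarrow> Ck_on k U (\<lambda>x. f x * g x)" for f g :: "real^'n \<Rightarrow> real"
    using Ck_on_scaleR[OF assms(1), of k f g] by simp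
  show ?case
  proof (rule Ck_on_SucI[OF assms(1)])
    show "((\<lambda>x. inverse (f x)) has_derivative
        (\<lambda>v. (-1) * (inverse (f x) * frechet_derivative f (at x) v * inverse (f x)))) (at x)"
      if "x \<in> U" for x
      using Deriv.has_derivative_inverse[OF assms(2)[OF that] Ck_on_has_derivative[OF Suc.prems that]] by simp
    show "Ck_on k U (\<lambda>x. (-1) * (inverse (f x) * frechet_derivative f (at x) v * inverse (f x)))" for v
      using Suc.prems by (intro mult Ck_on_const Suc.IH Ck_on_SucD[OF Suc.prems]) simp
  qed
qed

text \<open>The derivatives of \<open>exp (-1/s)\<close> are polynomials in \<open>1/s\<close> times \<open>exp (-1/s)\<close>; carrying the
  polynomial along makes the family closed under differentiation.\<close>

definition flat :: "real poly \<Rightarrow> real \<Rightarrow> real" where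
  "flat p s = (if 0 < s then poly p (1 / s) * exp (- (1 / s)) else 0)"

text \<open>With u = 1/s this is the decay of a polynomial in u against exp u at infinity; on the
  left of 0 the function is constantly 0.\<close>

lemma tendsto_flat_0: "(flat p \<longlongrightarrow> 0) (at 0)"
proof -
  have "((\<lambda>u. poly p u * exp (- u)) \<longlongrightarrow> (\<Sum>i\<le>degree p. coeff p i * 0)) at_top"
  proof -
    have "((\<lambda>u. \<Sum>i\<le>degree p. coeff p i * (u ^ i / exp u)) \<longlongrightarrow> (\<Sum>i\<le>degree p. coeff p i * 0)) at_top"
      by (intro tendsto_intros tendsto_power_div_exp_0)
    then show ?thesis
      by (simp add: poly_altdef exp_minus divide_inverse sum_distrib_right mult.assoc)
  qed
  then have "((\<lambda>s. poly p (1 / s) * exp (- (1 / s))) \<longlongrightarrow> 0) (at_right 0)"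
    by (simp add: filterlim_at_top_to_right inverse_eq_divide)
  then have "(flat p \<longlongrightarrow> 0) (at_right 0)"
    by (rule Lim_transform_eventually) (auto simp: flat_def eventually_at_right_field intro: exI[of _ 1])
  moreover have "(flat p \<longlongrightarrow> 0) (at_left 0)"
    by (rule Lim_transform_eventually[OF tendsto_const]) (auto simp: flat_def eventually_at_left_field intro: exI[of _ "-1"])
  ultimately show ?thesis by (simp add: filterlim_split_at)
qed

text \<open>For s > 0 the chain rule produces the factor 1/s^2 in front of p - p', which is the
  polynomial X^2 in 1/s. At s = 0 the difference quotient is again a flat function, for the
  polynomial X p, so its limit is already known.\<close>

lemma DERIV_flat: "DERIV (flat p) s :> flat ([:0, 0, 1:] * (p - pderiv p)) s"
proof -
  consider "s > 0" | "s < 0" | "s = 0" by linarith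
  then show ?thesis
  proof cases
    case 1
    have "((\<lambda>s. poly p (1 / s) * exp (- (1 / s))) has_real_derivative
        flat ([:0, 0, 1:] * (p - pderiv p)) s) (at s)"
      using 1 by (auto intro!: derivative_eq_intros DERIV_chain2[OF poly_DERIV]
        simp: flat_def power2_eq_square field_simps)
    then show ?thesis
      by (rule has_field_derivative_transform_within_open[where S="{0<..}"]) (use 1 in \<open>auto simp: flat_def\<close>)
  next
    case 2
    have "((\<lambda>s. 0) has_real_derivative flat ([:0, 0, 1:] * (p - pderiv p)) s) (at s)"
      using 2 by (simp add: flat_def)
    then show ?thesis
      by (rule has_field_derivative_transform_within_open[where S="{..<0}"]) (use 2 in \<open>auto simp: flat_def\<close>)
  next
    case 3
    have "(\<lambda>h. (flat p (0 + h) - flat p 0) / h) = flat ([:0, 1:] * p)"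
      by (auto simp: flat_def fun_eq_iff)
    then show ?thesis using tendsto_flat_0[of "[:0, 1:] * p"] 3
      by (simp add: DERIV_def flat_def)
  qed
qed

lemma Ck_on_flat:
  fixes f :: "real^'n \<Rightarrow> real"
  assumes "open U" "Ck_on k U f"
  shows "Ck_on k U (\<lambda>x. flat p (f x))"
  using assms(2)
proof (induction k arbitrary: p)
  case 0
  have "continuous_on UNIV (flat p)"
    using DERIV_flat by (meson DERIV_isCont continuous_at_imp_continuous_on)
  then show ?case using 0 by (auto intro: continuous_on_compose2)
next
  case (Suc k)
  show ?case
  proof (rule Ck_on_SucI[OF assms(1)])
    show "((\<lambda>x. flat p (f x)) has_derivative
        (\<lambda>v. flat ([:0, 0, 1:] * (p - pderiv p)) (f x) *\<^sub>R frechet_derivative f (at x) v)) (at x)"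
      if "x \<in> U" for x
      using has_derivative_compose[OF Ck_on_has_derivative[OF Suc.prems that]
        DERIV_flat[THEN has_field_derivative_imp_has_derivative]] by (simp add: mult.commute)
    show "Ck_on k U (\<lambda>x. flat ([:0, 0, 1:] * (p - pderiv p)) (f x) *\<^sub>R frechet_derivative f (at x) v)" for v
      by (intro Ck_on_scaleR assms(1) Suc.IH) (use Suc.prems Ck_on_SucD in auto)
  qed
qed

text \<open>The function is n / (n + m), where n is positive exactly inside radius 2r and m exactly
  outside radius r. The two regions cover the space, so the denominator never vanishes. The squared
  distance is used because, unlike the distance, it is smooth at the centre.\<close>

lemma Ck_bump:
  fixes x0 :: "real^'n" and r :: real
  assumes "0 < r"
  shows "\<exists>b :: real^'n \<Rightarrow> real. (\<forall>k. Ck_on k UNIV b) \<and> (\<forall>x. 0 \<le> b x \<and> b x \<le> 1) \<and>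
    (\<forall>x\<in>cball x0 r. b x = 1) \<and> (\<forall>x. x \<notin> cball x0 (2 * r) \<longrightarrow> b x = 0)"
proof -
  define q where "q x = (x - x0) \<bullet> (x - x0)" for x
  have mult: "Ck_on k UNIV f \<Longrightarrow> Ck_on k UNIV g \<Longrightarrow> Ck_on k UNIV (\<lambda>x. f x * g x)"
    for k and f g :: "real^'n \<Rightarrow> real"
    using Ck_on_scaleR[of UNIV k f g] by simp
  have add: "Ck_on k UNIV f \<Longrightarrow> Ck_on k UNIV g \<Longrightarrow> Ck_on k UNIV (\<lambda>x. f x + g x)"
    for k and f g :: "real^'n \<Rightarrow> real"
    using Ck_on_add[of UNIV k f g] by simp
  have coord: "Ck_on k UNIV (\<lambda>x::real^'n. x $ i + c)" for k i c
    by (rule add[OF Ck_on_linear[OF open_UNIV bounded_linear_vec_nth] Ck_on_const])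
  have "Ck_on k UNIV (\<lambda>x. \<Sum>i\<in>UNIV. (x $ i + - x0 $ i) * (x $ i + - x0 $ i))" for k
    by (intro Ck_on_sum mult coord) auto
  then have q: "Ck_on k UNIV q" for k
    unfolding q_def by (simp add: inner_vec_def)
  define h where "h s = flat 1 s" for s
  have h: "h s > 0 \<longleftrightarrow> s > 0" "h s \<ge> 0" for s by (auto simp: h_def flat_def)
  define n where "n x = h (4 * r\<^sup>2 + (- 1) * q x)" for x
  define d where "d x = n x + h (q x + - r\<^sup>2)" for x
  have n: "Ck_on k UNIV n" for k
    unfolding n_def h_def by (intro Ck_on_flat open_UNIV add mult Ck_on_const q)
  have d: "Ck_on k UNIV d" for k
    unfolding d_def by (intro add n) (unfold h_def, intro Ck_on_flat open_UNIV add Ck_on_const q)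
  have dpos: "d x > 0" for x
  proof (cases "q x < 4 * r\<^sup>2")
    case True
    then have "n x > 0" by (simp add: n_def h)
    then show ?thesis using h(2)[of "q x + - r\<^sup>2"] by (simp add: d_def)
  next
    case False
    then have "q x > r\<^sup>2" using zero_less_power[OF assms, of 2] by linarith
    then have "h (q x + - r\<^sup>2) > 0" by (simp add: h)
    then show ?thesis using h(2) by (simp add: d_def n_def add_nonneg_pos)
  qed
  have qn: "q x = (dist x0 x)\<^sup>2" for x
    using norm_minus_commute[of x x0] by (simp add: q_def dist_norm flip: power2_norm_eq_inner)
  show ?thesis
  proof (intro exI[of _ "\<lambda>x. n x * inverse (d x)"] conjI allI ballI impI)
    show "Ck_on k UNIV (\<lambda>x. n x * inverse (d x))" for k
      by (intro mult n Ck_on_inverse d open_UNIV) (use dpos in \<open>simp add: less_imp_neq[symmetric]\<close>)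
    show "0 \<le> n x * inverse (d x)" for x
      using dpos[of x] h(2) by (simp add: n_def)
    show "n x * inverse (d x) \<le> 1" for x
      using dpos[of x] h(2)[of "q x + - r\<^sup>2"] by (simp add: d_def field_simps)
    show "n x * inverse (d x) = 1" if "x \<in> cball x0 r" for x
    proof -
      have "q x \<le> r\<^sup>2" using that assms by (simp add: qn)
      then have "h (q x + - r\<^sup>2) = 0" using h[of "q x + - r\<^sup>2"] by linarith
      then show ?thesis using dpos[of x] by (simp add: d_def)
    qed
    show "n x * inverse (d x) = 0" if "x \<notin> cball x0 (2 * r)" for x
    proof -
      have "(2 * r)\<^sup>2 < q x" using that assms unfolding qn by (intro power_strict_mono) auto
      then have "n x = 0" using h[of "4 * r\<^sup>2 + (- 1) * q x"] by (simp add: n_def power2_eq_square)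
      then show ?thesis by simp
    qed
  qed
qed

subsection \<open>Symmetry of second derivatives\<close>

lemma DERIV_along_line:
  fixes g :: "'v::real_normed_vector \<Rightarrow> real"
  assumes "(g has_derivative g') (at (w + a *\<^sub>R u))"
  shows "((\<lambda>s. g (w + s *\<^sub>R u)) has_real_derivative g' u) (at a)"
proof -
  have "((\<lambda>s. w + s *\<^sub>R u) has_derivative (\<lambda>h. h *\<^sub>R u)) (at a)"
    by (auto intro!: derivative_eq_intros)
  from has_derivative_compose[OF this assms] show ?thesis
    using linear_scale[OF has_derivative_linear[OF assms]]
    by (simp add: has_field_derivative_def mult.commute[of _ "g' u"])
qed

text \<open>The second difference is the increment, along \<open>u\<close>, of a first difference
  along \<open>v\<close>. One application of the mean value theorem in each direction turns it into
  a mixed derivative at a point of the parallelogram.\<close>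

lemma second_difference_mean_value:
  fixes g :: "real^'n \<Rightarrow> real"
  assumes C: "Ck_on 2 U g" and s: "0 < s"
    and U: "\<And>a b. \<lbrakk>0 \<le> a; a \<le> s; 0 \<le> b; b \<le> s\<rbrakk> \<Longrightarrow> x + a *\<^sub>R u + b *\<^sub>R v \<in> U"
  shows "\<exists>a b. 0 \<le> a \<and> a \<le> s \<and> 0 \<le> b \<and> b \<le> s \<and>
    g (x + s *\<^sub>R u + s *\<^sub>R v) - g (x + s *\<^sub>R u) - g (x + s *\<^sub>R v) + g x =
    s * (s * frechet_derivative (\<lambda>y. frechet_derivative g (at y) u) (at (x + a *\<^sub>R u + b *\<^sub>R v)) v)"
proof -
  have C2: "Ck_on (Suc (Suc 0)) U g" using C by (simp add: numeral_2_eq_2)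
  have C1: "Ck_on (Suc 0) U (\<lambda>y. frechet_derivative g (at y) u)"
    using C2 unfolding Ck_on.simps(2)[of "Suc 0"] by blast
  define \<phi> where "\<phi> a = g (x + s *\<^sub>R v + a *\<^sub>R u) - g (x + a *\<^sub>R u)" for a
  have "DERIV \<phi> a :> frechet_derivative g (at (x + s *\<^sub>R v + a *\<^sub>R u)) u - frechet_derivative g (at (x + a *\<^sub>R u)) u"
    if "0 \<le> a" "a \<le> s" for a
    unfolding \<phi>_def using U[of a s] U[of a 0] that s
    by (intro DERIV_diff DERIV_along_line Ck_on_has_derivative[OF C2]) (simp_all add: algebra_simps)
  from MVT2[OF s this] obtain a where a: "0 < a" "a < s" "\<phi> s - \<phi> 0 = (s - 0) * (frechet_derivative g (at (x + s *\<^sub>R v + a *\<^sub>R u)) u - frechet_derivative g (at (x + a *\<^sub>R u)) u)"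
    by blast
  define \<xi> where "\<xi> b = frechet_derivative g (at (x + a *\<^sub>R u + b *\<^sub>R v)) u" for b
  have "DERIV \<xi> b :> frechet_derivative (\<lambda>y. frechet_derivative g (at y) u) (at (x + a *\<^sub>R u + b *\<^sub>R v)) v"
    if "0 \<le> b" "b \<le> s" for b
    unfolding \<xi>_def using U[of a b] that a
    by (intro DERIV_along_line[of "\<lambda>y. frechet_derivative g (at y) u"] Ck_on_has_derivative[OF C1]) simp_all
  from MVT2[OF s this] obtain b where b: "0 < b" "b < s" "\<xi> s - \<xi> 0 = (s - 0) * frechet_derivative (\<lambda>y. frechet_derivative g (at y) u) (at (x + a *\<^sub>R u + b *\<^sub>R v)) v"
    by blast
  have "g (x + s *\<^sub>R u + s *\<^sub>R v) - g (x + s *\<^sub>R u) - g (x + s *\<^sub>R v) + g x = \<phi> s - \<phi> 0"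
    by (simp add: \<phi>_def algebra_simps)
  also have "\<dots> = s * (\<xi> s - \<xi> 0)" using a(3) by (simp add: \<xi>_def add.commute add.left_commute)
  finally show ?thesis using a b by (intro exI[of _ a] exI[of _ b]) auto
qed

text \<open>The second difference is symmetric in \<open>u\<close> and \<open>v\<close>, so both
  mixed derivatives take a common value at points of an arbitrarily small parallelogram; continuity
  at \<open>x\<close> then forbids a gap between them.\<close>

lemma second_derivative_symmetric:
  fixes g :: "real^'n \<Rightarrow> real"
  assumes C: "Ck_on 2 U g" and U: "open U" "x \<in> U"
  shows "frechet_derivative (\<lambda>y. frechet_derivative g (at y) u) (at x) v =
    frechet_derivative (\<lambda>y. frechet_derivative g (at y) v) (at x) u"
proof (rule ccontr)
  define A where "A u v y = frechet_derivative (\<lambda>y. frechet_derivative g (at y) u) (at y) v" for u v y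
  assume "\<not> ?thesis"
  then have ne: "A u v x \<noteq> A v u x" by (simp add: A_def)
  \<comment> \<open>Half the gap: numbers within \<open>e\<close> of the two sides cannot
    coincide.\<close>
  define e where "e = \<bar>A u v x - A v u x\<bar> / 2"
  have e: "e > 0" using ne by (simp add: e_def)
  have cont: "continuous_on U (A u v)" for u v
    using C unfolding A_def numeral_2_eq_2 by simp
  have ev: "eventually (\<lambda>y. y \<in> U \<and> dist (A u v y) (A u v x) < e) (nhds x)" for u v
  proof -
    have "isCont (A u v) x" using cont U continuous_on_eq_continuous_at by blast
    then have "(A u v \<longlongrightarrow> A u v x) (nhds x)"
      by (simp add: isCont_def tendsto_at_iff_tendsto_nhds)
    then show ?thesis
      using eventually_conj[OF eventually_nhds_in_open[OF U] tendstoD[OF _ e]] by blast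
  qed
  from eventually_conj[OF ev[of u v] ev[of v u]] obtain r where r: "r > 0"
    "\<And>y. dist y x < r \<Longrightarrow> y \<in> U \<and> dist (A u v y) (A u v x) < e \<and> dist (A v u y) (A v u x) < e"
    unfolding eventually_nhds_metric by blast
  \<comment> \<open>Chosen so that the whole parallelogram with sides s u and s v stays within
    distance r of x; the summand 1 keeps the denominator positive when both vectors vanish.\<close>
  define s where "s = r / (2 * (norm u + norm v + 1))"
  have np: "norm u + norm v + 1 > 0" by (smt (verit) norm_ge_zero)
  have s: "s > 0" using r np by (simp add: s_def)
  have "s * (norm u + norm v) < r"
  proof -
    have "s * (norm u + norm v) \<le> s * (norm u + norm v + 1)" using s by simp
    also have "\<dots> = r / 2" using np by (simp add: s_def field_simps)
    finally show ?thesis using r by simp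
  qed
  then have near: "dist (x + a *\<^sub>R u + b *\<^sub>R v) x < r" if "0 \<le> a" "a \<le> s" "0 \<le> b" "b \<le> s" for a b
  proof -
    have "dist (x + a *\<^sub>R u + b *\<^sub>R v) x \<le> a * norm u + b * norm v"
      using that norm_triangle_ineq[of "a *\<^sub>R u" "b *\<^sub>R v"] by (simp add: dist_norm algebra_simps)
    also have "\<dots> \<le> s * norm u + s * norm v"
      using that by (intro add_mono mult_right_mono) auto
    finally show ?thesis using \<open>s * (norm u + norm v) < r\<close> by (simp add: algebra_simps)
  qed
  obtain a b where 1: "0 \<le> a" "a \<le> s" "0 \<le> b" "b \<le> s"
    "g (x + s *\<^sub>R u + s *\<^sub>R v) - g (x + s *\<^sub>R u) - g (x + s *\<^sub>R v) + g x = s * (s * A u v (x + a *\<^sub>R u + b *\<^sub>R v))"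
    using second_difference_mean_value[OF C s, of x u v] near r(2) unfolding A_def by blast
  have near': "x + a *\<^sub>R v + b *\<^sub>R u \<in> U" if "0 \<le> a" "a \<le> s" "0 \<le> b" "b \<le> s" for a b
    using near[of b a] r(2) that by (simp add: algebra_simps)
  obtain a' b' where 2: "0 \<le> a'" "a' \<le> s" "0 \<le> b'" "b' \<le> s"
    "g (x + s *\<^sub>R v + s *\<^sub>R u) - g (x + s *\<^sub>R v) - g (x + s *\<^sub>R u) + g x = s * (s * A v u (x + a' *\<^sub>R v + b' *\<^sub>R u))"
    using second_difference_mean_value[OF C s, of x v u] near' unfolding A_def by blast
  have "A u v (x + a *\<^sub>R u + b *\<^sub>R v) = A v u (x + b' *\<^sub>R u + a' *\<^sub>R v)"
  proof -
    have "s * (s * A u v (x + a *\<^sub>R u + b *\<^sub>R v)) = s * (s * A v u (x + a' *\<^sub>R v + b' *\<^sub>R u))"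
      unfolding 1(5)[symmetric] 2(5)[symmetric] by (simp add: algebra_simps)
    then show ?thesis using s by (simp add: algebra_simps)
  qed
  then show False
    using r(2)[OF near[OF 1(1-4)]] r(2)[OF near[OF 2(3,4) 2(1,2)]] unfolding e_def dist_real_def
    by (smt (verit) field_sum_of_halves)
qed


subsection \<open>Smooth functions on arbitrary sets\<close>

lemma smooth_onE:
  assumes "smooth_on S f" "x \<in> S"
  obtains U g where "open U" "x \<in> U" "\<And>k. Ck_on k U g" "\<And>y. y \<in> U \<Longrightarrow> y \<in> S \<Longrightarrow> g y = f y"
proof -
  from bspec[OF assms(1)[unfolded smooth_on_def] assms(2)] obtain U g where
    "open U \<and> x \<in> U \<and> (\<forall>k. Ck_on k U g) \<and> (\<forall>y\<in>U \<inter> S. g y = f y)" by (elim exE)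
  then show ?thesis using that[of U g] by simp
qed

lemma smooth_onI:
  assumes "\<And>x. x \<in> S \<Longrightarrow> \<exists>U g. open U \<and> x \<in> U \<and> (\<forall>k. Ck_on k U g) \<and> (\<forall>y\<in>U \<inter> S. g y = f y)"
  shows "smooth_on S f"
  using assms unfolding smooth_on_def by (rule ballI)

lemma smooth_on_subset:
  assumes "smooth_on S f" "T \<subseteq> S"
  shows "smooth_on T f"
proof (rule smooth_onI)
  fix x assume "x \<in> T"
  then have "x \<in> S" using assms(2) by blast
  then obtain U g where "open U" "x \<in> U" "\<And>k. Ck_on k U g" "\<And>y. y \<in> U \<Longrightarrow> y \<in> S \<Longrightarrow> g y = f y"
    by (rule smooth_onE[OF assms(1)]) (rule that)
  with assms(2) show "\<exists>U g. open U \<and> x \<in> U \<and> (\<forall>k. Ck_on k U g) \<and> (\<forall>y\<in>U \<inter> T. g y = f y)"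
    by (intro exI[of _ U] exI[of _ g]) auto
qed

lemma smooth_on_cong:
  assumes "smooth_on S f" "\<And>x. x \<in> S \<Longrightarrow> f x = g x"
  shows "smooth_on S g"
proof (rule smooth_onI)
  fix x assume "x \<in> S"
  then obtain U h where "open U" "x \<in> U" "\<And>k. Ck_on k U h" "\<And>y. y \<in> U \<Longrightarrow> y \<in> S \<Longrightarrow> h y = f y"
    by (rule smooth_onE[OF assms(1)]) (rule that)
  then show "\<exists>U h. open U \<and> x \<in> U \<and> (\<forall>k. Ck_on k U h) \<and> (\<forall>y\<in>U \<inter> S. h y = g y)"
    using assms(2) by (intro exI[of _ U] exI[of _ h]) auto
qed

lemma smooth_on_UNIV_Ck: "(\<And>k. Ck_on k UNIV f) \<Longrightarrow> smooth_on S f"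
  unfolding smooth_on_def by (intro ballI exI[of _ UNIV] exI[of _ f]) auto

lemma smooth_on_const: "smooth_on S (\<lambda>x. c)"
  by (rule smooth_on_UNIV_Ck[OF Ck_on_const])

lemma smooth_on_linear: "bounded_linear L \<Longrightarrow> smooth_on S L"
  by (rule smooth_on_UNIV_Ck[OF Ck_on_linear[OF open_UNIV]])

lemma smooth_on_local:
  assumes "\<And>x. x \<in> S \<Longrightarrow> \<exists>V. open V \<and> x \<in> V \<and> smooth_on (S \<inter> V) f"
  shows "smooth_on S f"
proof (rule smooth_onI)
  fix x assume x: "x \<in> S"
  obtain V where V: "open V" "x \<in> V" "smooth_on (S \<inter> V) f" using assms x by blast
  obtain U g where U: "open U" "x \<in> U" "\<And>k. Ck_on k U g" "\<And>y. y \<in> U \<Longrightarrow> y \<in> S \<inter> V \<Longrightarrow> g y = f y"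
    using smooth_onE[OF V(3), of x thesis] that x V by blast
  show "\<exists>U g. open U \<and> x \<in> U \<and> (\<forall>k. Ck_on k U g) \<and> (\<forall>y\<in>U \<inter> S. g y = f y)"
    using U V by (intro exI[of _ "U \<inter> V"] exI[of _ g]) (auto intro: Ck_on_subset)
qed

lemma smooth_on_binary:
  fixes f :: "real^'n \<Rightarrow> 'b::real_normed_vector" and g :: "real^'n \<Rightarrow> 'c::real_normed_vector"
    and op :: "'b \<Rightarrow> 'c \<Rightarrow> 'd::real_normed_vector"
  assumes f: "smooth_on S f" and g: "smooth_on S g"
    and op: "\<And>U k (f :: real^'n \<Rightarrow> _) g. open U \<Longrightarrow> Ck_on k U f \<Longrightarrow> Ck_on k U g \<Longrightarrow> Ck_on k U (\<lambda>x. op (f x) (g x))"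
  shows "smooth_on S (\<lambda>x. op (f x) (g x))"
proof (rule smooth_onI)
  fix x assume x: "x \<in> S"
  obtain U1 g1 where 1: "open U1" "x \<in> U1" "\<And>k. Ck_on k U1 g1" "\<And>y. y \<in> U1 \<Longrightarrow> y \<in> S \<Longrightarrow> g1 y = f y"
    by (rule smooth_onE[OF f x]) (rule that)
  obtain U2 g2 where 2: "open U2" "x \<in> U2" "\<And>k. Ck_on k U2 g2" "\<And>y. y \<in> U2 \<Longrightarrow> y \<in> S \<Longrightarrow> g2 y = g y"
    by (rule smooth_onE[OF g x]) (rule that)
  show "\<exists>U h. open U \<and> x \<in> U \<and> (\<forall>k. Ck_on k U h) \<and> (\<forall>y\<in>U \<inter> S. h y = op (f y) (g y))"
    using 1 2 Ck_on_subset[of _ U1 g1 "U1 \<inter> U2"] Ck_on_subset[of _ U2 g2 "U1 \<inter> U2"]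
    by (intro exI[of _ "U1 \<inter> U2"] exI[of _ "\<lambda>x. op (g1 x) (g2 x)"]) (auto intro!: op)
qed

lemma smooth_on_add: "smooth_on S f \<Longrightarrow> smooth_on S g \<Longrightarrow> smooth_on S (\<lambda>x. f x + g x)"
  by (rule smooth_on_binary[where op="(+)"]) (auto intro: Ck_on_add)

lemma smooth_on_scaleR:
  fixes f :: "real^'n \<Rightarrow> real"
  shows "smooth_on S f \<Longrightarrow> smooth_on S g \<Longrightarrow> smooth_on S (\<lambda>x. f x *\<^sub>R g x)"
  by (rule smooth_on_binary[where op="(*\<^sub>R)"]) (auto intro: Ck_on_scaleR)

lemma smooth_on_mult:
  fixes f g :: "real^'n \<Rightarrow> real"
  shows "smooth_on S f \<Longrightarrow> smooth_on S g \<Longrightarrow> smooth_on S (\<lambda>x. f x * g x)"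
  using smooth_on_scaleR[of S f g] by simp

lemma smooth_on_sum:
  "(\<And>i. i \<in> I \<Longrightarrow> smooth_on S (f i)) \<Longrightarrow> smooth_on S (\<lambda>x. \<Sum>i\<in>I. f i x)"
  by (induction I rule: infinite_finite_induct) (auto intro!: smooth_on_const smooth_on_add)

lemma smooth_on_prod:
  fixes f :: "'i \<Rightarrow> real^'n \<Rightarrow> real"
  shows "(\<And>i. i \<in> I \<Longrightarrow> smooth_on S (f i)) \<Longrightarrow> smooth_on S (\<lambda>x. \<Prod>i\<in>I. f i x)"
  by (induction I rule: infinite_finite_induct) (auto intro!: smooth_on_const smooth_on_mult)

lemma smooth_on_diff:
  fixes f g :: "real^'n \<Rightarrow> real"
  shows "smooth_on S f \<Longrightarrow> smooth_on S g \<Longrightarrow> smooth_on S (\<lambda>x. f x - g x)"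
  using smooth_on_add[of S f "\<lambda>x. (-1) * g x"] smooth_on_mult[OF smooth_on_const[of S "-1"], of g] by simp

lemma smooth_on_compose:
  fixes f :: "real^'m \<Rightarrow> real^'n"
  assumes f: "smooth_on S f" and g: "smooth_on T g" and ST: "f ` S \<subseteq> T"
  shows "smooth_on S (\<lambda>x. g (f x))"
proof (rule smooth_onI)
  fix x assume x: "x \<in> S"
  obtain U f1 where 1: "open U" "x \<in> U" "\<And>k. Ck_on k U f1" "\<And>y. y \<in> U \<Longrightarrow> y \<in> S \<Longrightarrow> f1 y = f y"
    by (rule smooth_onE[OF f x]) (rule that)
  obtain W g1 where 2: "open W" "f x \<in> W" "\<And>k. Ck_on k W g1" "\<And>y. y \<in> W \<Longrightarrow> y \<in> T \<Longrightarrow> g1 y = g y"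
    using smooth_onE[OF g, of "f x" thesis] that x ST by blast
  have "Ck_on 0 U f1" using 1 by blast
  then have "continuous_on U f1" by simp
  then have o: "open (U \<inter> f1 -` W)"
    using continuous_on_open_vimage[OF 1(1), of f1] 2(1) by (metis Int_commute)
  have "Ck_on k (U \<inter> f1 -` W) (\<lambda>x. g1 (f1 x))" for k
    by (rule Ck_on_compose[OF o 2(1)]) (use 1 2 Ck_on_subset[of _ U f1 "U \<inter> f1 -` W"] in auto)
  then show "\<exists>U h. open U \<and> x \<in> U \<and> (\<forall>k. Ck_on k U h) \<and> (\<forall>y\<in>U \<inter> S. h y = g (f y))"
    using 1 2 o x ST
    by (intro exI[of _ "U \<inter> f1 -` W"] exI[of _ "\<lambda>x. g1 (f1 x)"]) auto
qed

lemma smooth_on_bounded_linear: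
  assumes "bounded_linear L" "smooth_on S f"
  shows "smooth_on S (\<lambda>x. L (f x))"
proof (rule smooth_onI)
  fix x assume x: "x \<in> S"
  obtain U f1 where 1: "open U" "x \<in> U" "\<And>k. Ck_on k U f1" "\<And>y. y \<in> U \<Longrightarrow> y \<in> S \<Longrightarrow> f1 y = f y"
    by (rule smooth_onE[OF assms(2) x]) (rule that)
  then show "\<exists>U h. open U \<and> x \<in> U \<and> (\<forall>k. Ck_on k U h) \<and> (\<forall>y\<in>U \<inter> S. h y = L (f y))"
    by (intro exI[of _ U] exI[of _ "\<lambda>x. L (f1 x)"]) (auto intro: Ck_on_bounded_linear assms(1))
qed

lemma smooth_on_imp_continuous_on:
  assumes "smooth_on S f" shows "continuous_on S f"
  unfolding continuous_on_eq_continuous_within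
proof
  fix x assume x: "x \<in> S"
  obtain U f1 where 1: "open U" "x \<in> U" "\<And>k. Ck_on k U f1" "\<And>y. y \<in> U \<Longrightarrow> y \<in> S \<Longrightarrow> f1 y = f y"
    by (rule smooth_onE[OF assms x]) (rule that)
  have "Ck_on 0 U f1" using 1 by blast
  then have "isCont f1 x" using 1(1,2) by (simp add: continuous_on_eq_continuous_at)
  then have "continuous (at x within S) f1" using continuous_at_imp_continuous_within by blast
  then show "continuous (at x within S) f"
  proof -
    assume c: "continuous (at x within S) f1"
    have "eventually (\<lambda>y. f1 y = f y) (at x within S)"
      unfolding eventually_at_topological using 1 by blast
    moreover have "(f1 \<longlongrightarrow> f x) (at x within S)" using c 1(2,4) x by (simp add: continuous_within)
    ultimately show ?thesis unfolding continuous_within by (rule Lim_transform_eventually[rotated])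
  qed
qed

subsection \<open>Derivatives within the half-space\<close>

abbreviation relopen :: "(real^4) set \<Rightarrow> bool" where
  "relopen S \<equiv> openin (top_of_set half_space) S"

abbreviation half_deriv :: "(real^4 \<Rightarrow> 'b::real_normed_vector) \<Rightarrow> real^4 \<Rightarrow> real^4 \<Rightarrow> 'b" where
  "half_deriv f x \<equiv> frechet_derivative f (at x within half_space)"

text \<open>Derivatives within the half-space are unique even at boundary points: every standard
  basis vector has a nonnegative first component, so small positive multiples of it never lead out
  of the half-space.\<close>

lemma half_deriv_eqI:
  assumes "(f has_derivative f') (at x within half_space)" "x \<in> half_space"
  shows "half_deriv f x = f'"
proof (rule frechet_derivative_unique_within)
  show "(f has_derivative half_deriv f x) (at x within half_space)"
    using assms(1) frechet_derivative_works differentiable_def by blast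
  show "\<exists>d. 0 < \<bar>d\<bar> \<and> \<bar>d\<bar> < e \<and> x + d *\<^sub>R i \<in> half_space" if i: "i \<in> Basis" and "e > 0" for i and e :: real
  proof (intro exI[of _ "e / 2"] conjI)
    have "i $ 1 \<ge> 0" using i by (auto simp: Basis_vec_def axis_def)
    then show "x + (e / 2) *\<^sub>R i \<in> half_space" using assms(2) that by (simp add: half_space_def)
  qed (use that in auto)
qed (rule assms(1))

lemma has_derivative_transform_relopen:
  assumes "(g has_derivative g') (at x within H)" "open U" "x \<in> U" "x \<in> H" "\<And>y. y \<in> U \<inter> H \<Longrightarrow> f y = g y"
  shows "(f has_derivative g') (at x within H)"
proof -
  obtain d where "d > 0" "\<And>y. dist y x < d \<Longrightarrow> y \<in> U" using assms(2,3) open_dist by metis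
  then show ?thesis
    by (intro has_derivative_transform_within[OF assms(1), of d]) (use assms in auto)
qed

text \<open>The bridge between the two notions of derivative. On a relatively open set the local
  extension \<open>g\<close> agrees with \<open>f\<close> near the point inside the half-space, so
  by uniqueness the one-sided derivative of \<open>f\<close> is the ordinary derivative of
  \<open>g\<close>, at boundary points too.\<close>

lemma smooth_on_relopenE:
  assumes "smooth_on S f" "relopen S" "x \<in> S"
  obtains U g where "open U" "x \<in> U" "U \<inter> half_space \<subseteq> S" "\<And>k. Ck_on k U g"
    "\<And>y. y \<in> U \<inter> half_space \<Longrightarrow> f y = g y"
    "\<And>y. y \<in> U \<inter> half_space \<Longrightarrow> (f has_derivative frechet_derivative g (at y)) (at y within half_space)"
    "\<And>y. y \<in> U \<inter> half_space \<Longrightarrow> half_deriv f y = frechet_derivative g (at y)"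
proof -
  obtain U g where 1: "open U" "x \<in> U" "\<And>k. Ck_on k U g" "\<And>y. y \<in> U \<Longrightarrow> y \<in> S \<Longrightarrow> g y = f y"
    by (rule smooth_onE[OF assms(1,3)]) (rule that)
  obtain V where V: "open V" "S = half_space \<inter> V" using assms(2) by (auto simp: openin_open)
  have x: "x \<in> half_space" "x \<in> V" using V assms(3) by auto
  have der: "(f has_derivative frechet_derivative g (at y)) (at y within half_space)"
    if y: "y \<in> (U \<inter> V) \<inter> half_space" for y
  proof (rule has_derivative_transform_relopen[of g _ _ _ "U \<inter> V"])
    show "(g has_derivative frechet_derivative g (at y)) (at y within half_space)"
      using y 1(3) Ck_on_has_derivative has_derivative_at_withinI by blast
  qed (use 1 V y in auto)
  show ?thesis
  proof (rule that[of "U \<inter> V" g])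
    show "half_deriv f y = frechet_derivative g (at y)" if "y \<in> U \<inter> V \<inter> half_space" for y
      using half_deriv_eqI[OF der[OF that]] that by blast
    show "Ck_on k (U \<inter> V) g" for k using 1 by (meson Ck_on_subset Int_lower1)
  qed (use 1 V x der in auto)
qed

lemma smooth_on_has_half_deriv:
  assumes "smooth_on S f" "relopen S" "x \<in> S"
  shows "(f has_derivative half_deriv f x) (at x within half_space)"
proof -
  have x: "x \<in> half_space" using assms openin_imp_subset by blast
  show ?thesis
    by (rule smooth_on_relopenE[OF assms]) (use x in auto)
qed

lemma smooth_on_half_deriv:
  assumes "smooth_on S f" "relopen S"
  shows "smooth_on S (\<lambda>x. half_deriv f x v)"
proof (rule smooth_onI)
  fix x assume "x \<in> S"
  from smooth_on_relopenE[OF assms this] obtain U g where U: "open U" "x \<in> U"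
    "U \<inter> half_space \<subseteq> S" "\<And>k. Ck_on k U g"
    "\<And>y. y \<in> U \<inter> half_space \<Longrightarrow> half_deriv f y = frechet_derivative g (at y)" by metis
  moreover have "S \<subseteq> half_space" using assms(2) openin_imp_subset by blast
  moreover have "Ck_on k U (\<lambda>x. frechet_derivative g (at x) v)" for k
    using U(4)[of "Suc k"] by simp
  ultimately show "\<exists>U h. open U \<and> x \<in> U \<and> (\<forall>k. Ck_on k U h) \<and> (\<forall>y\<in>U \<inter> S. h y = half_deriv f y v)"
    by (intro exI[of _ U] exI[of _ "\<lambda>x. frechet_derivative g (at x) v"]) auto
qed

text \<open>Near the point, first derivatives of \<open>f\<close> within the half-space coincide
  with those of one smooth extension, so the mixed derivatives are those of the extension, where the
  classical symmetry applies.\<close>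

lemma half_deriv_symmetric:
  fixes f :: "real^4 \<Rightarrow> real"
  assumes "smooth_on S f" "relopen S" "x \<in> S"
  shows "half_deriv (\<lambda>y. half_deriv f y u) x v = half_deriv (\<lambda>y. half_deriv f y v) x u"
proof -
  from smooth_on_relopenE[OF assms] obtain U g where U: "open U" "x \<in> U"
    "U \<inter> half_space \<subseteq> S" "\<And>k. Ck_on k U g"
    "\<And>y. y \<in> U \<inter> half_space \<Longrightarrow> half_deriv f y = frechet_derivative g (at y)" by metis
  have x: "x \<in> half_space" using assms openin_imp_subset by blast
  have "half_deriv (\<lambda>y. half_deriv f y w) x = frechet_derivative (\<lambda>y. frechet_derivative g (at y) w) (at x)" for w
  proof (rule half_deriv_eqI[OF _ x], rule has_derivative_transform_relopen[OF _ U(1,2) x])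
    have "Ck_on (Suc 0) U (\<lambda>y. frechet_derivative g (at y) w)"
      using U(4)[of "Suc (Suc 0)"] unfolding Ck_on.simps(2)[of "Suc 0"] by blast
    from Ck_on_has_derivative[OF this U(2)]
    show "((\<lambda>y. frechet_derivative g (at y) w) has_derivative
        frechet_derivative (\<lambda>y. frechet_derivative g (at y) w) (at x)) (at x within half_space)"
      by (rule has_derivative_at_withinI)
  qed (use U(5) in simp)
  then show ?thesis using second_derivative_symmetric[OF U(4) U(1,2)] by simp
qed

lemma half_deriv_cong:
  assumes S: "relopen S" "x \<in> S" and eq: "\<And>y. y \<in> S \<Longrightarrow> f y = g y"
  shows "half_deriv f x = half_deriv g x"
proof -
  obtain V where V: "open V" "S = half_space \<inter> V" using S(1) by (auto simp: openin_open)
  have "(f has_derivative d) (at x within half_space) \<longleftrightarrow> (g has_derivative d) (at x within half_space)" for d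
    using has_derivative_transform_relopen[of f d x half_space V g]
      has_derivative_transform_relopen[of g d x half_space V f] V S(2) eq by auto
  then show ?thesis by (simp add: frechet_derivative_def)
qed

section \<open>Alternating forms of low degree\<close>

text \<open>Forms take infinite sequences of vectors. \<open>ev1\<close> to \<open>ev4\<close> pad
  the sequence with its last entry, which is harmless because an alternating form ignores entries
  beyond its degree. With them identities of forms become polynomial identities between real
  numbers.\<close>

definition ev1 :: "((nat \<Rightarrow> 'v) \<Rightarrow> real) \<Rightarrow> 'v \<Rightarrow> real" where
  "ev1 w a = w (\<lambda>_. a)"

definition ev2 :: "((nat \<Rightarrow> 'v) \<Rightarrow> real) \<Rightarrow> 'v \<Rightarrow> 'v \<Rightarrow> real" where
  "ev2 w a b = w (\<lambda>i. if i = 0 then a else b)"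

definition ev3 :: "((nat \<Rightarrow> 'v) \<Rightarrow> real) \<Rightarrow> 'v \<Rightarrow> 'v \<Rightarrow> 'v \<Rightarrow> real" where
  "ev3 w a b c = w (\<lambda>i. if i = 0 then a else if i = 1 then b else c)"

definition ev4 :: "((nat \<Rightarrow> 'v) \<Rightarrow> real) \<Rightarrow> 'v \<Rightarrow> 'v \<Rightarrow> 'v \<Rightarrow> 'v \<Rightarrow> real" where
  "ev4 w a b c d = w (\<lambda>i. if i = 0 then a else if i = 1 then b else if i = 2 then c else d)"

lemma less_2_nat: "(i::nat) < 2 \<longleftrightarrow> i = 0 \<or> i = 1"
  and less_3_nat: "(i::nat) < 3 \<longleftrightarrow> i = 0 \<or> i = 1 \<or> i = 2"
  and less_4_nat: "(i::nat) < 4 \<longleftrightarrow> i = 0 \<or> i = 1 \<or> i = 2 \<or> i = 3"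
  by auto

lemma alternating_form_cong:
  "alternating_form k w \<Longrightarrow> (\<And>i. i < k \<Longrightarrow> v i = v' i) \<Longrightarrow> w v = w v'"
  unfolding alternating_form_def by blast

lemma alternating_form_linear:
  "alternating_form k w \<Longrightarrow> i < k \<Longrightarrow> linear (\<lambda>u. w (v(i := u)))"
  unfolding alternating_form_def by blast

lemma alternating_form_zero:
  "alternating_form k w \<Longrightarrow> i < j \<Longrightarrow> j < k \<Longrightarrow> v i = v j \<Longrightarrow> w v = 0"
  unfolding alternating_form_def by blast

text \<open>Polarisation: inserting a + b in both slots gives 0, and bilinear expansion leaves only
  the two mixed terms.\<close>

lemma alternating_form_swap:
  assumes w: "alternating_form k w" and ij: "i < j" "j < k"
  shows "w (v(i := a, j := b)) = - w (v(i := b, j := a))"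
proof -
  have li: "linear (\<lambda>u. w (v(j := y, i := u)))" for y
    using alternating_form_linear[OF w, of i "v(j := y)"] ij by simp
  have lj: "linear (\<lambda>u. w (v(i := x, j := u)))" for x
    using alternating_form_linear[OF w, of j "v(i := x)"] ij by simp
  have tw: "v(i := x, j := y) = v(j := y, i := x)" for x y using ij by (auto simp: fun_eq_iff)
  have z: "w (v(i := x, j := x)) = 0" for x
    by (rule alternating_form_zero[OF w ij]) (use ij in auto)
  have "0 = w (v(i := a + b, j := a + b))" by (simp add: z)
  also have "\<dots> = w (v(i := a + b, j := a)) + w (v(i := a + b, j := b))"
    using linear_add[OF lj] .
  also have "\<dots> = w (v(i := a, j := a)) + w (v(i := b, j := a)) + (w (v(i := a, j := b)) + w (v(i := b, j := b)))"
    unfolding tw linear_add[OF li] ..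
  also have "\<dots> = w (v(i := b, j := a)) + w (v(i := a, j := b))" by (simp add: z)
  finally show ?thesis by simp
qed

lemma ev1: "alternating_form 1 w \<Longrightarrow> w v = ev1 w (v 0)"
  unfolding ev1_def by (rule alternating_form_cong) auto

lemma ev2: "alternating_form 2 w \<Longrightarrow> w v = ev2 w (v 0) (v 1)"
  unfolding ev2_def by (rule alternating_form_cong) (auto simp: less_2_nat)

lemma ev3: "alternating_form 3 w \<Longrightarrow> w v = ev3 w (v 0) (v 1) (v 2)"
  unfolding ev3_def by (rule alternating_form_cong) (auto simp: less_3_nat)

lemma ev4: "alternating_form 4 w \<Longrightarrow> w v = ev4 w (v 0) (v 1) (v 2) (v 3)"
  unfolding ev4_def by (rule alternating_form_cong) (auto simp: less_4_nat)

lemma linear_ev1: "alternating_form 1 w \<Longrightarrow> linear (ev1 w)"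
  using alternating_form_linear[of 1 w 0 "\<lambda>_. 0"]
  by (simp add: ev1[of w "_(0 := _)"])

lemma linear_ev2:
  assumes "alternating_form 2 w"
  shows "linear (\<lambda>a. ev2 w a b)" "linear (ev2 w a)"
  using alternating_form_linear[OF assms, of 0 "\<lambda>_. b"] alternating_form_linear[OF assms, of 1 "\<lambda>_. a"]
  by (simp_all add: ev2[OF assms])

lemma ev2_alt:
  assumes "alternating_form 2 w"
  shows "ev2 w a a = 0" "ev2 w a b = - ev2 w b a"
  using alternating_form_zero[OF assms, of 0 1 "\<lambda>_. a"]
    alternating_form_swap[OF assms, of 0 1 "\<lambda>_. a" a b] by (simp_all add: ev2[OF assms])

lemma ev3_alt:
  assumes "alternating_form 3 w"
  shows "ev3 w a a c = 0" "ev3 w a c a = 0" "ev3 w c a a = 0"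
    "ev3 w a b c = - ev3 w b a c" "ev3 w a b c = - ev3 w a c b"
  using alternating_form_zero[OF assms, of 0 1 "(\<lambda>_. a)(2 := c)"]
    alternating_form_zero[OF assms, of 0 2 "(\<lambda>_. a)(1 := c)"]
    alternating_form_zero[OF assms, of 1 2 "(\<lambda>_. a)(0 := c)"]
    alternating_form_swap[OF assms, of 0 1 "\<lambda>_. c" a b]
    alternating_form_swap[OF assms, of 1 2 "\<lambda>_. a" b c] by (simp_all add: ev3[OF assms])

lemma ev4_linear:
  assumes "alternating_form 4 w"
  shows "linear (\<lambda>a. ev4 w a b c d)" "linear (\<lambda>b. ev4 w a b c d)"
    "linear (\<lambda>c. ev4 w a b c d)" "linear (\<lambda>d. ev4 w a b c d)"
  using alternating_form_linear[OF assms, of 0 "(\<lambda>_. b)(2 := c, 3 := d)"]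
    alternating_form_linear[OF assms, of 1 "(\<lambda>_. a)(2 := c, 3 := d)"]
    alternating_form_linear[OF assms, of 2 "(\<lambda>_. a)(1 := b, 3 := d)"]
    alternating_form_linear[OF assms, of 3 "(\<lambda>_. a)(1 := b, 2 := c)"]
  by (simp_all add: ev4[OF assms])

lemma ev4_alt:
  assumes "alternating_form 4 w"
  shows "ev4 w a a c d = 0" "ev4 w a c a d = 0" "ev4 w a c d a = 0"
    "ev4 w c a a d = 0" "ev4 w c a d a = 0" "ev4 w c d a a = 0"
    "ev4 w a b c d = - ev4 w b a c d" "ev4 w a b c d = - ev4 w a c b d" "ev4 w a b c d = - ev4 w a b d c"
  using alternating_form_zero[OF assms, of 0 1 "(\<lambda>_. a)(2 := c, 3 := d)"]
    alternating_form_zero[OF assms, of 0 2 "(\<lambda>_. a)(1 := c, 3 := d)"]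
    alternating_form_zero[OF assms, of 0 3 "(\<lambda>_. a)(1 := c, 2 := d)"]
    alternating_form_zero[OF assms, of 1 2 "(\<lambda>_. a)(0 := c, 3 := d)"]
    alternating_form_zero[OF assms, of 1 3 "(\<lambda>_. a)(0 := c, 2 := d)"]
    alternating_form_zero[OF assms, of 2 3 "(\<lambda>_. a)(0 := c, 1 := d)"]
    alternating_form_swap[OF assms, of 0 1 "(\<lambda>_. c)(3 := d)" a b]
    alternating_form_swap[OF assms, of 1 2 "(\<lambda>_. a)(3 := d)" b c]
    alternating_form_swap[OF assms, of 2 3 "(\<lambda>_. a)(1 := b)" c d]
  by (simp_all add: ev4[OF assms])

subsection \<open>Explicit wedge products\<close>

lemma lessThan_nat_eqs: "{..<2::nat} = {0, 1}" "{..<3::nat} = {0, 1, 2}" "{..<4::nat} = {0, 1, 2, 3}"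
  by auto

text \<open>These rules enumerate the permutations of an explicit finite set as products of
  transpositions, whose signs are then known; the general wedge product thereby unfolds into
  explicit terms.\<close>

lemmas perm_sum_simps = sum_over_permutations_insert permutes_sing sign_compose sign_swap_id
  permutation_swap_id permutation_compose sign_id

lemma wedge_1_1:
  assumes "alternating_form 1 (\<omega> c x)" "alternating_form 1 (\<eta> c x)"
  shows "wedge 1 1 \<omega> \<eta> c x v =
    ev1 (\<omega> c x) (v 0) * ev1 (\<eta> c x) (v 1) - ev1 (\<omega> c x) (v 1) * ev1 (\<eta> c x) (v 0)"
  unfolding wedge_def
  by (simp add: lessThan_nat_eqs perm_sum_simps ev1[OF assms(1)] ev1[OF assms(2)] transpose_def numeral_2_eq_2[symmetric])

lemma wedge_1_2:
  assumes "alternating_form 1 (\<omega> c x)" "alternating_form 2 (\<eta> c x)"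
  shows "wedge 1 2 \<omega> \<eta> c x v =
    ev1 (\<omega> c x) (v 0) * ev2 (\<eta> c x) (v 1) (v 2) - ev1 (\<omega> c x) (v 1) * ev2 (\<eta> c x) (v 0) (v 2) +
    ev1 (\<omega> c x) (v 2) * ev2 (\<eta> c x) (v 0) (v 1)"
  unfolding wedge_def
  using ev2_alt(2)[OF assms(2), of "v 1" "v 0"] ev2_alt(2)[OF assms(2), of "v 2" "v 0"] ev2_alt(2)[OF assms(2), of "v 2" "v 1"]
  by (simp add: lessThan_nat_eqs perm_sum_simps ev1[OF assms(1)] ev2[OF assms(2)] transpose_def numeral_2_eq_2[symmetric])

lemma wedge_2_1:
  assumes "alternating_form 2 (\<omega> c x)" "alternating_form 1 (\<eta> c x)"
  shows "wedge 2 1 \<omega> \<eta> c x v =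
    ev2 (\<omega> c x) (v 0) (v 1) * ev1 (\<eta> c x) (v 2) - ev2 (\<omega> c x) (v 0) (v 2) * ev1 (\<eta> c x) (v 1) +
    ev2 (\<omega> c x) (v 1) (v 2) * ev1 (\<eta> c x) (v 0)"
  unfolding wedge_def
  using ev2_alt(2)[OF assms(1), of "v 1" "v 0"] ev2_alt(2)[OF assms(1), of "v 2" "v 0"] ev2_alt(2)[OF assms(1), of "v 2" "v 1"]
  by (simp add: lessThan_nat_eqs perm_sum_simps ev2[OF assms(1)] ev1[OF assms(2)] transpose_def numeral_2_eq_2[symmetric])

text \<open>The 24 permutations fall into groups of four with equal contribution, by antisymmetry
  within each factor. This cancels 2! 2! and leaves the six shuffles. The supplied instances of
  antisymmetry sort the arguments so that equal contributions become syntactically equal.\<close>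

lemma wedge_2_2:
  assumes "alternating_form 2 (\<omega> c x)" "alternating_form 2 (\<eta> c x)"
  shows "wedge 2 2 \<omega> \<eta> c x v =
    ev2 (\<omega> c x) (v 0) (v 1) * ev2 (\<eta> c x) (v 2) (v 3) - ev2 (\<omega> c x) (v 0) (v 2) * ev2 (\<eta> c x) (v 1) (v 3) +
    ev2 (\<omega> c x) (v 0) (v 3) * ev2 (\<eta> c x) (v 1) (v 2) + ev2 (\<omega> c x) (v 1) (v 2) * ev2 (\<eta> c x) (v 0) (v 3) -
    ev2 (\<omega> c x) (v 1) (v 3) * ev2 (\<eta> c x) (v 0) (v 2) + ev2 (\<omega> c x) (v 2) (v 3) * ev2 (\<eta> c x) (v 0) (v 1)"
  unfolding wedge_def
  using ev2_alt(2)[OF assms(1), of "v 1" "v 0"] ev2_alt(2)[OF assms(1), of "v 2" "v 0"] ev2_alt(2)[OF assms(1), of "v 2" "v 1"]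
    ev2_alt(2)[OF assms(1), of "v 3" "v 0"] ev2_alt(2)[OF assms(1), of "v 3" "v 1"] ev2_alt(2)[OF assms(1), of "v 3" "v 2"]
    ev2_alt(2)[OF assms(2), of "v 1" "v 0"] ev2_alt(2)[OF assms(2), of "v 2" "v 0"] ev2_alt(2)[OF assms(2), of "v 2" "v 1"]
    ev2_alt(2)[OF assms(2), of "v 3" "v 0"] ev2_alt(2)[OF assms(2), of "v 3" "v 1"] ev2_alt(2)[OF assms(2), of "v 3" "v 2"]
  by (simp add: lessThan_nat_eqs perm_sum_simps ev2[OF assms(1)] ev2[OF assms(2)] transpose_def numeral_2_eq_2[symmetric])

lemma wedge_3_1:
  assumes "alternating_form 3 (\<omega> c x)" "alternating_form 1 (\<eta> c x)"
  shows "wedge 3 1 \<omega> \<eta> c x v =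
    ev3 (\<omega> c x) (v 0) (v 1) (v 2) * ev1 (\<eta> c x) (v 3) - ev3 (\<omega> c x) (v 0) (v 1) (v 3) * ev1 (\<eta> c x) (v 2) +
    ev3 (\<omega> c x) (v 0) (v 2) (v 3) * ev1 (\<eta> c x) (v 1) - ev3 (\<omega> c x) (v 1) (v 2) (v 3) * ev1 (\<eta> c x) (v 0)"
proof -
  let ?w = "ev3 (\<omega> c x)"
  have p: "?w a c b = - ?w a b c" "?w b a c = - ?w a b c" "?w b c a = ?w a b c" "?w c a b = ?w a b c"
    "?w c b a = - ?w a b c" for a b c
    using ev3_alt(4,5)[OF assms(1)] by (metis minus_minus)+
  note q = p[where a="v 0" and b="v 1" and c="v 2"] p[where a="v 0" and b="v 1" and c="v 3"]
    p[where a="v 0" and b="v 2" and c="v 3"] p[where a="v 1" and b="v 2" and c="v 3"]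
  \<comment> \<open>The simplifier rewrites the index 1 to \<open>Suc 0\<close>, so the equations
    have to be brought into that form to match.\<close>
  note q = q[unfolded One_nat_def]
  show ?thesis
    unfolding wedge_def
    by (simp add: lessThan_nat_eqs perm_sum_simps ev3[OF assms(1)] ev1[OF assms(2)] transpose_def
        numeral_2_eq_2[symmetric] q fact_numeral)
qed

subsection \<open>Closure properties of alternating forms\<close>

lemma alternating_form_add:
  assumes "alternating_form k w" "alternating_form k w'"
  shows "alternating_form k (\<lambda>v. w v + w' v)"
  unfolding alternating_form_def
proof (intro conjI allI impI)
  show "linear (\<lambda>u. w (v(i := u)) + w' (v(i := u)))" if "i < k" for v i
    by (intro linear_compose_add alternating_form_linear[OF _ that] assms)
  show "w v + w' v = w v' + w' v'" if "\<forall>i<k. v i = v' i" for v v'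
    using alternating_form_cong[OF assms(1), of v v'] alternating_form_cong[OF assms(2), of v v'] that by simp
  show "w v + w' v = 0" if "i < j \<and> j < k \<and> v i = v j" for v i j
    using alternating_form_zero[OF assms(1), of i j v] alternating_form_zero[OF assms(2), of i j v] that by simp
qed

lemma alternating_form_scale:
  assumes "alternating_form k w"
  shows "alternating_form k (\<lambda>v. r * w v)"
  unfolding alternating_form_def
proof (intro conjI allI impI)
  show "linear (\<lambda>u. r * w (v(i := u)))" if "i < k" for v i
    using linear_compose_scale_right[OF alternating_form_linear[OF assms that], of r v] by simp
  show "r * w v = r * w v'" if "\<forall>i<k. v i = v' i" for v v'
    using alternating_form_cong[OF assms, of v v'] that by simp
  show "r * w v = 0" if "i < j \<and> j < k \<and> v i = v j" for v i j
    using alternating_form_zero[OF assms, of i j v] that by simp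
qed

text \<open>For a fixed permutation \<sigma>, the vector in slot \<open>m\<close> is used in the
  single position \<open>inv \<sigma> m\<close>, which belongs to either the first or the second
  factor; linearity is inherited from that factor. When two vectors coincide, composing \<sigma>
  with their transposition changes only the sign, so the sum equals its own negative.\<close>

lemma alternating_form_wedge:
  assumes \<omega>: "alternating_form k (\<omega> c x)" and \<eta>: "alternating_form l (\<eta> c x)"
  shows "alternating_form (k + l) (wedge k l \<omega> \<eta> c x)"
proof -
  define f where "f v \<sigma> = of_int (sign \<sigma>) * \<omega> c x (\<lambda>i. v (\<sigma> i)) * \<eta> c x (\<lambda>i. v (\<sigma> (k + i)))" for v \<sigma>
  have W: "wedge k l \<omega> \<eta> c x = (\<lambda>v. inverse (fact k * fact l) * (\<Sum>\<sigma> | \<sigma> permutes {..<k + l}. f v \<sigma>))"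
    by (simp add: wedge_def f_def divide_inverse mult.commute fun_eq_iff)
  show ?thesis
    unfolding W
  proof (rule alternating_form_scale, unfold alternating_form_def, intro conjI allI impI)
    fix v v' :: "nat \<Rightarrow> real^'a" assume v: "\<forall>i<k + l. v i = v' i"
    have "f v \<sigma> = f v' \<sigma>" if \<sigma>: "\<sigma> permutes {..<k + l}" for \<sigma>
    proof -
      have less: "i < k + l \<Longrightarrow> \<sigma> i < k + l" for i using permutes_in_image[OF \<sigma>, of i] by simp
      have "\<omega> c x (\<lambda>i. v (\<sigma> i)) = \<omega> c x (\<lambda>i. v' (\<sigma> i))"
        by (rule alternating_form_cong[OF \<omega>]) (use v less in auto)
      moreover have "\<eta> c x (\<lambda>i. v (\<sigma> (k + i))) = \<eta> c x (\<lambda>i. v' (\<sigma> (k + i)))"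
        by (rule alternating_form_cong[OF \<eta>]) (use v less in auto)
      ultimately show ?thesis by (simp add: f_def)
    qed
    then show "(\<Sum>\<sigma> | \<sigma> permutes {..<k + l}. f v \<sigma>) = (\<Sum>\<sigma> | \<sigma> permutes {..<k + l}. f v' \<sigma>)"
      by simp
  next
    fix v :: "nat \<Rightarrow> real^'a" and m assume m: "m < k + l"
    show "linear (\<lambda>u. \<Sum>\<sigma> | \<sigma> permutes {..<k + l}. f (v(m := u)) \<sigma>)"
    proof (rule linear_compose_sum, rule ballI)
      fix \<sigma> assume "\<sigma> \<in> {\<sigma>. \<sigma> permutes {..<k + l}}"
      then have \<sigma>: "\<sigma> permutes {..<k + l}" by simp
      define n where "n = inv \<sigma> m"
      have n: "\<sigma> i = m \<longleftrightarrow> i = n" for i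
        using permutes_inverses[OF \<sigma>] by (metis n_def)
      have "n < k + l" using permutes_in_image[OF permutes_inv[OF \<sigma>], of m] m by (simp add: n_def)
      show "linear (\<lambda>u. f (v(m := u)) \<sigma>)"
      proof (cases "n < k")
        case True
        have "(\<lambda>i. (v(m := u)) (\<sigma> i)) = (\<lambda>i. v (\<sigma> i))(n := u)"
          "(\<lambda>i. (v(m := u)) (\<sigma> (k + i))) = (\<lambda>i. v (\<sigma> (k + i)))" for u
          using n True by (auto simp: fun_eq_iff)
        then have "f (v(m := u)) \<sigma> = (of_int (sign \<sigma>) * \<eta> c x (\<lambda>i. v (\<sigma> (k + i)))) *\<^sub>R \<omega> c x ((\<lambda>i. v (\<sigma> i))(n := u))" for u
          by (simp add: f_def)
        then show ?thesis
          using linear_compose_scale_right[OF alternating_form_linear[OF \<omega> True]] by simp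
      next
        case False
        have "(\<lambda>i. (v(m := u)) (\<sigma> i)) = (\<lambda>i. v (\<sigma> i))(n := u)"
          "(\<lambda>i. (v(m := u)) (\<sigma> (k + i))) = (\<lambda>i. v (\<sigma> (k + i)))(n - k := u)" for u
          using n False by (auto simp: fun_eq_iff)
        moreover have "\<omega> c x ((\<lambda>i. v (\<sigma> i))(n := u)) = \<omega> c x (\<lambda>i. v (\<sigma> i))" for u
          by (rule alternating_form_cong[OF \<omega>]) (use False in auto)
        ultimately have "f (v(m := u)) \<sigma> = (of_int (sign \<sigma>) * \<omega> c x (\<lambda>i. v (\<sigma> i))) *\<^sub>R \<eta> c x ((\<lambda>i. v (\<sigma> (k + i)))(n - k := u))" for u
          by (simp add: f_def)
        moreover have "n - k < l" using False \<open>n < k + l\<close> by simp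
        ultimately show ?thesis
          using linear_compose_scale_right[OF alternating_form_linear[OF \<eta>]] by simp
      qed
    qed
  next
    fix v :: "nat \<Rightarrow> real^'a" and i j assume ij: "i < j \<and> j < k + l \<and> v i = v j"
    let ?t = "Transposition.transpose i j"
    have t: "?t permutes {..<k + l}" using ij by (intro permutes_swap_id) auto
    have vt: "v (?t m) = v m" for m using ij by (auto simp: Transposition.transpose_def)
    have "f v (?t \<circ> \<sigma>) = - f v \<sigma>" if \<sigma>: "\<sigma> permutes {..<k + l}" for \<sigma>
    proof -
      have "sign (?t \<circ> \<sigma>) = - sign \<sigma>"
        using ij permutes_imp_permutation[OF _ \<sigma>]
        by (simp add: sign_compose permutation_swap_id sign_swap_id)
      then show ?thesis by (simp add: f_def vt)
    qed
    then have "(\<Sum>\<sigma> | \<sigma> permutes {..<k + l}. f v \<sigma>) = - (\<Sum>\<sigma> | \<sigma> permutes {..<k + l}. f v \<sigma>)"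
      by (subst setum_permutations_compose_left[OF t]) (simp add: sum_negf)
    then show "(\<Sum>\<sigma> | \<sigma> permutes {..<k + l}. f v \<sigma>) = 0" by simp
  qed
qed

subsection \<open>Top-degree forms and determinants\<close>

lemma std_frame_simps: "std_frame 0 = axis 1 1" "std_frame 1 = axis 2 1" "std_frame 2 = axis 3 1" "std_frame 3 = axis 4 1"
  by (simp_all add: std_frame_def)


lemma det_4:
  fixes A :: "real^4^4"
  shows "det A = (\<Sum>\<sigma> | \<sigma> permutes {1, 2, 3, 4}. of_int (sign \<sigma>) * (A$1$\<sigma> 1 * A$2$\<sigma> 2 * A$3$\<sigma> 3 * A$4$\<sigma> 4))"
  unfolding det_def UNIV_4 by (simp add: mult.assoc)

text \<open>Multilinear expansion in the columns of \<open>L\<close> produces a sum over four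
  indices. Terms with a repeated index vanish, the others are signed copies of the value on the
  standard frame, and the signs assemble the determinant of the transposed matrix.\<close>

lemma alternating_form_4_det:
  fixes w :: "(nat \<Rightarrow> real^4) \<Rightarrow> real"
  assumes w: "alternating_form 4 w" and L: "linear L"
  shows "w (\<lambda>i. L (std_frame i)) = det (matrix L) * w std_frame"
proof -
  define W where "W i j k l = ev4 w (axis i 1) (axis j 1) (axis k 1) (axis l 1)" for i j k l :: 4
  have s: "ev4 w a b c d = (\<Sum>i\<in>UNIV. a $ i *\<^sub>R ev4 w (axis i 1) b c d)"
    "ev4 w a b c d = (\<Sum>i\<in>UNIV. b $ i *\<^sub>R ev4 w a (axis i 1) c d)"
    "ev4 w a b c d = (\<Sum>i\<in>UNIV. c $ i *\<^sub>R ev4 w a b (axis i 1) d)"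
    "ev4 w a b c d = (\<Sum>i\<in>UNIV. d $ i *\<^sub>R ev4 w a b c (axis i 1))" for a b c d
    by (rule linear_axis_expansion, rule ev4_linear[OF w])+
  have E: "ev4 w a b c d = (\<Sum>i\<in>UNIV. a $ i * (\<Sum>j\<in>UNIV. b $ j * (\<Sum>k\<in>UNIV. c $ k * (\<Sum>l\<in>UNIV. d $ l * W i j k l))))"
    for a b c d
    unfolding W_def
    by (subst s(1), subst s(2), subst s(3), subst s(4)) simp
  have z: "W i i k l = 0" "W i k i l = 0" "W i k l i = 0" "W k i i l = 0" "W k i l i = 0" "W k l i i = 0" for i k l
    unfolding W_def by (rule ev4_alt[OF w])+
  have sw: "W i j k l = - W j i k l" "W i j k l = - W i k j l" "W i j k l = - W i j l k" for i j k l
    unfolding W_def by (rule ev4_alt[OF w])+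
  \<comment> \<open>Only instances with descending neighbours are kept as rewrite rules, so
    simplification sorts the indices step by step and terminates.\<close>
  note sw' = sw(1)[of 2 1] sw(1)[of 3 1] sw(1)[of 4 1] sw(1)[of 3 2] sw(1)[of 4 2] sw(1)[of 4 3]
    sw(2)[of _ 2 1] sw(2)[of _ 3 1] sw(2)[of _ 4 1] sw(2)[of _ 3 2] sw(2)[of _ 4 2] sw(2)[of _ 4 3]
    sw(3)[of _ _ 2 1] sw(3)[of _ _ 3 1] sw(3)[of _ _ 4 1] sw(3)[of _ _ 3 2] sw(3)[of _ _ 4 2] sw(3)[of _ _ 4 3]
  define A where "A = matrix L"
  have A: "L (axis j 1) $ i = A $ i $ j" for i j by (simp add: A_def matrix_def)
  have "w (\<lambda>i. L (std_frame i)) = (\<Sum>i\<in>UNIV. A $ i $ 1 * (\<Sum>j\<in>UNIV. A $ j $ 2 * (\<Sum>k\<in>UNIV. A $ k $ 3 * (\<Sum>l\<in>UNIV. A $ l $ 4 * W i j k l))))"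
    by (subst ev4[OF w]) (simp only: std_frame_simps E A)
  also have "\<dots> = det (transpose A) * W 1 2 3 4"
    unfolding det_4
    by (simp add: sum_4 z sw' perm_sum_simps Transposition.transpose_def Finite_Cartesian_Product.transpose_def algebra_simps)
  also have "W 1 2 3 4 = w std_frame"
    by (subst ev4[OF w]) (simp only: std_frame_simps W_def)
  finally show ?thesis by (simp add: A_def det_transpose)
qed

section \<open>Calculus of forms on a manifold\<close>

lemma at_within_relopen:
  assumes "relopen S" "x \<in> S"
  shows "at x within S = at x within half_space"
proof -
  obtain V where V: "open V" "S = half_space \<inter> V" using assms(1) by (auto simp: openin_open)
  show ?thesis by (rule at_within_nhd[of x V]) (use V assms(2) in auto)
qed

section \<open>Rules of differentiation within the half-space\<close>

lemma half_deriv_add: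
  assumes "smooth_on S f" "smooth_on S g" "relopen S" "x \<in> S"
  shows "half_deriv (\<lambda>y. f y + g y) x v = half_deriv f x v + half_deriv g x v"
proof -
  have "half_deriv (\<lambda>y. f y + g y) x = (\<lambda>v. half_deriv f x v + half_deriv g x v)"
    using assms openin_imp_subset[OF assms(3)]
    by (intro half_deriv_eqI has_derivative_add smooth_on_has_half_deriv[of S]) auto
  then show ?thesis by simp
qed

lemma half_deriv_mult:
  fixes f g :: "real^4 \<Rightarrow> real"
  assumes "smooth_on S f" "smooth_on S g" "relopen S" "x \<in> S"
  shows "half_deriv (\<lambda>y. f y * g y) x v = f x * half_deriv g x v + half_deriv f x v * g x"
proof -
  have "half_deriv (\<lambda>y. f y * g y) x = (\<lambda>v. f x * half_deriv g x v + half_deriv f x v * g x)"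
    using assms openin_imp_subset[OF assms(3)]
    by (intro half_deriv_eqI has_derivative_mult smooth_on_has_half_deriv[of S]) auto
  then show ?thesis by simp
qed

lemma half_deriv_const:
  assumes "x \<in> half_space"
  shows "half_deriv (\<lambda>y. c) x v = 0"
  using half_deriv_eqI[OF has_derivative_const assms, of c] by simp

lemma half_deriv_cmult:
  fixes f :: "real^4 \<Rightarrow> real"
  assumes "smooth_on S f" "relopen S" "x \<in> S"
  shows "half_deriv (\<lambda>y. r * f y) x v = r * half_deriv f x v"
  using half_deriv_mult[OF smooth_on_const[of S r] assms] openin_imp_subset[OF assms(2)] assms(3)
  by (auto simp: half_deriv_const)

lemma half_deriv_diff:
  fixes f g :: "real^4 \<Rightarrow> real"
  assumes "smooth_on S f" "smooth_on S g" "relopen S" "x \<in> S"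
  shows "half_deriv (\<lambda>y. f y - g y) x v = half_deriv f x v - half_deriv g x v"
  using half_deriv_add[OF assms(1) smooth_on_mult[OF smooth_on_const[of S "-1"] assms(2)] assms(3,4)]
    half_deriv_cmult[OF assms(2-4), of "-1"] by simp

lemma half_deriv_sum:
  assumes "finite I" "\<And>i. i \<in> I \<Longrightarrow> smooth_on S (f i)" "relopen S" "x \<in> S"
  shows "half_deriv (\<lambda>y. \<Sum>i\<in>I. f i y) x v = (\<Sum>i\<in>I. half_deriv (f i) x v)"
  using assms(1,2)
proof (induction I rule: finite_induct)
  case empty
  then show ?case using half_deriv_const assms(3,4) openin_imp_subset by fastforce
next
  case (insert i I)
  have "half_deriv (\<lambda>y. f i y + (\<Sum>i\<in>I. f i y)) x v = half_deriv (f i) x v + half_deriv (\<lambda>y. \<Sum>i\<in>I. f i y) x v"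
    by (rule half_deriv_add[OF _ _ assms(3,4)]) (use insert in \<open>auto intro: smooth_on_sum\<close>)
  then show ?case using insert by simp
qed

lemma linear_half_deriv:
  assumes "smooth_on S f" "relopen S" "x \<in> S"
  shows "linear (half_deriv f x)"
  using smooth_on_has_half_deriv[OF assms] by (rule has_derivative_linear)

text \<open>The chain rule requires \<open>g\<close> to be differentiated within the image of
  \<open>f\<close>. Relatively open sets determine the same derivative as the half-space itself, so
  the computation is done within \<open>S\<close> and \<open>T\<close> and then transferred
  back.\<close>

lemma half_deriv_compose:
  assumes "smooth_on S f" "relopen S" "x \<in> S"
    and "smooth_on T g" "relopen T" "f ` S \<subseteq> T"
  shows "half_deriv (\<lambda>y. g (f y)) x v = half_deriv g (f x) (half_deriv f x v)"
proof -
  have x: "x \<in> half_space" using assms(2,3) openin_imp_subset by blast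
  have f: "(f has_derivative half_deriv f x) (at x within S)"
    using smooth_on_has_half_deriv[OF assms(1-3)] at_within_relopen[OF assms(2,3)] by simp
  have fx: "f x \<in> T" using assms by blast
  have "(g has_derivative half_deriv g (f x)) (at (f x) within T)"
    using smooth_on_has_half_deriv[OF assms(4,5) fx] at_within_relopen[OF assms(5) fx] by simp
  then have "(g has_derivative half_deriv g (f x)) (at (f x) within f ` S)"
    using assms(6) by (rule has_derivative_subset)
  from has_derivative_in_compose[OF f this]
  have "half_deriv (\<lambda>y. g (f y)) x = (\<lambda>v. half_deriv g (f x) (half_deriv f x v))"
    unfolding at_within_relopen[OF assms(2,3)] by (rule half_deriv_eqI[OF _ x])
  then show ?thesis by simp
qed

lemma half_deriv_component:
  fixes f :: "real^4 \<Rightarrow> real^'n"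
  assumes "smooth_on S f" "relopen S" "x \<in> S"
  shows "half_deriv f x v $ k = half_deriv (\<lambda>y. f y $ k) x v"
proof -
  have x: "x \<in> half_space" using assms(2,3) openin_imp_subset by blast
  have "((\<lambda>y. f y $ k) has_derivative (\<lambda>v. half_deriv f x v $ k)) (at x within half_space)"
    using bounded_linear.has_derivative[OF bounded_linear_vec_nth smooth_on_has_half_deriv[OF assms]] .
  then show ?thesis using half_deriv_eqI[OF _ x] by metis
qed

lemma eps_wedge_apply:
  "eps_wedge k l \<phi> \<psi> i = (\<lambda>c x v. \<Sum>j\<in>UNIV. \<Sum>m\<in>UNIV. levi_civita i j m * wedge k l (\<phi> j) (\<psi> m) c x v)"
  by (simp add: eps_wedge_def sum_3 form_scale_def fun_eq_iff)

section \<open>Charts, overlaps and transition maps of an oriented manifold with boundary\<close>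

locale oriented_manifold =
  fixes X :: "'a topology" and \<A> :: "('a, 4) chart set"
  assumes oriented_manifold: "oriented_smooth_4_manifold X \<A>"
begin

lemma hausdorff: "Hausdorff_space X"
  and charts_cover: "(\<Union>c\<in>\<A>. fst c) = topspace X"
  using oriented_manifold by (auto simp: oriented_smooth_4_manifold_def smooth_manifold_def)

context
  fixes c assumes c: "c \<in> \<A>"
begin

lemma chart_domain_open: "openin X (fst c)"
  and chart_image_open: "relopen (chart_image c)"
  and chart_homeomorphic: "homeomorphic_map (subtopology X (fst c)) (top_of_set (chart_image c)) (snd c)"
  using oriented_manifold c by (auto simp: oriented_smooth_4_manifold_def smooth_manifold_def)

lemma chart_domain_subset: "fst c \<subseteq> topspace X"
  using chart_domain_open by (rule openin_subset)

lemma chart_image_half_space: "x \<in> chart_image c \<Longrightarrow> x \<in> half_space"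
  using openin_imp_subset[OF chart_image_open] by blast

lemma chart_inj: "inj_on (snd c) (fst c)"
  using homeomorphic_imp_injective_map[OF chart_homeomorphic] chart_domain_subset
  by (simp add: Int_absorb1)

lemma chart_inv_chart [simp]: "p \<in> fst c \<Longrightarrow> chart_inv c (snd c p) = p"
  unfolding chart_inv_def by (rule inv_into_f_f[OF chart_inj])

lemma chart_mem_image [simp]: "p \<in> fst c \<Longrightarrow> snd c p \<in> chart_image c"
  by (simp add: chart_image_def)

lemma chart_inv_mem [simp]: "x \<in> chart_image c \<Longrightarrow> chart_inv c x \<in> fst c"
  and chart_chart_inv [simp]: "x \<in> chart_image c \<Longrightarrow> snd c (chart_inv c x) = x"
  by (auto simp: chart_image_def)

lemma openin_chart_image:
  assumes "openin X W" "W \<subseteq> fst c"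
  shows "relopen (snd c ` W)"
proof -
  have "openin (subtopology X (fst c)) W" using assms by (simp add: openin_subset_topspace_eq openin_open_subtopology chart_domain_open)
  then have "openin (top_of_set (chart_image c)) (snd c ` W)"
    using homeomorphic_imp_open_map[OF chart_homeomorphic] by (simp add: open_map_def)
  then show ?thesis using chart_image_open openin_trans by blast
qed

lemma openin_chart_preimage:
  assumes "relopen V"
  shows "openin X {p \<in> fst c. snd c p \<in> V}"
proof -
  have "openin (top_of_set (chart_image c)) (V \<inter> chart_image c)"
    using assms by (metis Int_commute chart_image_open openin_Int openin_subset_trans openin_imp_subset Int_lower1)
  then have "openin (subtopology X (fst c)) {p \<in> topspace (subtopology X (fst c)). snd c p \<in> V \<inter> chart_image c}"
    using homeomorphic_imp_continuous_map[OF chart_homeomorphic] openin_continuous_map_preimage by blast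
  moreover have "{p \<in> topspace (subtopology X (fst c)). snd c p \<in> V \<inter> chart_image c} = {p \<in> fst c. snd c p \<in> V}"
    using chart_domain_subset by auto
  ultimately show ?thesis using chart_domain_open openin_open_subtopology by metis
qed

end

definition overlap :: "('a, 4) chart \<Rightarrow> ('a, 4) chart \<Rightarrow> (real^4) set" where
  "overlap c d = snd c ` (fst c \<inter> fst d)"

context
  fixes c d assumes c: "c \<in> \<A>" and d: "d \<in> \<A>"
begin

lemma overlap_open: "relopen (overlap c d)"
  unfolding overlap_def by (intro openin_chart_image c openin_Int chart_domain_open d) auto

lemma overlap_subset: "overlap c d \<subseteq> chart_image c"
  by (auto simp: overlap_def chart_image_def)

lemma overlap_iff: "x \<in> overlap c d \<longleftrightarrow> x \<in> chart_image c \<and> chart_inv c x \<in> fst d"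
  using c by (auto simp: overlap_def image_iff chart_image_def)

lemma transition_chart [simp]: "p \<in> fst c \<Longrightarrow> transition c d (snd c p) = snd d p"
  using c by (simp add: local_rep_def)

lemma chart_inv_transition [simp]: "x \<in> overlap c d \<Longrightarrow> chart_inv d (transition c d x) = chart_inv c x"
  using c d by (auto simp: overlap_def)

lemma transition_mem: "x \<in> overlap c d \<Longrightarrow> transition c d x \<in> overlap d c"
  using c d by (auto simp: overlap_def)

lemma smooth_transition: "smooth_on (overlap c d) (transition c d)"
  using oriented_manifold c d by (auto simp: oriented_smooth_4_manifold_def smooth_manifold_def overlap_def)

lemma det_transition_pos: "x \<in> overlap c d \<Longrightarrow> 0 < det (matrix (half_deriv (transition c d) x))"
  using oriented_manifold c d by (auto simp: oriented_smooth_4_manifold_def oriented_atlas_def overlap_def)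

lemma linear_transition_deriv: "x \<in> overlap c d \<Longrightarrow> linear (half_deriv (transition c d) x)"
  using linear_half_deriv[OF smooth_transition overlap_open] .

end

text \<open>The cocycle law for Jacobians: on the triple overlap the direct transition map is the
  composite of the other two. It is what makes the test forms below independent of the
  chart.\<close>

lemma half_deriv_transition_comp:
  assumes "c \<in> \<A>" "d \<in> \<A>" "e \<in> \<A>" "p \<in> fst c" "p \<in> fst d" "p \<in> fst e"
  shows "half_deriv (transition c e) (snd c p) v =
    half_deriv (transition d e) (snd d p) (half_deriv (transition c d) (snd c p) v)"
proof -
  let ?S = "overlap c d \<inter> overlap c e"
  have S: "relopen ?S" by (intro openin_Int overlap_open assms)
  have x: "snd c p \<in> ?S" using assms by (auto simp: overlap_def)
  have "half_deriv (transition c e) (snd c p) v = half_deriv (\<lambda>y. transition d e (transition c d y)) (snd c p) v"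
    by (rule half_deriv_cong[OF S x, THEN fun_cong]) (use assms in \<open>auto simp: overlap_iff local_rep_def\<close>)
  also have "\<dots> =
      half_deriv (transition d e) (transition c d (snd c p)) (half_deriv (transition c d) (snd c p) v)"
  proof (rule half_deriv_compose[OF _ S x smooth_transition overlap_open])
    show "smooth_on ?S (transition c d)"
      using smooth_transition[OF assms(1,2)] by (rule smooth_on_subset) auto
    show "transition c d ` ?S \<subseteq> overlap d e"
      using assms by (auto simp: overlap_iff local_rep_def)
  qed (use assms in auto)
  finally show ?thesis using assms by simp
qed

lemma half_deriv_transition_self:
  assumes "c \<in> \<A>" "x \<in> chart_image c"
  shows "half_deriv (transition c c) x v = v"
proof -
  have "half_deriv (transition c c) x = half_deriv (\<lambda>y. y) x"
    by (rule half_deriv_cong[OF chart_image_open[OF assms(1)] assms(2)]) (use assms in \<open>auto simp: local_rep_def\<close>)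
  also have "\<dots> = (\<lambda>v. v)"
    by (rule half_deriv_eqI[OF has_derivative_ident chart_image_half_space[OF assms]])
  finally show ?thesis by simp
qed

subsection \<open>Smooth forms\<close>

abbreviation sform :: "nat \<Rightarrow> ('a, 4) form \<Rightarrow> bool" where
  "sform \<equiv> smooth_form half_space \<A>"

lemma sform_alternating: "sform k \<omega> \<Longrightarrow> c \<in> \<A> \<Longrightarrow> x \<in> chart_image c \<Longrightarrow> alternating_form k (\<omega> c x)"
  and sform_smooth: "sform k \<omega> \<Longrightarrow> c \<in> \<A> \<Longrightarrow> smooth_on (chart_image c) (\<lambda>x. \<omega> c x v)"
  unfolding smooth_form_def by auto

lemma sform_transition:
  assumes "sform k \<omega>" "c \<in> \<A>" "d \<in> \<A>" "x \<in> overlap c d"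
  shows "\<omega> c x v = \<omega> d (transition c d x) (\<lambda>i. half_deriv (transition c d) x (v i))"
proof -
  obtain p where p: "p \<in> fst c \<inter> fst d" "x = snd c p" using assms(4) unfolding overlap_def by blast
  have "\<omega> c (snd c p) v = \<omega> d (snd d p) (\<lambda>i. half_deriv (transition c d) (snd c p) (v i))"
    using assms(1-3) p(1) unfolding smooth_form_def by blast
  then show ?thesis using assms(2,3) p by simp
qed

lemma sformI:
  assumes "\<And>c x. c \<in> \<A> \<Longrightarrow> x \<in> chart_image c \<Longrightarrow> alternating_form k (\<omega> c x)"
    and "\<And>c v. c \<in> \<A> \<Longrightarrow> smooth_on (chart_image c) (\<lambda>x. \<omega> c x v)"
    and "\<And>c d x v. c \<in> \<A> \<Longrightarrow> d \<in> \<A> \<Longrightarrow> x \<in> overlap c d \<Longrightarrow>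
      \<omega> c x v = \<omega> d (transition c d x) (\<lambda>i. half_deriv (transition c d) x (v i))"
  shows "sform k \<omega>"
  unfolding smooth_form_def
proof (intro conjI ballI allI)
  fix c d p v assume "c \<in> \<A>" "d \<in> \<A>" "p \<in> fst c \<inter> fst d"
  then show "\<omega> c (snd c p) v = \<omega> d (snd d p) (\<lambda>i. half_deriv (transition c d) (snd c p) (v i))"
    using assms(3)[of c d "snd c p" v] by (auto simp: overlap_def)
qed (use assms in auto)

lemma sform_add:
  assumes "sform k \<omega>" "sform k \<eta>" shows "sform k (\<omega> + \<eta>)"
  unfolding plus_fun_def
proof (rule sformI)
  show "alternating_form k (\<lambda>v. \<omega> c x v + \<eta> c x v)" if "c \<in> \<A>" "x \<in> chart_image c" for c x
    by (intro alternating_form_add sform_alternating assms that)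
  show "smooth_on (chart_image c) (\<lambda>x. \<omega> c x v + \<eta> c x v)" if "c \<in> \<A>" for c v
    by (rule smooth_on_add[OF sform_smooth[OF assms(1) that] sform_smooth[OF assms(2) that]])
  show "\<omega> c x v + \<eta> c x v = \<omega> d (transition c d x) (\<lambda>i. half_deriv (transition c d) x (v i)) +
      \<eta> d (transition c d x) (\<lambda>i. half_deriv (transition c d) x (v i))"
    if "c \<in> \<A>" "d \<in> \<A>" "x \<in> overlap c d" for c d x v
    using sform_transition[OF assms(1) that, of v] sform_transition[OF assms(2) that, of v] by simp
qed

definition fun_mult :: "('a \<Rightarrow> real) \<Rightarrow> ('a, 4) form \<Rightarrow> ('a, 4) form" where
  "fun_mult f \<omega> = (\<lambda>c x v. f (chart_inv c x) * \<omega> c x v)"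

lemma sform_fun_mult:
  assumes f: "smooth_function \<A> f" and \<omega>: "sform k \<omega>"
  shows "sform k (fun_mult f \<omega>)"
  unfolding fun_mult_def
proof (rule sformI)
  show "alternating_form k (\<lambda>v. f (chart_inv c x) * \<omega> c x v)" if "c \<in> \<A>" "x \<in> chart_image c" for c x
    by (intro alternating_form_scale sform_alternating \<omega> that)
  show "smooth_on (chart_image c) (\<lambda>x. f (chart_inv c x) * \<omega> c x v)" if "c \<in> \<A>" for c v
    using f that by (intro smooth_on_mult sform_smooth[OF \<omega>]) (auto simp: smooth_function_def o_def)
  show "f (chart_inv c x) * \<omega> c x v = f (chart_inv d (transition c d x)) *
      \<omega> d (transition c d x) (\<lambda>i. half_deriv (transition c d) x (v i))"
    if "c \<in> \<A>" "d \<in> \<A>" "x \<in> overlap c d" for c d x v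
    using sform_transition[OF \<omega> that, of v] chart_inv_transition[OF that] by simp
qed

lemma sform_scale: "sform k \<omega> \<Longrightarrow> sform k (r \<odot> \<omega>)"
  using sform_fun_mult[of "\<lambda>_. r"] unfolding fun_mult_def form_scale_def
  by (simp add: smooth_function_def o_def smooth_on_const)

lemma sform_wedge:
  assumes \<omega>: "sform k \<omega>" and \<eta>: "sform l \<eta>"
  shows "sform (k + l) (wedge k l \<omega> \<eta>)"
proof (rule sformI)
  show "alternating_form (k + l) (wedge k l \<omega> \<eta> c x)" if "c \<in> \<A>" "x \<in> chart_image c" for c x
    by (intro alternating_form_wedge sform_alternating \<omega> \<eta> that)
  show "smooth_on (chart_image c) (\<lambda>x. wedge k l \<omega> \<eta> c x v)" if "c \<in> \<A>" for c v
    unfolding wedge_def divide_inverse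
    by (intro smooth_on_mult smooth_on_sum smooth_on_const sform_smooth[OF \<omega> that] sform_smooth[OF \<eta> that])
  show "wedge k l \<omega> \<eta> c x v =
      wedge k l \<omega> \<eta> d (transition c d x) (\<lambda>i. half_deriv (transition c d) x (v i))"
    if "c \<in> \<A>" "d \<in> \<A>" "x \<in> overlap c d" for c d x v
    unfolding wedge_def
    by (subst sform_transition[OF \<omega> that], subst sform_transition[OF \<eta> that]) simp
qed

lemma sform_eps_wedge:
  assumes "so3_smooth_form half_space \<A> k \<phi>" "so3_smooth_form half_space \<A> l \<psi>"
  shows "sform (k + l) (eps_wedge k l \<phi> \<psi> i)"
  unfolding eps_wedge_def sum_3
  using assms by (intro sform_add sform_scale sform_wedge) (auto simp: so3_smooth_form_def)

lemma smooth_ev: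
  assumes "c \<in> \<A>"
  shows "sform 1 \<omega> \<Longrightarrow> smooth_on (chart_image c) (\<lambda>x. ev1 (\<omega> c x) a)"
    and "sform 2 \<omega> \<Longrightarrow> smooth_on (chart_image c) (\<lambda>x. ev2 (\<omega> c x) a b)"
  unfolding ev1_def ev2_def by (rule sform_smooth[OF _ assms], assumption)+

lemma ext_d_1:
  assumes \<omega>: "sform 1 \<omega>" and c: "c \<in> \<A>" and x: "x \<in> chart_image c"
  shows "ext_d half_space 1 \<omega> c x v =
    half_deriv (\<lambda>y. ev1 (\<omega> c y) (v 1)) x (v 0) - half_deriv (\<lambda>y. ev1 (\<omega> c y) (v 0)) x (v 1)"
proof -
  have "half_deriv (\<lambda>y. \<omega> c y u) x = half_deriv (\<lambda>y. ev1 (\<omega> c y) (u 0)) x" for u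
    by (rule half_deriv_cong[OF chart_image_open[OF c] x]) (use ev1[OF sform_alternating[OF \<omega> c]] in auto)
  then show ?thesis by (simp add: ext_d_def)
qed

lemma ext_d_2:
  assumes \<omega>: "sform 2 \<omega>" and c: "c \<in> \<A>" and x: "x \<in> chart_image c"
  shows "ext_d half_space 2 \<omega> c x v =
    half_deriv (\<lambda>y. ev2 (\<omega> c y) (v 1) (v 2)) x (v 0) - half_deriv (\<lambda>y. ev2 (\<omega> c y) (v 0) (v 2)) x (v 1)
    + half_deriv (\<lambda>y. ev2 (\<omega> c y) (v 0) (v 1)) x (v 2)"
proof -
  have "half_deriv (\<lambda>y. \<omega> c y u) x = half_deriv (\<lambda>y. ev2 (\<omega> c y) (u 0) (u 1)) x" for u
    by (rule half_deriv_cong[OF chart_image_open[OF c] x]) (use ev2[OF sform_alternating[OF \<omega> c]] in auto)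
  then show ?thesis by (simp add: ext_d_def numeral_2_eq_2)
qed

lemma linear_half_deriv_ev1:
  assumes \<omega>: "sform 1 \<omega>" and c: "c \<in> \<A>" and x: "x \<in> chart_image c"
  shows "linear (\<lambda>u. half_deriv (\<lambda>y. ev1 (\<omega> c y) u) x w)" "linear (half_deriv (\<lambda>y. ev1 (\<omega> c y) u) x)"
proof -
  have lin: "linear (ev1 (\<omega> c y))" if "y \<in> chart_image c" for y
    by (intro linear_ev1 sform_alternating[OF \<omega> c that])
  show "linear (\<lambda>u. half_deriv (\<lambda>y. ev1 (\<omega> c y) u) x w)"
  proof (rule linearI)
    fix a b and r :: real
    have "half_deriv (\<lambda>y. ev1 (\<omega> c y) (a + b)) x = half_deriv (\<lambda>y. ev1 (\<omega> c y) a + ev1 (\<omega> c y) b) x"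
      by (rule half_deriv_cong[OF chart_image_open[OF c] x]) (rule linear_add[OF lin])
    then show "half_deriv (\<lambda>y. ev1 (\<omega> c y) (a + b)) x w = half_deriv (\<lambda>y. ev1 (\<omega> c y) a) x w + half_deriv (\<lambda>y. ev1 (\<omega> c y) b) x w"
      using half_deriv_add[OF smooth_ev(1)[OF c \<omega>] smooth_ev(1)[OF c \<omega>] chart_image_open[OF c] x] by simp
    have "half_deriv (\<lambda>y. ev1 (\<omega> c y) (r *\<^sub>R a)) x = half_deriv (\<lambda>y. r * ev1 (\<omega> c y) a) x"
      by (rule half_deriv_cong[OF chart_image_open[OF c] x]) (simp add: linear_scale[OF lin])
    then show "half_deriv (\<lambda>y. ev1 (\<omega> c y) (r *\<^sub>R a)) x w = r *\<^sub>R half_deriv (\<lambda>y. ev1 (\<omega> c y) a) x w"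
      using half_deriv_cmult[OF smooth_ev(1)[OF c \<omega>] chart_image_open[OF c] x] by simp
  qed
  show "linear (half_deriv (\<lambda>y. ev1 (\<omega> c y) u) x)"
    by (rule linear_half_deriv[OF smooth_ev(1)[OF c \<omega>] chart_image_open[OF c] x])
qed

text \<open>In chart \<open>c\<close> the form is a sum of products
  \<open>h u k y * g k (T y)\<close>, with \<open>h\<close> the entries of the Jacobian of the
  transition map and \<open>g\<close> the coefficients in chart \<open>d\<close>. Differentiation
  gives the derivative terms of chart \<open>d\<close> plus terms with second derivatives of
  \<open>T\<close>; the latter are symmetric and disappear when antisymmetrised.\<close>

lemma ext_d_1_transition:
  assumes \<omega>: "sform 1 \<omega>" and c: "c \<in> \<A>" and d: "d \<in> \<A>" and x: "x \<in> overlap c d"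
  shows "ext_d half_space 1 \<omega> c x v =
    ext_d half_space 1 \<omega> d (transition c d x) (\<lambda>i. half_deriv (transition c d) x (v i))"
proof -
  define T where "T = transition c d"
  define S where "S = overlap c d"
  have S: "relopen S" "x \<in> S" using overlap_open[OF c d] x by (auto simp: S_def)
  have T: "smooth_on S T" using smooth_transition[OF c d] by (simp add: S_def T_def)
  have xc: "x \<in> chart_image c" using x overlap_subset[OF c d] by blast
  have TS: "T ` S \<subseteq> chart_image d"
    using transition_mem[OF c d] overlap_subset[OF d c] unfolding S_def T_def by blast
  define g where "g k z = ev1 (\<omega> d z) (axis k 1)" for k z
  have g: "smooth_on (chart_image d) (g k)" for k
    unfolding g_def by (rule smooth_ev(1)[OF d \<omega>])
  have gT: "smooth_on S (\<lambda>y. g k (T y))" for k by (rule smooth_on_compose[OF T g TS])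
  define h where "h u k y = half_deriv (\<lambda>z. T z $ k) y u" for u k y
  have Tk: "smooth_on S (\<lambda>z. T z $ k)" for k
    by (rule smooth_on_bounded_linear[OF bounded_linear_vec_nth T])
  have h: "smooth_on S (h u k)" for u k
    unfolding h_def by (rule smooth_on_half_deriv[OF Tk S(1)])
  have hT: "half_deriv T y u $ k = h u k y" if "y \<in> S" for u k y
    unfolding h_def by (rule half_deriv_component[OF T S(1) that])
  have ev: "ev1 (\<omega> c y) u = (\<Sum>k\<in>UNIV. h u k y * g k (T y))" if y: "y \<in> S" for y u
  proof -
    have "ev1 (\<omega> c y) u = ev1 (\<omega> d (T y)) (half_deriv T y u)"
      using sform_transition[OF \<omega> c d, of y "\<lambda>_. u"] y by (simp add: ev1_def S_def T_def)
    also have "\<dots> = (\<Sum>k\<in>UNIV. half_deriv T y u $ k *\<^sub>R ev1 (\<omega> d (T y)) (axis k 1))"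
      using TS y by (intro linear_axis_expansion linear_ev1 sform_alternating[OF \<omega> d]) auto
    finally show ?thesis by (simp add: hT[OF y] g_def)
  qed
  have D: "half_deriv (\<lambda>y. ev1 (\<omega> c y) u) x w =
      (\<Sum>k\<in>UNIV. h u k x * half_deriv (g k) (T x) (half_deriv T x w) + half_deriv (h u k) x w * g k (T x))" for u w
  proof -
    have "half_deriv (\<lambda>y. ev1 (\<omega> c y) u) x = half_deriv (\<lambda>y. \<Sum>k\<in>UNIV. h u k y * g k (T y)) x"
      by (rule half_deriv_cong[OF S]) (rule ev)
    then have "half_deriv (\<lambda>y. ev1 (\<omega> c y) u) x w = (\<Sum>k\<in>UNIV. half_deriv (\<lambda>y. h u k y * g k (T y)) x w)"
      by (simp add: half_deriv_sum[OF _ _ S] smooth_on_mult h gT)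
    also have "\<dots> = (\<Sum>k\<in>UNIV. h u k x * half_deriv (g k) (T x) (half_deriv T x w) + half_deriv (h u k) x w * g k (T x))"
      by (intro sum.cong refl)
        (simp add: half_deriv_mult[OF h gT S] half_deriv_compose[OF T S g chart_image_open[OF d] TS])
    finally show ?thesis .
  qed
  have sym: "half_deriv (h u k) x w = half_deriv (h w k) x u" for u w k
    unfolding h_def by (rule half_deriv_symmetric[OF Tk S])
  have Tx: "T x \<in> chart_image d" using TS S(2) by blast
  \<comment> \<open>Here \<open>half_deriv T x u\<close> is a fixed vector, the Jacobian at the
    single point \<open>x\<close>, so linearity reassembles the sum over coordinates into one
    directional derivative.\<close>
  have G: "(\<Sum>k\<in>UNIV. h u k x * half_deriv (g k) (T x) w) = half_deriv (\<lambda>z. ev1 (\<omega> d z) (half_deriv T x u)) (T x) w" for u w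
    using linear_axis_expansion[OF linear_half_deriv_ev1(1)[OF \<omega> d Tx], of "half_deriv T x u" w]
    by (simp add: hT[OF S(2)] g_def[abs_def])
  show ?thesis
    unfolding ext_d_1[OF \<omega> c xc] T_def[symmetric] ext_d_1[OF \<omega> d Tx] D sum.distrib G
    by (simp add: sym[of "v (Suc 0)" _ "v 0"])
qed

lemma sform_ext_d_1:
  assumes \<omega>: "sform 1 \<omega>"
  shows "sform 2 (ext_d half_space 1 \<omega>)"
proof (rule sformI)
  fix c x assume c: "c \<in> \<A>" and x: "x \<in> chart_image c"
  note l = linear_half_deriv_ev1[OF \<omega> c x]
  show "alternating_form 2 (ext_d half_space 1 \<omega> c x)"
    unfolding alternating_form_def ext_d_1[OF \<omega> c x] less_2_nat
  proof (intro conjI allI impI)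
    fix v :: "nat \<Rightarrow> real^4" and i :: nat assume "i = 0 \<or> i = 1"
    then show "linear (\<lambda>u. half_deriv (\<lambda>y. ev1 (\<omega> c y) ((v(i := u)) 1)) x ((v(i := u)) 0) -
          half_deriv (\<lambda>y. ev1 (\<omega> c y) ((v(i := u)) 0)) x ((v(i := u)) 1))"
      by (elim disjE) (simp_all add: linear_compose_sub l)
  qed auto
next
  fix c and v :: "nat \<Rightarrow> real^4" assume c: "c \<in> \<A>"
  have "smooth_on (chart_image c) (\<lambda>x. half_deriv (\<lambda>y. ev1 (\<omega> c y) (v 1)) x (v 0) - half_deriv (\<lambda>y. ev1 (\<omega> c y) (v 0)) x (v 1))"
    by (intro smooth_on_diff smooth_on_half_deriv smooth_ev \<omega> c chart_image_open)
  then show "smooth_on (chart_image c) (\<lambda>x. ext_d half_space 1 \<omega> c x v)"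
    by (rule smooth_on_cong) (simp only: ext_d_1[OF \<omega> c])
qed (rule ext_d_1_transition[OF \<omega>])

lemma sform_curvature:
  assumes "so3_smooth_form half_space \<A> 1 A"
  shows "sform 2 (curvature half_space A i)"
  unfolding curvature_def
  using assms sform_eps_wedge[OF assms assms]
  by (intro sform_add sform_scale sform_ext_d_1) (auto simp: so3_smooth_form_def numeral_2_eq_2)

lemma sform_cov_d_1:
  assumes "so3_smooth_form half_space \<A> 1 A" "so3_smooth_form half_space \<A> 1 \<phi>"
  shows "sform 2 (cov_d half_space A 1 \<phi> i)"
  unfolding cov_d_def
  using assms sform_eps_wedge[OF assms]
  by (intro sform_add sform_ext_d_1) (auto simp: so3_smooth_form_def numeral_2_eq_2)

end

section \<open>Algebra of so(3)-valued forms\<close>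

text \<open>Each index \<open>i\<close> begins exactly one cyclic triple, and the Levi-Civita sum
  with first index \<open>i\<close> has only the two terms given by that triple. Computations with
  \<open>eps_wedge\<close> can thus be done once for a generic \<open>i\<close>.\<close>

definition cyc :: "3 \<Rightarrow> 3 \<Rightarrow> 3 \<Rightarrow> bool" where
  "cyc i j k \<longleftrightarrow> (i, j, k) \<in> {(1, 2, 3), (2, 3, 1), (3, 1, 2)}"

lemma cyc_rotate: "cyc i j k \<Longrightarrow> cyc j k i"
  by (auto simp: cyc_def)

lemma cycE: obtains j k where "cyc i j k"
  using exhaust_3[of i] by (auto simp: cyc_def)

lemma eps_wedge_cyc:
  "cyc i j m \<Longrightarrow> eps_wedge k l \<phi> \<psi> i c x v = wedge k l (\<phi> j) (\<psi> m) c x v - wedge k l (\<phi> m) (\<psi> j) c x v"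
  unfolding eps_wedge_apply by (auto simp: cyc_def levi_civita_def sum_3)

text \<open>The wedge of two 2-forms as an operation on their component functions alone, without
  charts or points; its bilinearity and commutativity are then plain polynomial identities.\<close>

definition w22 :: "('v \<Rightarrow> 'v \<Rightarrow> real) \<Rightarrow> ('v \<Rightarrow> 'v \<Rightarrow> real) \<Rightarrow> (nat \<Rightarrow> 'v) \<Rightarrow> real" where
  "w22 P Q v = P (v 0) (v 1) * Q (v 2) (v 3) - P (v 0) (v 2) * Q (v 1) (v 3) + P (v 0) (v 3) * Q (v 1) (v 2)
    + P (v 1) (v 2) * Q (v 0) (v 3) - P (v 1) (v 3) * Q (v 0) (v 2) + P (v 2) (v 3) * Q (v 0) (v 1)"

lemma wedge_2_2_w22:
  "alternating_form 2 (\<omega> c x) \<Longrightarrow> alternating_form 2 (\<eta> c x) \<Longrightarrow>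
    wedge 2 2 \<omega> \<eta> c x v = w22 (ev2 (\<omega> c x)) (ev2 (\<eta> c x)) v"
  by (simp add: wedge_2_2 w22_def)

lemma w22_add_left: "w22 (\<lambda>u w. P u w + r * Q u w) R v = w22 P R v + r * w22 Q R v"
  and w22_add_right: "w22 R (\<lambda>u w. P u w + r * Q u w) v = w22 R P v + r * w22 R Q v"
  and w22_commute: "w22 P Q v = w22 Q P v"
  by (simp_all add: w22_def algebra_simps)

context oriented_manifold
begin

abbreviation so3form :: "nat \<Rightarrow> ('a, 4) so3_form \<Rightarrow> bool" where
  "so3form \<equiv> so3_smooth_form half_space \<A>"

lemma so3form_sform: "so3form k \<phi> \<Longrightarrow> sform k (\<phi> i)"
  by (simp add: so3_smooth_form_def)

lemma so3form_curvature: "so3form 1 A \<Longrightarrow> so3form 2 (curvature half_space A)"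
  by (simp add: so3_smooth_form_def sform_curvature)

lemma so3form_add_scale: "so3form k A \<Longrightarrow> so3form k e \<Longrightarrow> so3form k (\<lambda>i. A i + s \<odot> e i)"
  by (simp add: so3_smooth_form_def sform_add sform_scale)

lemma so3form_eps_wedge: "so3form k A \<Longrightarrow> so3form l e \<Longrightarrow> so3form (k + l) (eps_wedge k l A e)"
  using sform_eps_wedge by (simp add: so3_smooth_form_def)

section \<open>Curvature and covariant derivative at a point of a chart\<close>

context
  fixes c x assumes c: "c \<in> \<A>" and x: "x \<in> chart_image c"
begin

lemma so3form_alternating: "so3form k \<phi> \<Longrightarrow> alternating_form k (\<phi> i c x)"
  using sform_alternating[OF so3form_sform c x] .

lemma eps_wedge_1_1:
  assumes "so3form 1 e" "cyc i j k"
  shows "eps_wedge 1 1 e e i c x v =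
    2 * (ev1 (e j c x) (v 0) * ev1 (e k c x) (v 1) - ev1 (e j c x) (v 1) * ev1 (e k c x) (v 0))"
  using so3form_alternating[OF assms(1)] by (simp add: eps_wedge_cyc[OF assms(2)] wedge_1_1[unfolded One_nat_def])

lemma ext_d_1_add_scale:
  assumes "sform 1 \<omega>" "sform 1 \<eta>"
  shows "ext_d half_space 1 (\<omega> + s \<odot> \<eta>) c x v = ext_d half_space 1 \<omega> c x v + s * ext_d half_space 1 \<eta> c x v"
proof -
  have ev: "ev1 ((\<omega> + s \<odot> \<eta>) c y) u = ev1 (\<omega> c y) u + s * ev1 (\<eta> c y) u" for y u
    by (simp add: ev1_def form_scale_def)
  have "half_deriv (\<lambda>y. ev1 (\<omega> c y) u + s * ev1 (\<eta> c y) u) x w =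
      half_deriv (\<lambda>y. ev1 (\<omega> c y) u) x w + s * half_deriv (\<lambda>y. ev1 (\<eta> c y) u) x w" for u w
    using assms by (simp add: half_deriv_add[OF _ _ chart_image_open[OF c] x]
        half_deriv_cmult[OF _ chart_image_open[OF c] x] smooth_ev[OF c] smooth_on_mult smooth_on_const)
  then show ?thesis
    unfolding ext_d_1[OF sform_add[OF assms(1) sform_scale[OF assms(2)]] c x] ev
      ext_d_1[OF assms(1) c x] ext_d_1[OF assms(2) c x] by (simp add: algebra_simps)
qed

text \<open>In the quadratic term of the curvature both mixed products of \<open>A\<close> and
  \<open>e\<close> agree, since \<epsilon> and the wedge of 1-forms are both antisymmetric. They
  double up, cancel the factor 1/2, and complete the exterior derivative of \<open>e\<close> to its
  covariant derivative.\<close>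

lemma curvature_add_scale:
  assumes A: "so3form 1 A" and e: "so3form 1 e"
  shows "curvature half_space (\<lambda>i. A i + s \<odot> e i) i c x v =
    curvature half_space A i c x v + s * cov_d half_space A 1 e i c x v + s\<^sup>2 / 2 * eps_wedge 1 1 e e i c x v"
proof -
  obtain j k where ijk: "cyc i j k" by (rule cycE)
  have ev: "ev1 (A i c x + (s \<odot> e i) c x) u = ev1 (A i c x) u + s * ev1 (e i c x) u" for i u
    by (simp add: ev1_def form_scale_def)
  have w: "eps_wedge 1 1 A e i c x v =
      ev1 (A j c x) (v 0) * ev1 (e k c x) (v 1) - ev1 (A j c x) (v 1) * ev1 (e k c x) (v 0)
      - (ev1 (A k c x) (v 0) * ev1 (e j c x) (v 1) - ev1 (A k c x) (v 1) * ev1 (e j c x) (v 0))"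
    using so3form_alternating[OF A] so3form_alternating[OF e]
    by (simp add: eps_wedge_cyc[OF ijk] wedge_1_1[unfolded One_nat_def])
  show ?thesis
    unfolding curvature_def cov_d_def
    by (simp add: form_scale_def[of "1/2"] ext_d_1_add_scale[unfolded One_nat_def] so3form_sform[OF A, unfolded One_nat_def]
       so3form_sform[OF e, unfolded One_nat_def] w[unfolded One_nat_def]
       eps_wedge_1_1[OF so3form_add_scale[OF A e] ijk, unfolded One_nat_def] eps_wedge_1_1[OF A ijk, unfolded One_nat_def] eps_wedge_1_1[OF e ijk, unfolded One_nat_def] ev)
     (simp add: field_simps power2_eq_square)
qed

lemma ev2_curvature:
  assumes A: "so3form 1 A" and ijk: "cyc i j k"
  shows "ev2 (curvature half_space A i c x) u w =
    half_deriv (\<lambda>y. ev1 (A i c y) w) x u - half_deriv (\<lambda>y. ev1 (A i c y) u) x w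
    + (ev1 (A j c x) u * ev1 (A k c x) w - ev1 (A j c x) w * ev1 (A k c x) u)"
  unfolding ev2_def curvature_def
  by (simp add: form_scale_def ext_d_1[OF so3form_sform[OF A] c x, unfolded One_nat_def] eps_wedge_1_1[OF A ijk, unfolded One_nat_def])

end

lemma half_deriv_ev2_curvature:
  assumes A: "so3form 1 A" and ijk: "cyc i j k" and c: "c \<in> \<A>" and x: "x \<in> chart_image c"
  shows "half_deriv (\<lambda>y. ev2 (curvature half_space A i c y) u w) x t =
    half_deriv (\<lambda>y. half_deriv (\<lambda>y. ev1 (A i c y) w) y u) x t - half_deriv (\<lambda>y. half_deriv (\<lambda>y. ev1 (A i c y) u) y w) x t
    + (ev1 (A j c x) u * half_deriv (\<lambda>y. ev1 (A k c y) w) x t + half_deriv (\<lambda>y. ev1 (A j c y) u) x t * ev1 (A k c x) w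
       - (ev1 (A j c x) w * half_deriv (\<lambda>y. ev1 (A k c y) u) x t + half_deriv (\<lambda>y. ev1 (A j c y) w) x t * ev1 (A k c x) u))"
proof -
  note S = chart_image_open[OF c]
  have s: "smooth_on (chart_image c) (\<lambda>y. ev1 (A i c y) u)" for i u
    by (rule smooth_ev(1)[OF c so3form_sform[OF A]])
  have "half_deriv (\<lambda>y. ev2 (curvature half_space A i c y) u w) x t =
    half_deriv (\<lambda>y. half_deriv (\<lambda>y. ev1 (A i c y) w) y u - half_deriv (\<lambda>y. ev1 (A i c y) u) y w
    + (ev1 (A j c y) u * ev1 (A k c y) w - ev1 (A j c y) w * ev1 (A k c y) u)) x t"
    by (rule half_deriv_cong[OF S x, THEN fun_cong]) (rule ev2_curvature[OF c _ A ijk])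
  also have "\<dots> = half_deriv (\<lambda>y. half_deriv (\<lambda>y. ev1 (A i c y) w) y u - half_deriv (\<lambda>y. ev1 (A i c y) u) y w) x t
     + half_deriv (\<lambda>y. ev1 (A j c y) u * ev1 (A k c y) w - ev1 (A j c y) w * ev1 (A k c y) u) x t"
    by (intro half_deriv_add[OF _ _ S x] smooth_on_diff smooth_on_half_deriv smooth_on_mult s S)
  also have "half_deriv (\<lambda>y. half_deriv (\<lambda>y. ev1 (A i c y) w) y u - half_deriv (\<lambda>y. ev1 (A i c y) u) y w) x t =
     half_deriv (\<lambda>y. half_deriv (\<lambda>y. ev1 (A i c y) w) y u) x t - half_deriv (\<lambda>y. half_deriv (\<lambda>y. ev1 (A i c y) u) y w) x t"
    by (intro half_deriv_diff[OF _ _ S x] smooth_on_half_deriv s S)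
  also have "half_deriv (\<lambda>y. ev1 (A j c y) u * ev1 (A k c y) w - ev1 (A j c y) w * ev1 (A k c y) u) x t =
     half_deriv (\<lambda>y. ev1 (A j c y) u * ev1 (A k c y) w) x t - half_deriv (\<lambda>y. ev1 (A j c y) w * ev1 (A k c y) u) x t"
    by (intro half_deriv_diff[OF _ _ S x] smooth_on_mult s)
  finally show ?thesis unfolding half_deriv_mult[OF s s S x] .
qed

lemma wedge_1_2_at:
  assumes "sform 1 \<omega>" "sform 2 \<eta>" "c \<in> \<A>" "x \<in> chart_image c"
  shows "wedge 1 2 \<omega> \<eta> c x v =
    ev1 (\<omega> c x) (v 0) * ev2 (\<eta> c x) (v 1) (v 2) - ev1 (\<omega> c x) (v 1) * ev2 (\<eta> c x) (v 0) (v 2) +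
    ev1 (\<omega> c x) (v 2) * ev2 (\<eta> c x) (v 0) (v 1)"
  by (intro wedge_1_2 sform_alternating assms)

lemma wedge_1_1_at:
  assumes "sform 1 \<omega>" "sform 1 \<eta>" "c \<in> \<A>" "x \<in> chart_image c"
  shows "wedge 1 1 \<omega> \<eta> c x v = ev1 (\<omega> c x) (v 0) * ev1 (\<eta> c x) (v 1) - ev1 (\<omega> c x) (v 1) * ev1 (\<eta> c x) (v 0)"
  by (intro wedge_1_1 sform_alternating assms)

lemma ev2_wedge_1_1:
  assumes "sform 1 \<omega>" "sform 1 \<eta>" "c \<in> \<A>" "x \<in> chart_image c"
  shows "ev2 (wedge 1 1 \<omega> \<eta> c x) u w = ev1 (\<omega> c x) u * ev1 (\<eta> c x) w - ev1 (\<omega> c x) w * ev1 (\<eta> c x) u"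
  unfolding ev2_def by (subst wedge_1_1_at[OF assms]) simp

lemma wedge_2_1_at:
  assumes "sform 2 \<omega>" "sform 1 \<eta>" "c \<in> \<A>" "x \<in> chart_image c"
  shows "wedge 2 1 \<omega> \<eta> c x v =
    ev2 (\<omega> c x) (v 0) (v 1) * ev1 (\<eta> c x) (v 2) - ev2 (\<omega> c x) (v 0) (v 2) * ev1 (\<eta> c x) (v 1) +
    ev2 (\<omega> c x) (v 1) (v 2) * ev1 (\<eta> c x) (v 0)"
  by (intro wedge_2_1 sform_alternating assms)

lemma ev3_wedge_2_1:
  assumes "sform 2 \<omega>" "sform 1 \<eta>" "c \<in> \<A>" "x \<in> chart_image c"
  shows "ev3 (wedge 2 1 \<omega> \<eta> c x) u w z =
    ev2 (\<omega> c x) u w * ev1 (\<eta> c x) z - ev2 (\<omega> c x) u z * ev1 (\<eta> c x) w + ev2 (\<omega> c x) w z * ev1 (\<eta> c x) u"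
  unfolding ev3_def by (subst wedge_2_1_at[OF assms]) simp

lemma wedge_2_2_at:
  assumes "sform 2 \<omega>" "sform 2 \<eta>" "c \<in> \<A>" "x \<in> chart_image c"
  shows "wedge 2 2 \<omega> \<eta> c x v = w22 (ev2 (\<omega> c x)) (ev2 (\<eta> c x)) v"
  by (intro wedge_2_2_w22 sform_alternating assms)

lemma wedge_3_1_at:
  assumes "sform 3 \<omega>" "sform 1 \<eta>" "c \<in> \<A>" "x \<in> chart_image c"
  shows "wedge 3 1 \<omega> \<eta> c x v =
    ev3 (\<omega> c x) (v 0) (v 1) (v 2) * ev1 (\<eta> c x) (v 3) - ev3 (\<omega> c x) (v 0) (v 1) (v 3) * ev1 (\<eta> c x) (v 2) +
    ev3 (\<omega> c x) (v 0) (v 2) (v 3) * ev1 (\<eta> c x) (v 1) - ev3 (\<omega> c x) (v 1) (v 2) (v 3) * ev1 (\<eta> c x) (v 0)"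
  by (intro wedge_3_1 sform_alternating assms)

text \<open>The second derivatives of \<open>A\<close> cancel by symmetry, and the products of
  \<open>A\<close> with its first derivatives cancel between the exterior derivative and the
  \<epsilon> term. In the cubic terms of a cyclic triple one of the 1-forms always occurs twice, so
  these vanish individually.\<close>

lemma Bianchi:
  assumes A: "so3form 1 A" and c: "c \<in> \<A>" and x: "x \<in> chart_image c"
  shows "cov_d half_space A 2 (curvature half_space A) i c x v = 0"
proof -
  obtain j k where ijk: "cyc i j k" by (rule cycE)
  note jki = cyc_rotate[OF ijk]
  note kij = cyc_rotate[OF jki]
  have F: "sform 2 (curvature half_space A i)" for i by (rule sform_curvature[OF A])
  have s: "smooth_on (chart_image c) (\<lambda>y. ev1 (A i c y) u)" for i u
    by (rule smooth_ev(1)[OF c so3form_sform[OF A]])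
  have sym: "half_deriv (\<lambda>y. half_deriv (\<lambda>y. ev1 (A i c y) w) y u) x t =
      half_deriv (\<lambda>y. half_deriv (\<lambda>y. ev1 (A i c y) w) y t) x u" for i u w t
    by (rule half_deriv_symmetric[OF s chart_image_open[OF c] x])
  have "cov_d half_space A 2 (curvature half_space A) i c x v =
      ext_d half_space 2 (curvature half_space A i) c x v + (wedge 1 2 (A j) (curvature half_space A k) c x v
      - wedge 1 2 (A k) (curvature half_space A j) c x v)"
    by (simp add: cov_d_def eps_wedge_cyc[OF ijk])
  \<comment> \<open>The three instances of \<open>sym\<close> select one order of differentiation
    for each pair of directions; used as a general rewrite rule the symmetry would not
    terminate.\<close>
  also have "\<dots> = 0"
    unfolding ext_d_2[OF F c x] half_deriv_ev2_curvature[OF A ijk c x]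
      wedge_1_2_at[OF so3form_sform[OF A] F c x] ev2_curvature[OF c x A jki] ev2_curvature[OF c x A kij]
      sym[of i "v 2" "v 1" "v 0"] sym[of i "v 1" "v 2" "v 0"] sym[of i "v 0" "v 2" "v 1"]
    by (simp add: algebra_simps)
  finally show ?thesis .
qed


lemma ev2_curvature_add_scale:
  assumes "so3form 1 A" "so3form 1 e" "c \<in> \<A>" "x \<in> chart_image c"
  shows "ev2 (curvature half_space (\<lambda>i. A i + s \<odot> e i) i c x) =
    (\<lambda>u w. ev2 (curvature half_space A i c x) u w + s * ev2 (cov_d half_space A 1 e i c x) u w
      + s\<^sup>2 / 2 * ev2 (eps_wedge 1 1 e e i c x) u w)"
  unfolding ev2_def curvature_add_scale[OF assms(3,4,1,2)] ..

lemma cov_d_add_scale: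
  "cov_d half_space (\<lambda>i. A i + s \<odot> e i) 2 G i c x v =
    cov_d half_space A 2 G i c x v + s * eps_wedge 1 2 e G i c x v"
proof -
  obtain j k where ijk: "cyc i j k" by (rule cycE)
  have "wedge 1 2 (A j + s \<odot> e j) (G k) c x v = wedge 1 2 (A j) (G k) c x v + s * wedge 1 2 (e j) (G k) c x v" for j k
    unfolding wedge_def form_scale_def
    by (simp add: algebra_simps sum.distrib sum_distrib_left add_divide_distrib)
  then show ?thesis by (simp add: cov_d_def eps_wedge_cyc[OF ijk] algebra_simps)
qed

lemma eps_wedge_1_2_at:
  assumes e: "so3form 1 e" and G: "so3form 2 G" and c: "c \<in> \<A>" "x \<in> chart_image c" and ijk: "cyc i j k"
  shows "eps_wedge 1 2 e G i c x v =
    ev1 (e j c x) (v 0) * ev2 (G k c x) (v 1) (v 2) - ev1 (e j c x) (v 1) * ev2 (G k c x) (v 0) (v 2) +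
    ev1 (e j c x) (v 2) * ev2 (G k c x) (v 0) (v 1)
    - (ev1 (e k c x) (v 0) * ev2 (G j c x) (v 1) (v 2) - ev1 (e k c x) (v 1) * ev2 (G j c x) (v 0) (v 2) +
    ev1 (e k c x) (v 2) * ev2 (G j c x) (v 0) (v 1))"
  unfolding eps_wedge_cyc[OF ijk] wedge_1_2_at[OF so3form_sform[OF e] so3form_sform[OF G] c] ..

lemma ev2_eps_wedge_1_1:
  assumes "so3form 1 e" "cyc i j k" "c \<in> \<A>" "x \<in> chart_image c"
  shows "ev2 (eps_wedge 1 1 e e i c x) u w = 2 * (ev1 (e j c x) u * ev1 (e k c x) w - ev1 (e j c x) w * ev1 (e k c x) u)"
  unfolding ev2_def eps_wedge_1_1[OF assms(3,4,1,2)] by simp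

text \<open>The quadratic part of the curvature contributes products of three components of
  \<open>e\<close> with a repetition, hence nothing. The minus sign comes from writing the 2-form
  before the 1-form: this order does not change the wedge, but it exchanges two indices of
  \<epsilon>.\<close>

lemma eps_wedge_1_2_curvature_add_scale:
  assumes A: "so3form 1 A" and e: "so3form 1 e" and c: "c \<in> \<A>" "x \<in> chart_image c"
  shows "eps_wedge 1 2 e (curvature half_space (\<lambda>i. A i + s \<odot> e i)) i c x v =
    eps_wedge 1 2 e (curvature half_space A) i c x v - s * eps_wedge 2 1 (cov_d half_space A 1 e) e i c x v"
proof -
  obtain j k where ijk: "cyc i j k" by (rule cycE)
  note jki = cyc_rotate[OF ijk]
  note kij = cyc_rotate[OF jki]
  have E: "eps_wedge 2 1 (cov_d half_space A 1 e) e i c x v =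
    wedge 2 1 (cov_d half_space A 1 e j) (e k) c x v - wedge 2 1 (cov_d half_space A 1 e k) (e j) c x v"
    by (rule eps_wedge_cyc[OF ijk])
  show ?thesis
    unfolding E wedge_2_1_at[OF sform_cov_d_1[OF A e] so3form_sform[OF e] c]
      eps_wedge_1_2_at[OF e so3form_curvature[OF so3form_add_scale[OF A e]] c ijk]
      eps_wedge_1_2_at[OF e so3form_curvature[OF A] c ijk] ev2_curvature_add_scale[OF A e c]
      ev2_eps_wedge_1_1[OF e jki c] ev2_eps_wedge_1_1[OF e kij c]
    by (simp add: algebra_simps)
qed

text \<open>Stated with two free parameters, for which the coefficients are symmetric polynomials in
  \<open>s\<close> and \<open>t\<close>. The stated decomposition of the Lagrangian is the case s =
  \<alpha> - 1, t = \<alpha>, matching the order F_- before F_+.\<close>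

lemma wedge_2_2_decomposition:
  assumes A: "so3form 1 A" and e: "so3form 1 e" and c: "c \<in> \<A>" "x \<in> chart_image c"
  defines "F \<equiv> curvature half_space A" and "De \<equiv> cov_d half_space A 1 e"
  shows "(\<Sum>i\<in>UNIV. wedge 2 2 (curvature half_space (\<lambda>i. A i + s \<odot> e i) i) (curvature half_space (\<lambda>i. A i + t \<odot> e i) i) c x v) =
    (s\<^sup>2 + t\<^sup>2) / 2 * (\<Sum>i\<in>UNIV. \<Sum>j\<in>UNIV. \<Sum>k\<in>UNIV. levi_civita i j k * wedge 2 2 (wedge 1 1 (e i) (e j)) (F k) c x v)
    + s * t * (s + t) / 2 * (\<Sum>i\<in>UNIV. \<Sum>j\<in>UNIV. \<Sum>k\<in>UNIV. levi_civita i j k * wedge 3 1 (wedge 2 1 (De i) (e j)) (e k) c x v)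
    + s * t * (\<Sum>i\<in>UNIV. wedge 2 2 (De i) (De i) c x v)
    + (s + t) * (\<Sum>i\<in>UNIV. wedge 2 2 (De i) (F i) c x v) + (\<Sum>i\<in>UNIV. wedge 2 2 (F i) (F i) c x v)"
proof -
  define E where "E i = ev2 (eps_wedge 1 1 e e i c x)" for i
  define P where "P i = ev2 (F i c x)" for i
  define D where "D i = ev2 (De i c x)" for i
  have sF: "sform 2 (F i)" and sD: "sform 2 (De i)" and se: "sform 1 (e i)" for i
    unfolding F_def De_def using A e by (simp_all only: sform_cov_d_1 sform_curvature so3form_sform)
  have see: "sform 2 (wedge 1 1 (e i) (e j))" and sDe: "sform 3 (wedge 2 1 (De i) (e j))" for i j
    using sform_wedge[OF se se] sform_wedge[OF sD se] by (simp_all only: one_add_one numeral_plus_one semiring_norm)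
  have sG: "sform 2 (curvature half_space (\<lambda>i. A i + s \<odot> e i) i)" for i s
    by (rule sform_curvature[OF so3form_add_scale[OF A e]])
  have E: "E 1 u w = 2 * (ev1 (e 2 c x) u * ev1 (e 3 c x) w - ev1 (e 2 c x) w * ev1 (e 3 c x) u)"
    "E 2 u w = 2 * (ev1 (e 3 c x) u * ev1 (e 1 c x) w - ev1 (e 3 c x) w * ev1 (e 1 c x) u)"
    "E 3 u w = 2 * (ev1 (e 1 c x) u * ev1 (e 2 c x) w - ev1 (e 1 c x) w * ev1 (e 2 c x) u)" for u w
    unfolding E_def by (rule ev2_eps_wedge_1_1[OF e _ c]; simp add: cyc_def)+
  have EF: "(\<Sum>i\<in>UNIV. \<Sum>j\<in>UNIV. \<Sum>k\<in>UNIV. levi_civita i j k * wedge 2 2 (wedge 1 1 (e i) (e j)) (F k) c x v) = (\<Sum>i\<in>UNIV. w22 (E i) (P i) v)"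
    unfolding wedge_2_2_at[OF see sF c] w22_def ev2_wedge_1_1[OF se se c] P_def[symmetric]
    by (simp add: sum_3 levi_civita_def E algebra_simps)
  have DE: "(\<Sum>i\<in>UNIV. \<Sum>j\<in>UNIV. \<Sum>k\<in>UNIV. levi_civita i j k * wedge 3 1 (wedge 2 1 (De i) (e j)) (e k) c x v) = (\<Sum>i\<in>UNIV. w22 (D i) (E i) v)"
    unfolding wedge_3_1_at[OF sDe se c] w22_def ev3_wedge_2_1[OF sD se c] D_def[symmetric]
    by (simp add: sum_3 levi_civita_def E algebra_simps)
  \<comment> \<open>The only quartic contribution in \<open>e\<close>. Each summand is the square of
    a product of two 1-forms and therefore zero.\<close>
  have EE: "(\<Sum>i\<in>UNIV. w22 (E i) (E i) v) = 0"
    unfolding w22_def by (simp add: sum_3 E algebra_simps)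
  have G: "wedge 2 2 (curvature half_space (\<lambda>i. A i + s \<odot> e i) i) (curvature half_space (\<lambda>i. A i + t \<odot> e i) i) c x v
    = s\<^sup>2 * t\<^sup>2 / 4 * w22 (E i) (E i) v + (s\<^sup>2 + t\<^sup>2) / 2 * w22 (E i) (P i) v + s * t * (s + t) / 2 * w22 (D i) (E i) v
      + s * t * w22 (D i) (D i) v + (s + t) * w22 (D i) (P i) v + w22 (P i) (P i) v" for i
    unfolding wedge_2_2_at[OF sG sG c] ev2_curvature_add_scale[OF A e c] F_def[symmetric] De_def[symmetric]
      P_def[symmetric] D_def[symmetric] E_def[symmetric] w22_add_left w22_add_right
    unfolding w22_commute[of "P i" "D i"] w22_commute[of "P i" "E i"] w22_commute[of "E i" "D i"]
    by (simp add: algebra_simps power2_eq_square) (simp add: field_simps)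
  show ?thesis
    unfolding G EF DE wedge_2_2_at[OF sD sD c] wedge_2_2_at[OF sD sF c] wedge_2_2_at[OF sF sF c]
      P_def[symmetric] D_def[symmetric] sum.distrib sum_distrib_left[symmetric] EE by simp
qed

end

section \<open>The boundary\<close>

definition boundary_incl :: "real^3 \<Rightarrow> real^4" where
  "boundary_incl y = vector [0, y $ 1, y $ 2, y $ 3]"

lemma vector_4: "(vector [a, b, c, d] :: 'z::zero^4) $ 1 = a" "(vector [a, b, c, d] :: 'z^4) $ 2 = b"
  "(vector [a, b, c, d] :: 'z^4) $ 3 = c" "(vector [a, b, c, d] :: 'z^4) $ 4 = d"
  by (simp_all add: vector_def)

lemma boundary_incl_component [simp]:
  "boundary_incl y $ 1 = 0" "boundary_incl y $ 2 = y $ 1" "boundary_incl y $ 3 = y $ 2" "boundary_incl y $ 4 = y $ 3"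
  by (simp_all add: boundary_incl_def vector_4)

lemma linear_boundary_incl: "linear boundary_incl"
  by (rule linearI) (simp_all add: vec_eq_iff forall_4)

definition boundary_chart :: "('a, 4) chart set \<Rightarrow> ('a, 4) chart \<Rightarrow> ('a, 3) chart" where
  "boundary_chart \<A> c = (fst c \<inter> boundary_points \<A>, \<lambda>p. vector [snd c p $ 2, snd c p $ 3, snd c p $ 4])"

lemma boundary_atlas_eq: "boundary_atlas \<A> = boundary_chart \<A> ` \<A>"
  by (simp add: boundary_atlas_def boundary_chart_def)

context oriented_manifold
begin

text \<open>Where a transition map meets the boundary from the interior, its first coordinate has a local
  minimum, so its Jacobian would have a zero row.\<close>

lemma boundary_invariant:
  assumes c: "c \<in> \<A>" and p: "p \<in> fst c" "p \<in> boundary_points \<A>"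
  shows "snd c p $ 1 = 0"
proof (rule ccontr)
  assume ne: "snd c p $ 1 \<noteq> 0"
  obtain d where d: "d \<in> \<A>" "p \<in> fst d" "snd d p $ 1 = 0"
    using p(2) by (auto simp: boundary_points_def)
  define x where "x = snd c p"
  define T where "T = transition c d"
  have x: "x \<in> overlap c d" using p d by (auto simp: x_def overlap_def)
  have xh: "x \<in> half_space" using x openin_imp_subset[OF overlap_open[OF c d(1)]] by blast
  then have pos: "x $ 1 > 0" using ne by (simp add: x_def half_space_def)
  obtain V where V: "open V" "overlap c d = half_space \<inter> V"
    using overlap_open[OF c d(1)] by (auto simp: openin_open)
  define W where "W = V \<inter> {y. 0 < y $ 1}"
  have "open {y :: real^4. 0 < y $ 1}" using open_halfspace_component_gt_cart[of 0 "1::4"] by simp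
  then have W: "open W" unfolding W_def using V(1) by (rule open_Int[rotated])
  have xW: "x \<in> W" using x V(2) pos by (simp add: W_def)
  have Wsub: "W \<subseteq> overlap c d" unfolding V(2) W_def half_space_def by auto
  \<comment> \<open>The point has an open neighbourhood inside the overlap, so the one-sided
    derivative is a full derivative and the first-order condition at a minimum applies.\<close>
  have at: "at x within half_space = at x"
    by (rule at_within_interior, rule interiorI[OF W xW]) (use Wsub V(2) in auto)
  have der: "((\<lambda>y. T y $ 1) has_derivative (\<lambda>v. half_deriv T x v $ 1)) (at x)"
    using bounded_linear.has_derivative[OF bounded_linear_vec_nth
        smooth_on_has_half_deriv[OF smooth_transition[OF c d(1)] overlap_open[OF c d(1)] x]] at
    unfolding T_def by simp
  have "(\<lambda>v. half_deriv T x v $ 1) = (\<lambda>v. 0)"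
  proof (rule has_derivative_local_min[OF der])
    have "T x $ 1 = 0" using c d p by (simp add: T_def x_def)
    moreover have "T y $ 1 \<ge> 0" if "y \<in> W" for y
      using transition_mem[OF c d(1), of y] openin_imp_subset[OF overlap_open[OF d(1) c]] that Wsub
      by (auto simp: T_def half_space_def)
    ultimately show "\<forall>\<^sub>F y in at x. T x $ 1 \<le> T y $ 1"
      using W xW unfolding eventually_at_topological by auto
  qed
  then have "row 1 (matrix (half_deriv T x)) = 0"
    by (simp add: row_def matrix_def vec_eq_iff fun_eq_iff)
  then have "det (matrix (half_deriv T x)) = 0" by (rule det_zero_row(1))
  then show False using det_transition_pos[OF c d(1) x] by (simp add: T_def)
qed

context
  fixes c assumes c: "c \<in> \<A>"
begin

lemma boundary_incl_chart:
  assumes "p \<in> fst c \<inter> boundary_points \<A>"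
  shows "boundary_incl (snd (boundary_chart \<A> c) p) = snd c p"
  using boundary_invariant[OF c, of p] assms by (simp add: boundary_chart_def vec_eq_iff forall_4 vector_3)

text \<open>Being a boundary point can be read off in any chart, by
  \<open>boundary_invariant\<close>, so the image of an induced chart is the whole slice of
  \<open>chart_image c\<close> on which the first coordinate vanishes.\<close>

lemma boundary_chart_image:
  "y \<in> chart_image (boundary_chart \<A> c) \<longleftrightarrow> boundary_incl y \<in> chart_image c"
proof
  assume "y \<in> chart_image (boundary_chart \<A> c)"
  then obtain p where "p \<in> fst c \<inter> boundary_points \<A>" "y = snd (boundary_chart \<A> c) p"
    by (auto simp: chart_image_def boundary_chart_def)
  then show "boundary_incl y \<in> chart_image c" using boundary_incl_chart c by auto
next
  assume "boundary_incl y \<in> chart_image c"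
  then obtain p where p: "p \<in> fst c" "snd c p = boundary_incl y" by (auto simp: chart_image_def)
  then have "p \<in> fst c \<inter> boundary_points \<A>" using c by (force simp: boundary_points_def)
  moreover have "snd (boundary_chart \<A> c) p = y"
    using p by (simp add: boundary_chart_def vec_eq_iff forall_3 vector_3)
  ultimately show "y \<in> chart_image (boundary_chart \<A> c)"
    unfolding chart_image_def by (force simp: boundary_chart_def)
qed

lemma boundary_chart_inv:
  assumes "y \<in> chart_image (boundary_chart \<A> c)"
  shows "chart_inv (boundary_chart \<A> c) y = chart_inv c (boundary_incl y)"
proof -
  let ?b = "boundary_chart \<A> c"
  have m: "chart_inv ?b y \<in> fst c \<inter> boundary_points \<A>" "snd ?b (chart_inv ?b y) = y"
    using assms inv_into_into[of y "snd ?b" "fst ?b"] f_inv_into_f[of y "snd ?b" "fst ?b"]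
    by (auto simp: chart_image_def chart_inv_def boundary_chart_def)
  then have "snd c (chart_inv ?b y) = boundary_incl y" using boundary_incl_chart by metis
  then show ?thesis using m c by (metis IntD1 chart_inv_chart)
qed

lemma open_boundary_chart_image: "open (chart_image (boundary_chart \<A> c))"
proof -
  obtain V where V: "open V" "chart_image c = half_space \<inter> V"
    using chart_image_open[OF c] by (auto simp: openin_open)
  have "chart_image (boundary_chart \<A> c) = boundary_incl -` V"
    using V by (auto simp: boundary_chart_image half_space_def)
  moreover have "continuous_on UNIV boundary_incl"
    using linear_boundary_incl by (simp add: linear_continuous_on linear_conv_bounded_linear)
  ultimately show ?thesis using V(1) by (simp add: continuous_on_open_vimage open_vimage)
qed

lemma has_derivative_boundary_incl:
  assumes "(f has_derivative f') (at (boundary_incl y) within half_space)"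
  shows "((\<lambda>z. f (boundary_incl z)) has_derivative (\<lambda>v. f' (boundary_incl v))) (at y)"
proof -
  have "(boundary_incl has_derivative boundary_incl) (at y)"
    using linear_boundary_incl by (simp add: bounded_linear_imp_has_derivative linear_conv_bounded_linear)
  moreover have "(f has_derivative f') (at (boundary_incl y) within range boundary_incl)"
    by (rule has_derivative_subset[OF assms]) (auto simp: half_space_def)
  ultimately show ?thesis by (rule has_derivative_in_compose)
qed

text \<open>The pullback evaluates in an arbitrarily chosen target chart \<open>d\<close>. Its
  derivative there is the Jacobian of the transition map applied to tangential vectors, and the
  transformation law of \<omega> carries the value back to \<open>c\<close>, where the inclusion is
  the linear map \<open>boundary_incl\<close>.\<close>

lemma boundary_pullback_chart:
  assumes \<omega>: "sform k \<omega>" and y: "y \<in> chart_image (boundary_chart \<A> c)"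
  shows "boundary_pullback \<A> \<omega> (boundary_chart \<A> c) y v = \<omega> c (boundary_incl y) (\<lambda>i. boundary_incl (v i))"
proof -
  let ?b = "boundary_chart \<A> c"
  define p where "p = chart_inv ?b y"
  define d where "d = (SOME d. d \<in> \<A> \<and> p \<in> fst d)"
  have x: "boundary_incl y \<in> chart_image c" using y by (simp add: boundary_chart_image)
  have p: "p = chart_inv c (boundary_incl y)" unfolding p_def by (rule boundary_chart_inv[OF y])
  then have pc: "p \<in> fst c" using x c by simp
  have d: "d \<in> \<A>" "p \<in> fst d"
    using someI[of "\<lambda>d. d \<in> \<A> \<and> p \<in> fst d" c] c pc unfolding d_def by auto
  have ov: "boundary_incl y \<in> overlap c d" using x d c p by (simp add: overlap_iff)
  have "(local_rep ?b d id has_derivative (\<lambda>v. half_deriv (transition c d) (boundary_incl y) (boundary_incl v))) (at y)"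
  proof (rule has_derivative_transform_within_open[OF _ open_boundary_chart_image y])
    show "((\<lambda>z. transition c d (boundary_incl z)) has_derivative
        (\<lambda>v. half_deriv (transition c d) (boundary_incl y) (boundary_incl v))) (at y)"
      by (rule has_derivative_boundary_incl[OF smooth_on_has_half_deriv[OF smooth_transition overlap_open ov]]) (use c d in auto)
  qed (simp add: local_rep_def boundary_chart_inv)
  then have D: "frechet_derivative (local_rep ?b d id) (at y) =
      (\<lambda>v. half_deriv (transition c d) (boundary_incl y) (boundary_incl v))"
    using frechet_derivative_at by metis
  have sp: "transition c d (boundary_incl y) = snd d p" by (simp add: local_rep_def p)
  have "boundary_pullback \<A> \<omega> ?b y v = \<omega> d (snd d p) (\<lambda>i. frechet_derivative (local_rep ?b d id) (at y) (v i))"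
    unfolding boundary_pullback_def pullback_def Let_def by (simp add: d_def p_def)
  then show ?thesis
    unfolding D using sform_transition[OF \<omega> c d(1) ov] sp by simp
qed

end

section \<open>Pulled-back forms and the field equations on the boundary\<close>

lemma form_eq_boundary_iff:
  assumes "sform k \<omega>"
  shows "form_eq (boundary_atlas \<A>) (boundary_pullback \<A> \<omega>) 0 \<longleftrightarrow>
    (\<forall>c\<in>\<A>. \<forall>y. boundary_incl y \<in> chart_image c \<longrightarrow> (\<forall>v. \<omega> c (boundary_incl y) (\<lambda>i. boundary_incl (v i)) = 0))"
  unfolding form_eq_def boundary_atlas_eq
  by (auto simp: boundary_chart_image boundary_pullback_chart[OF _ assms])

text \<open>In an induced chart the inclusion is linear, so pulling back substitutes constant
  vectors for the arguments and a tangential derivative of the pullback is the corresponding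
  derivative within the half-space.\<close>

lemma boundary_pullback_ext_d:
  assumes \<omega>: "sform k \<omega>" and d\<omega>: "sform (Suc k) (ext_d half_space k \<omega>)" and c: "c \<in> \<A>"
    and y: "y \<in> chart_image (boundary_chart \<A> c)"
  shows "ext_d UNIV k (boundary_pullback \<A> \<omega>) (boundary_chart \<A> c) y v =
    ext_d half_space k \<omega> c (boundary_incl y) (\<lambda>i. boundary_incl (v i))"
proof -
  let ?b = "boundary_chart \<A> c"
  have x: "boundary_incl y \<in> chart_image c" using y c by (simp add: boundary_chart_image)
  have "frechet_derivative (\<lambda>z. boundary_pullback \<A> \<omega> ?b z u) (at y) =
      (\<lambda>w. half_deriv (\<lambda>z. \<omega> c z (\<lambda>i. boundary_incl (u i))) (boundary_incl y) (boundary_incl w))" for u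
  proof (rule frechet_derivative_at[symmetric], rule has_derivative_transform_within_open[OF _ open_boundary_chart_image[OF c] y])
    show "((\<lambda>z. \<omega> c (boundary_incl z) (\<lambda>i. boundary_incl (u i))) has_derivative
       (\<lambda>w. half_deriv (\<lambda>z. \<omega> c z (\<lambda>i. boundary_incl (u i))) (boundary_incl y) (boundary_incl w))) (at y)"
      by (rule has_derivative_boundary_incl[OF c smooth_on_has_half_deriv[OF sform_smooth[OF \<omega> c] chart_image_open[OF c] x]])
  qed (simp add: boundary_pullback_chart[OF c \<omega>])
  then show ?thesis
    by (simp add: ext_d_def if_distrib[of boundary_incl] cong: if_cong)
qed


lemma sform_diff:
  assumes "sform k \<omega>" "sform k \<eta>" shows "sform k (\<omega> - \<eta>)"
proof -
  have "\<omega> - \<eta> = \<omega> + (-1) \<odot> \<eta>" by (simp add: form_scale_def fun_eq_iff)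
  then show ?thesis using sform_add[OF assms(1) sform_scale[OF assms(2)]] by metis
qed

lemma boundary_pullback_wedge:
  assumes "sform k \<omega>" "sform l \<eta>" "c \<in> \<A>" "y \<in> chart_image (boundary_chart \<A> c)"
  shows "wedge k l (boundary_pullback \<A> \<omega>) (boundary_pullback \<A> \<eta>) (boundary_chart \<A> c) y v =
    wedge k l \<omega> \<eta> c (boundary_incl y) (\<lambda>i. boundary_incl (v i))"
  unfolding wedge_def boundary_pullback_chart[OF assms(3,1,4)] boundary_pullback_chart[OF assms(3,2,4)] ..

lemma boundary_pullback_eps_wedge:
  assumes "so3form k \<phi>" "so3form l \<psi>" "c \<in> \<A>" "y \<in> chart_image (boundary_chart \<A> c)"
  shows "eps_wedge k l (\<lambda>i. boundary_pullback \<A> (\<phi> i)) (\<lambda>i. boundary_pullback \<A> (\<psi> i)) i (boundary_chart \<A> c) y v =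
    eps_wedge k l \<phi> \<psi> i c (boundary_incl y) (\<lambda>i. boundary_incl (v i))"
  unfolding eps_wedge_apply boundary_pullback_wedge[OF so3form_sform[OF assms(1)] so3form_sform[OF assms(2)] assms(3,4)] ..

lemma boundary_pullback_cov_d:
  assumes A: "so3form 1 A" and e: "so3form 1 e" and c: "c \<in> \<A>" and y: "y \<in> chart_image (boundary_chart \<A> c)"
  shows "cov_d UNIV (\<lambda>i. boundary_pullback \<A> (A i)) 1 (\<lambda>i. boundary_pullback \<A> (e i)) i (boundary_chart \<A> c) y v =
    cov_d half_space A 1 e i c (boundary_incl y) (\<lambda>i. boundary_incl (v i))"
proof -
  have "sform (Suc 1) (ext_d half_space 1 (e i))"
    using sform_ext_d_1[OF so3form_sform[OF e]] by (simp add: numeral_2_eq_2)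
  then show ?thesis
    unfolding cov_d_def plus_fun_apply boundary_pullback_eps_wedge[OF A e c y]
    by (simp only: boundary_pullback_ext_d[OF so3form_sform[OF e] _ c y])
qed

lemma boundary_pullback_curvature:
  assumes A: "so3form 1 A" and c: "c \<in> \<A>" and y: "y \<in> chart_image (boundary_chart \<A> c)"
  shows "curvature UNIV (\<lambda>i. boundary_pullback \<A> (A i)) i (boundary_chart \<A> c) y v =
    curvature half_space A i c (boundary_incl y) (\<lambda>i. boundary_incl (v i))"
proof -
  have "sform (Suc 1) (ext_d half_space 1 (A i))"
    using sform_ext_d_1[OF so3form_sform[OF A]] by (simp add: numeral_2_eq_2)
  then show ?thesis
    unfolding curvature_def plus_fun_apply form_scale_def boundary_pullback_eps_wedge[OF A A c y]
    by (simp only: boundary_pullback_ext_d[OF so3form_sform[OF A] _ c y])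
qed

text \<open>\<open>gr3_field_equations\<close> computes curvature and covariant derivative on the
  3-manifold from the pulled-back fields, while the boundary conditions pull back the forms computed
  on the 4-manifold. The two agree because wedge and exterior derivative commute with the
  pullback.\<close>

lemma gr3_field_equations_boundary:
  assumes A: "so3form 1 A" and e: "so3form 1 e"
  shows "gr3_field_equations (boundary_atlas \<A>) \<Lambda> (\<lambda>i. boundary_pullback \<A> (e i)) (\<lambda>i. boundary_pullback \<A> (A i)) \<longleftrightarrow>
    (\<forall>i. form_eq (boundary_atlas \<A>) (boundary_pullback \<A> (cov_d half_space A 1 e i)) 0) \<and>
    (\<forall>i. form_eq (boundary_atlas \<A>) (boundary_pullback \<A> (curvature half_space A i + (\<Lambda> / 2) \<odot> eps_wedge 1 1 e e i)) 0)"
proof -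
  have ee: "sform 2 (eps_wedge 1 1 e e i)" for i
    using sform_eps_wedge[OF e e] by (simp only: one_add_one)
  have FE: "sform 2 (curvature half_space A i + r \<odot> eps_wedge 1 1 e e i)" for i r
    by (intro sform_add sform_scale ee sform_curvature A)
  show ?thesis
    unfolding gr3_field_equations_def form_eq_boundary_iff[OF FE] form_eq_boundary_iff[OF sform_cov_d_1[OF A e]]
    unfolding form_eq_def boundary_atlas_eq
    by (auto simp: form_scale_def boundary_pullback_cov_d[OF A e, unfolded One_nat_def] boundary_pullback_curvature[OF A]
        boundary_pullback_eps_wedge[OF e e, unfolded One_nat_def] boundary_chart_image)
qed

section \<open>Passing from the two connections to the pair (e, A)\<close>

context
  fixes A e :: "('a, 4) so3_form" and \<alpha> :: real
    and A\<^sub>p A\<^sub>m F\<^sub>p F\<^sub>m F De :: "('a, 4) so3_form"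
  assumes A: "so3form 1 A" and e: "so3form 1 e"
  defines "A\<^sub>p \<equiv> \<lambda>i. A i + \<alpha> \<odot> e i" and "A\<^sub>m \<equiv> \<lambda>i. A i + (\<alpha> - 1) \<odot> e i"
    and "F\<^sub>p \<equiv> curvature half_space A\<^sub>p" and "F\<^sub>m \<equiv> curvature half_space A\<^sub>m"
    and "F \<equiv> curvature half_space A" and "De \<equiv> cov_d half_space A 1 e"
begin

text \<open>Since A_+ and A_- differ by \<open>e\<close>, the Bianchi identity leaves D_- F_+ =
  -(\<epsilon> e F - \<alpha> \<epsilon> De e) and D_+ F_- = \<epsilon> e F - (\<alpha> - 1)
  \<epsilon> De e. Their sum is \<epsilon> De e for every \<alpha>, so the linear system can always
  be solved.\<close>

lemma field_equations_iff:
  "(\<forall>i. form_eq \<A> (cov_d half_space A\<^sub>m 2 F\<^sub>p i) 0) \<and> (\<forall>i. form_eq \<A> (cov_d half_space A\<^sub>p 2 F\<^sub>m i) 0) \<longleftrightarrow>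
   (\<forall>i. form_eq \<A> (eps_wedge 1 2 e F i) 0) \<and> (\<forall>i. form_eq \<A> (eps_wedge 2 1 De e i) 0)"
proof -
  have Ap: "so3form 1 A\<^sub>p" and Am: "so3form 1 A\<^sub>m"
    unfolding A\<^sub>p_def A\<^sub>m_def by (intro so3form_add_scale A e)+
  have "A\<^sub>m = (\<lambda>i. A\<^sub>p i + (-1) \<odot> e i)" and "A\<^sub>p = (\<lambda>i. A\<^sub>m i + 1 \<odot> e i)"
    by (simp_all add: A\<^sub>m_def A\<^sub>p_def form_scale_def fun_eq_iff algebra_simps)
  then have "cov_d half_space A\<^sub>m 2 F\<^sub>p i c x v = cov_d half_space A\<^sub>p 2 F\<^sub>p i c x v + (-1) * eps_wedge 1 2 e F\<^sub>p i c x v"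
    "cov_d half_space A\<^sub>p 2 F\<^sub>m i c x v = cov_d half_space A\<^sub>m 2 F\<^sub>m i c x v + 1 * eps_wedge 1 2 e F\<^sub>m i c x v" for i c x v
    using cov_d_add_scale[of A\<^sub>p "-1" e F\<^sub>p] cov_d_add_scale[of A\<^sub>m 1 e F\<^sub>m] by metis+
  moreover have "eps_wedge 1 2 e F\<^sub>p i c x v = eps_wedge 1 2 e F i c x v - \<alpha> * eps_wedge 2 1 De e i c x v"
    "eps_wedge 1 2 e F\<^sub>m i c x v = eps_wedge 1 2 e F i c x v - (\<alpha> - 1) * eps_wedge 2 1 De e i c x v"
    if "c \<in> \<A>" "x \<in> chart_image c" for i c x v
    unfolding F\<^sub>p_def F\<^sub>m_def A\<^sub>p_def A\<^sub>m_def F_def De_def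
    by (intro eps_wedge_1_2_curvature_add_scale A e that)+
  moreover have "cov_d half_space A\<^sub>p 2 F\<^sub>p i c x v = 0" "cov_d half_space A\<^sub>m 2 F\<^sub>m i c x v = 0"
    if "c \<in> \<A>" "x \<in> chart_image c" for i c x v
    unfolding F\<^sub>p_def F\<^sub>m_def by (intro Bianchi Ap Am that)+
  ultimately have *: "cov_d half_space A\<^sub>m 2 F\<^sub>p i c x v = - (eps_wedge 1 2 e F i c x v - \<alpha> * eps_wedge 2 1 De e i c x v)"
    "cov_d half_space A\<^sub>p 2 F\<^sub>m i c x v = eps_wedge 1 2 e F i c x v - (\<alpha> - 1) * eps_wedge 2 1 De e i c x v"
    if "c \<in> \<A>" "x \<in> chart_image c" for i c x v
    using that by simp_all
  have "cov_d half_space A\<^sub>m 2 F\<^sub>p i c x v = 0 \<and> cov_d half_space A\<^sub>p 2 F\<^sub>m i c x v = 0 \<longleftrightarrow>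
      eps_wedge 1 2 e F i c x v = 0 \<and> eps_wedge 2 1 De e i c x v = 0"
    if "c \<in> \<A>" "x \<in> chart_image c" for i c x v
    unfolding *[OF that] by (auto simp: algebra_simps)
  then show ?thesis unfolding form_eq_def zero_fun_def by meson
qed

text \<open>Calling the two new combinations D' and F', one has F_+ = F' + \<alpha> D' and F_- = F_+
  - D'. This triangular system is invertible for every \<alpha>.\<close>

lemma boundary_conditions_iff:
  "(\<forall>i. form_eq (boundary_atlas \<A>) (boundary_pullback \<A> (F\<^sub>p i)) 0) \<and>
   (\<forall>i. form_eq (boundary_atlas \<A>) (boundary_pullback \<A> (F\<^sub>m i)) 0) \<longleftrightarrow>
   (\<forall>i. form_eq (boundary_atlas \<A>) (boundary_pullback \<A> (De i - ((1/2) * (1 - 2 * \<alpha>)) \<odot> eps_wedge 1 1 e e i)) 0) \<and>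
   (\<forall>i. form_eq (boundary_atlas \<A>) (boundary_pullback \<A> (F i - ((1/2) * \<alpha> * (\<alpha> - 1)) \<odot> eps_wedge 1 1 e e i)) 0)"
proof -
  have ee: "sform 2 (eps_wedge 1 1 e e i)" for i
    using sform_eps_wedge[OF e e] by (simp only: one_add_one)
  have sp: "sform 2 (F\<^sub>p i)" and sm: "sform 2 (F\<^sub>m i)" for i
    unfolding F\<^sub>p_def F\<^sub>m_def A\<^sub>p_def A\<^sub>m_def by (intro sform_curvature so3form_add_scale A e)+
  have sD: "sform 2 (De i - r \<odot> eps_wedge 1 1 e e i)" and sF: "sform 2 (F i - r \<odot> eps_wedge 1 1 e e i)" for i r
    unfolding De_def F_def by (intro sform_diff sform_scale ee sform_cov_d_1 sform_curvature A e)+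
  have "F\<^sub>p i c x v = 0 \<and> F\<^sub>m i c x v = 0 \<longleftrightarrow>
      (De i - ((1/2) * (1 - 2 * \<alpha>)) \<odot> eps_wedge 1 1 e e i) c x v = 0 \<and>
      (F i - ((1/2) * \<alpha> * (\<alpha> - 1)) \<odot> eps_wedge 1 1 e e i) c x v = 0"
    if "c \<in> \<A>" "x \<in> chart_image c" for i c x v
  proof -
    let ?D = "(De i - ((1/2) * (1 - 2 * \<alpha>)) \<odot> eps_wedge 1 1 e e i) c x v"
    let ?F = "(F i - ((1/2) * \<alpha> * (\<alpha> - 1)) \<odot> eps_wedge 1 1 e e i) c x v"
    have "F\<^sub>p i c x v = ?F + \<alpha> * ?D" "F\<^sub>m i c x v = F\<^sub>p i c x v - ?D"
      unfolding F\<^sub>p_def F\<^sub>m_def A\<^sub>p_def A\<^sub>m_def F_def De_def curvature_add_scale[OF that A e]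
      by (simp_all add: form_scale_def field_simps power2_eq_square)
    then show ?thesis by auto
  qed
  then show ?thesis
    unfolding form_eq_boundary_iff[OF sp] form_eq_boundary_iff[OF sm] form_eq_boundary_iff[OF sD] form_eq_boundary_iff[OF sF]
    by meson
qed

lemma lagrangian_decomposition:
  "form_eq \<A> (\<Sum>i\<in>UNIV. wedge 2 2 (F\<^sub>m i) (F\<^sub>p i))
     ((((1 - \<alpha>)\<^sup>2 + \<alpha>\<^sup>2) / 2) \<odot>
        (\<Sum>i\<in>UNIV. \<Sum>j\<in>UNIV. \<Sum>k\<in>UNIV. levi_civita i j k \<odot> wedge 2 2 (wedge 1 1 (e i) (e j)) (F k))
      + (\<alpha> * (1 - \<alpha>) * (1 - 2 * \<alpha>) / 2) \<odot>
        (\<Sum>i\<in>UNIV. \<Sum>j\<in>UNIV. \<Sum>k\<in>UNIV. levi_civita i j k \<odot> wedge 3 1 (wedge 2 1 (De i) (e j)) (e k))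
      + (\<alpha> * (\<alpha> - 1)) \<odot> (\<Sum>i\<in>UNIV. wedge 2 2 (De i) (De i))
      + (2 * \<alpha> - 1) \<odot> (\<Sum>i\<in>UNIV. wedge 2 2 (De i) (F i))
      + (\<Sum>i\<in>UNIV. wedge 2 2 (F i) (F i)))"
proof -
  have sum_apply: "(\<Sum>i\<in>UNIV. \<omega> i) c x v = (\<Sum>i\<in>UNIV. \<omega> i c x v)" for \<omega> :: "3 \<Rightarrow> ('a, 4) form" and c x v
    by (simp add: sum_3)
  \<comment> \<open>The coefficients in the form that \<open>wedge_2_2_decomposition\<close>
    produces at s = \<alpha> - 1 and t = \<alpha>.\<close>
  have coef: "((1 - \<alpha>)\<^sup>2 + \<alpha>\<^sup>2) / 2 = ((\<alpha> - 1)\<^sup>2 + \<alpha>\<^sup>2) / 2"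
    "\<alpha> * (1 - \<alpha>) * (1 - 2 * \<alpha>) / 2 = (\<alpha> - 1) * \<alpha> * (\<alpha> - 1 + \<alpha>) / 2"
    "\<alpha> * (\<alpha> - 1) = (\<alpha> - 1) * \<alpha>" "2 * \<alpha> - 1 = \<alpha> - 1 + \<alpha>"
    by (simp_all add: algebra_simps power2_eq_square)
  show ?thesis
    unfolding form_eq_def plus_fun_apply form_scale_def sum_apply coef
    unfolding F\<^sub>p_def F\<^sub>m_def A\<^sub>p_def A\<^sub>m_def F_def De_def
    using wedge_2_2_decomposition[OF A e] by blast
qed

end

end

section \<open>Partitions of unity and the integral\<close>

text \<open>Some of these names also belong to facts about the Bochner integral; the aliases fix the
  gauge integral, in which \<open>form_integral\<close> is defined.\<close>

lemmas hk_integral_add = Henstock_Kurzweil_Integration.integral_add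
  and hk_integral_cong = Henstock_Kurzweil_Integration.integral_cong
  and hk_integral_diff = Henstock_Kurzweil_Integration.integral_diff
  and hk_integral_mult_right = Henstock_Kurzweil_Integration.integral_mult_right
  and hk_integral_nonneg = Henstock_Kurzweil_Integration.integral_nonneg
  and hk_integral_restrict_Int = Henstock_Kurzweil_Integration.integral_restrict_Int
  and hk_integral_restrict_UNIV = Henstock_Kurzweil_Integration.integral_restrict_UNIV
  and hk_integral_sum = Henstock_Kurzweil_Integration.integral_sum

text \<open>Cutting off with the indicator of \<open>K\<close> gives a Borel integrable function on
  the whole space; it stays integrable for the completed measure and agrees with the cut-off to
  \<open>S\<close>.\<close>

lemma absolutely_integrable_on_compact_support:
  fixes f :: "'v::euclidean_space \<Rightarrow> real"
  assumes "continuous_on K f" "compact K" "K \<subseteq> S" "\<And>x. x \<in> S - K \<Longrightarrow> f x = 0"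
  shows "f absolutely_integrable_on S"
proof -
  have 1: "integrable lborel (\<lambda>x. indicator K x *\<^sub>R f x)"
    by (rule borel_integrable_compact[OF assms(2,1)])
  then have "integrable lebesgue (\<lambda>x. indicator K x *\<^sub>R f x)"
    by (subst integrable_completion) auto
  also have "(\<lambda>x. indicator K x *\<^sub>R f x) = (\<lambda>x. indicator S x *\<^sub>R f x)"
    using assms(3,4) by (auto simp: fun_eq_iff indicator_def)
  finally show ?thesis by (simp add: set_integrable_def)
qed

lemma integral_zero_outside:
  fixes f :: "'v::euclidean_space \<Rightarrow> real"
  assumes "T \<subseteq> S" "\<And>x. x \<in> S - T \<Longrightarrow> f x = 0"
  shows "integral S f = integral T f"
proof -
  have "integral UNIV (\<lambda>x. if x \<in> S then f x else 0) = integral UNIV (\<lambda>x. if x \<in> T then f x else 0)"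
    by (rule arg_cong[where f="integral UNIV"]) (use assms in \<open>auto simp: fun_eq_iff\<close>)
  then show ?thesis by (simp add: hk_integral_restrict_UNIV)
qed

lemma closed_half_space: "closed half_space"
  unfolding half_space_def using closed_halfspace_component_ge_cart[of 0 "1::4"] by simp

lemma relopen_half_space_lebesgue:
  assumes "relopen S"
  shows "S \<in> sets lebesgue"
proof -
  obtain V where V: "open V" "S = half_space \<inter> V" using assms by (auto simp: openin_open)
  have "S \<in> sets borel" using V closed_half_space by (simp add: sets.Int)
  then show ?thesis by simp
qed

context oriented_manifold
begin

lemma continuous_chart_inv:
  assumes c: "c \<in> \<A>"
  shows "continuous_map (top_of_set (chart_image c)) X (chart_inv c)"
  unfolding continuous_map_def
proof (intro conjI allI impI)
  show "chart_inv c \<in> topspace (top_of_set (chart_image c)) \<rightarrow> topspace X"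
    using c chart_domain_subset[OF c] by auto
  fix W assume W: "openin X W"
  have "snd c ` (fst c \<inter> W) = {x \<in> topspace (top_of_set (chart_image c)). chart_inv c x \<in> W}"
    using c by (force simp: chart_image_def)
  moreover have "relopen (snd c ` (fst c \<inter> W))"
    by (intro openin_chart_image c openin_Int chart_domain_open W) auto
  then have "openin (top_of_set (chart_image c)) (snd c ` (fst c \<inter> W))"
    by (rule openin_subset_trans) (use c chart_image_half_space[OF c] in auto)
  ultimately show "openin (top_of_set (chart_image c)) {x \<in> topspace (top_of_set (chart_image c)). chart_inv c x \<in> W}"
    by simp
qed

lemma compactin_chart_inv_image:
  assumes c: "c \<in> \<A>" and K: "compact K" "K \<subseteq> chart_image c"
  shows "compactin X (chart_inv c ` K)" "closedin X (chart_inv c ` K)" "chart_inv c ` K \<subseteq> fst c"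
proof -
  have "compactin (top_of_set (chart_image c)) K" using K by (simp add: compactin_subtopology)
  then show 1: "compactin X (chart_inv c ` K)" using image_compactin continuous_chart_inv[OF c] by blast
  show "closedin X (chart_inv c ` K)" by (rule compactin_imp_closedin[OF hausdorff 1])
  show "chart_inv c ` K \<subseteq> fst c" using K c by auto
qed

lemma compact_chart_image:
  assumes c: "c \<in> \<A>" and K: "compactin X K" "K \<subseteq> fst c"
  shows "compact (snd c ` K)" "snd c ` K \<subseteq> chart_image c"
proof -
  have "compactin (subtopology X (fst c)) K" using K by (simp add: compactin_subtopology)
  then have "compactin (top_of_set (chart_image c)) (snd c ` K)"
    using homeomorphic_imp_continuous_map[OF chart_homeomorphic[OF c]] image_compactin by blast
  then show "compact (snd c ` K)" by (simp add: compactin_subtopology)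
  show "snd c ` K \<subseteq> chart_image c" using K by (auto simp: chart_image_def)
qed

text \<open>Extension by zero across chart domains. A point outside the overlap is not in
  \<open>K\<close>, and because \<open>K\<close> is closed in the manifold a whole neighbourhood of
  it avoids \<open>K\<close>, where the function is constantly zero.\<close>

lemma smooth_on_chart_extend:
  assumes c: "c \<in> \<A>" and d: "d \<in> \<A>" and K: "closedin X K" "K \<subseteq> fst c"
    and f: "smooth_on (overlap d c) f" "\<And>x. x \<in> chart_image d \<Longrightarrow> chart_inv d x \<notin> K \<Longrightarrow> f x = 0"
  shows "smooth_on (chart_image d) f"
proof (rule smooth_on_local)
  fix x assume x: "x \<in> chart_image d"
  have xh: "x \<in> half_space" by (rule chart_image_half_space[OF d x])
  show "\<exists>V. open V \<and> x \<in> V \<and> smooth_on (chart_image d \<inter> V) f"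
  proof (cases "x \<in> overlap d c")
    case True
    obtain V where V: "open V" "overlap d c = half_space \<inter> V"
      using overlap_open[OF d c] by (auto simp: openin_open)
    have "smooth_on (chart_image d \<inter> V) f"
      by (rule smooth_on_subset[OF f(1)]) (use V(2) chart_image_half_space[OF d] in auto)
    then show ?thesis using V True by auto
  next
    case False
    then have nK: "chart_inv d x \<notin> K" using K x d by (auto simp: overlap_iff[OF d c])
    have "openin X (fst d - K)" using K chart_domain_open[OF d] by blast
    then have "relopen (snd d ` (fst d - K))"
      by (intro openin_chart_image d) auto
    then obtain V where V: "open V" "snd d ` (fst d - K) = half_space \<inter> V" by (auto simp: openin_open)
    have xV: "x \<in> snd d ` (fst d - K)"
      using nK x d by (intro image_eqI[of _ _ "chart_inv d x"]) auto
    have "smooth_on (chart_image d \<inter> V) (\<lambda>_. 0 :: 'b)" by (rule smooth_on_const)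
    then have "smooth_on (chart_image d \<inter> V) f"
    proof (rule smooth_on_cong)
      fix y assume y: "y \<in> chart_image d \<inter> V"
      then have "y \<in> snd d ` (fst d - K)" using V(2) chart_image_half_space[OF d] by auto
      then have "chart_inv d y \<notin> K" using d by auto
      then show "0 = f y" using f(2) y by simp
    qed
    then show ?thesis using V xV by auto
  qed
qed

section \<open>Bump functions and partitions of unity\<close>

lemma support_subset_closed:
  assumes "closedin X K" "\<And>p. p \<in> topspace X \<Longrightarrow> p \<notin> K \<Longrightarrow> f p = 0"
  shows "function_support X f \<subseteq> K"
  unfolding function_support_def using assms by (intro closure_of_minimal) auto

lemma support_zero:
  assumes "p \<in> topspace X" "p \<notin> function_support X f" shows "f p = 0"
  using assms closure_of_subset[of "{p \<in> topspace X. f p \<noteq> 0}" X] unfolding function_support_def by auto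

text \<open>The conditions on a single member of \<open>partition_of_unity_on\<close>, isolated
  because they are stable under sums and under products with nonnegative smooth functions.\<close>

definition bump_in :: "('a, 4) chart \<Rightarrow> ('a \<Rightarrow> real) \<Rightarrow> bool" where
  "bump_in c f \<longleftrightarrow> smooth_function \<A> f \<and> (\<forall>p\<in>topspace X. 0 \<le> f p) \<and>
     compactin X (function_support X f) \<and> function_support X f \<subseteq> fst c"

lemma bump_inI:
  assumes "smooth_function \<A> f" "\<And>p. p \<in> topspace X \<Longrightarrow> 0 \<le> f p"
    and "compactin X K" "K \<subseteq> fst c" "\<And>p. p \<in> topspace X \<Longrightarrow> p \<notin> K \<Longrightarrow> f p = 0"
  shows "bump_in c f"
proof -
  have "closedin X K" by (rule compactin_imp_closedin[OF hausdorff assms(3)])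
  then have "function_support X f \<subseteq> K" using assms(5) by (rule support_subset_closed)
  moreover have "closedin X (function_support X f)" by (simp add: function_support_def)
  ultimately show ?thesis
    unfolding bump_in_def using assms closed_compactin by blast
qed

lemma bump_from_chart:
  fixes \<theta> :: "real^4 \<Rightarrow> real"
  assumes c: "c \<in> \<A>" and \<theta>: "smooth_on (chart_image c) \<theta>" "\<And>x. x \<in> chart_image c \<Longrightarrow> 0 \<le> \<theta> x"
    and K: "compact K" "K \<subseteq> chart_image c" "\<And>x. x \<in> chart_image c - K \<Longrightarrow> \<theta> x = 0"
  shows "bump_in c (\<lambda>p. if p \<in> fst c then \<theta> (snd c p) else 0)"
proof (rule bump_inI)
  let ?K = "chart_inv c ` K"
  let ?f = "\<lambda>p. if p \<in> fst c then \<theta> (snd c p) else 0"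
  note K' = compactin_chart_inv_image[OF c K(1,2)]
  show "compactin X ?K" "?K \<subseteq> fst c" by (fact K')+
  show z: "?f p = 0" if "p \<notin> ?K" for p
  proof (cases "p \<in> fst c")
    case True
    then have "snd c p \<notin> K" using that c by (metis chart_inv_chart image_eqI)
    then show ?thesis using True K(3)[of "snd c p"] c by simp
  qed simp
  show "0 \<le> ?f p" for p using \<theta>(2) c by simp
  show "smooth_function \<A> ?f"
    unfolding smooth_function_def
  proof
    fix d assume d: "d \<in> \<A>"
    show "smooth_on (chart_image d) (?f \<circ> chart_inv d)"
    proof (rule smooth_on_chart_extend[OF c d K'(2,3)])
      have "smooth_on (overlap d c) (\<lambda>x. \<theta> (transition d c x))"
        by (rule smooth_on_compose[OF smooth_transition[OF d c] \<theta>(1)])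
          (use transition_mem[OF d c] overlap_subset[OF c d] in blast)
      then show "smooth_on (overlap d c) (?f \<circ> chart_inv d)"
        by (rule smooth_on_cong) (simp add: overlap_iff[OF d c] local_rep_def)
    qed (use z in auto)
  qed
qed

lemma smooth_function_add: "smooth_function \<A> f \<Longrightarrow> smooth_function \<A> g \<Longrightarrow> smooth_function \<A> (\<lambda>p. f p + g p)"
  unfolding smooth_function_def o_def by (auto intro: smooth_on_add)

lemma smooth_function_mult: "smooth_function \<A> f \<Longrightarrow> smooth_function \<A> g \<Longrightarrow> smooth_function \<A> (\<lambda>p. f p * g p)"
  unfolding smooth_function_def o_def by (auto intro: smooth_on_mult)

lemma smooth_function_prod_compl:
  "(\<And>i. i \<in> I \<Longrightarrow> smooth_function \<A> (f i)) \<Longrightarrow> smooth_function \<A> (\<lambda>p. \<Prod>i\<in>I. 1 - f i p)"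
  unfolding smooth_function_def o_def
  by (auto intro!: smooth_on_prod smooth_on_diff smooth_on_const)

lemma bump_in_add:
  assumes "bump_in c f" "bump_in c g"
  shows "bump_in c (\<lambda>p. f p + g p)"
  using assms unfolding bump_in_def
  by (intro bump_inI[unfolded bump_in_def, of _ "function_support X f \<union> function_support X g"])
    (auto intro: smooth_function_add compactin_Un simp: support_zero)

lemma bump_in_mult:
  assumes "bump_in c f" "smooth_function \<A> g" "\<And>p. p \<in> topspace X \<Longrightarrow> 0 \<le> g p"
  shows "bump_in c (\<lambda>p. f p * g p)"
  using assms unfolding bump_in_def
  by (intro bump_inI[unfolded bump_in_def, of _ "function_support X f"])
    (auto intro: smooth_function_mult simp: support_zero)

lemma bump_in_zero: "bump_in c (\<lambda>_. 0)"
  by (rule bump_inI[of _ "{}"]) (auto simp: smooth_function_def o_def smooth_on_const)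

lemma chart_ball:
  assumes c: "c \<in> \<A>" and x: "x \<in> chart_image c"
  obtains r where "r > 0" "\<And>s. s \<le> r \<Longrightarrow> cball x s \<inter> half_space \<subseteq> chart_image c"
proof -
  obtain V where V: "open V" "chart_image c = half_space \<inter> V"
    using chart_image_open[OF c] by (auto simp: openin_open)
  then have "x \<in> V" using x by auto
  then obtain r where "r > 0" "cball x r \<subseteq> V" using V(1) open_contains_cball by blast
  then show ?thesis using V(2) subset_cball by (intro that[of r]) blast+
qed

lemma bump_at:
  assumes c: "c \<in> \<A>" and p: "p \<in> fst c"
  obtains f N where "bump_in c f" "\<And>q. f q \<le> 1" "openin X N" "p \<in> N" "\<And>q. q \<in> N \<Longrightarrow> f q = 1"
proof -
  have x: "snd c p \<in> chart_image c" using c p by simp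
  obtain r where r: "r > 0" "\<And>s. s \<le> r \<Longrightarrow> cball (snd c p) s \<inter> half_space \<subseteq> chart_image c"
    by (rule chart_ball[OF c x]) (rule that)
  \<comment> \<open>\<open>Ck_bump\<close> has its support in the ball of twice the given radius;
    halving keeps the support in the ball that the chart covers.\<close>
  have r2: "r / 2 > 0" using r(1) by simp
  obtain b :: "real^4 \<Rightarrow> real" where b: "\<And>k. Ck_on k UNIV b" "\<And>y. 0 \<le> b y" "\<And>y. b y \<le> 1"
    "\<And>y. y \<in> cball (snd c p) (r / 2) \<Longrightarrow> b y = 1" "\<And>y. y \<notin> cball (snd c p) (2 * (r / 2)) \<Longrightarrow> b y = 0"
    using Ck_bump[OF r2, of "snd c p"] by blast
  define N where "N = {q \<in> fst c. snd c q \<in> half_space \<inter> ball (snd c p) (r / 2)}"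
  show ?thesis
  proof (rule that)
    show "bump_in c (\<lambda>q. if q \<in> fst c then b (snd c q) else 0)"
    proof (rule bump_from_chart[OF c])
      show "smooth_on (chart_image c) b" by (rule smooth_on_UNIV_Ck[OF b(1)])
      show "compact (cball (snd c p) r \<inter> half_space)"
        by (intro compact_Int_closed compact_cball closed_half_space)
      show "cball (snd c p) r \<inter> half_space \<subseteq> chart_image c" using r(2) by blast
      show "b y = 0" if "y \<in> chart_image c - cball (snd c p) r \<inter> half_space" for y
        using that b(5)[of y] chart_image_half_space[OF c, of y] by auto
    qed (use b in auto)
    show "openin X N" unfolding N_def by (intro openin_chart_preimage c openin_open_Int open_ball)
    show "p \<in> N" using p r(1) chart_image_half_space[OF c x] by (simp add: N_def)
    show "(if q \<in> fst c then b (snd c q) else 0) = 1" if "q \<in> N" for q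
      using that b(4)[of "snd c q"] by (auto simp: N_def)
    show "(if q \<in> fst c then b (snd c q) else 0) \<le> 1" for q using b(3) by simp
  qed
qed

text \<open>Multiplying each bump by the complements of the previous ones makes the sum telescope to
  \<open>1 - \<Prod>(1 - f)\<close>, which avoids dividing by the sum.\<close>

lemma partition_from_bumps:
  assumes "finite P" "\<And>p. p \<in> P \<Longrightarrow> ch p \<in> \<A> \<and> bump_in (ch p) (f p) \<and> (\<forall>q. f p q \<le> 1)"
  shows "\<exists>C \<rho>. finite C \<and> C \<subseteq> \<A> \<and> (\<forall>c. bump_in c (\<rho> c)) \<and> (\<forall>c. c \<notin> C \<longrightarrow> \<rho> c = (\<lambda>_. 0)) \<and>
    (\<forall>q. (\<Sum>c\<in>C. \<rho> c q) = 1 - (\<Prod>p\<in>P. 1 - f p q))"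
  using assms
proof (induction P rule: finite_induct)
  case empty
  show ?case by (intro exI[of _ "{}"] exI[of _ "\<lambda>_ _. 0"]) (auto simp: bump_in_zero)
next
  case (insert p P)
  then obtain C \<rho> where C: "finite C" "C \<subseteq> \<A>" "\<And>c. bump_in c (\<rho> c)" "\<And>c. c \<notin> C \<Longrightarrow> \<rho> c = (\<lambda>_. 0)"
    "\<And>q. (\<Sum>c\<in>C. \<rho> c q) = 1 - (\<Prod>p\<in>P. 1 - f p q)"
    by auto
  define g where "g q = f p q * (\<Prod>p\<in>P. 1 - f p q)" for q
  have g: "bump_in (ch p) g"
    unfolding g_def using insert.prems
    by (intro bump_in_mult smooth_function_prod_compl prod_nonneg) (auto simp: bump_in_def)
  \<comment> \<open>Different points may have been assigned the same chart, so the new bump is added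
    to what that chart already carries. For a chart outside \<open>C\<close> the earlier value is 0
    by the induction hypothesis, so no case is lost.\<close>
  define \<rho>' where "\<rho>' = \<rho>(ch p := (\<lambda>q. \<rho> (ch p) q + g q))"
  have "(\<Sum>c\<in>insert (ch p) C. \<rho>' c q) = 1 - (\<Prod>p\<in>insert p P. 1 - f p q)" for q
  proof -
    have "(\<Sum>c\<in>insert (ch p) C. \<rho>' c q) = (\<Sum>c\<in>insert (ch p) C. \<rho> c q + (if c = ch p then g q else 0))"
      by (rule sum.cong) (auto simp: \<rho>'_def)
    also have "\<dots> = (\<Sum>c\<in>insert (ch p) C. \<rho> c q) + g q"
      using C(1) by (simp add: sum.distrib)
    also have "(\<Sum>c\<in>insert (ch p) C. \<rho> c q) = (\<Sum>c\<in>C. \<rho> c q)"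
      using C(1,4) by (cases "ch p \<in> C") (auto simp: insert_absorb)
    finally show ?thesis using insert.hyps C(5) by (simp add: g_def algebra_simps)
  qed
  moreover have "bump_in c (\<rho>' c)" for c
    using C(3) g bump_in_add by (auto simp: \<rho>'_def)
  ultimately show ?case
    using C insert.prems by (intro exI[of _ "insert (ch p) C"] exI[of _ \<rho>']) (auto simp: \<rho>'_def)
qed

text \<open>Compactness selects finitely many bumps, each equal to 1 on an open set, these sets
  covering \<open>K\<close>. At every point of \<open>K\<close> some complement 1 - f is then 0,
  hence so is their product, and the telescoped sum is 1.\<close>

lemma partition_of_unity_exists:
  assumes K: "compactin X K"
  shows "\<exists>C \<rho>. partition_of_unity_on X \<A> K C \<rho>"
proof -
  have "\<exists>c f N. c \<in> \<A> \<and> bump_in c f \<and> (\<forall>q. f q \<le> 1) \<and> openin X N \<and> p \<in> N \<and> (\<forall>q\<in>N. f q = 1)" if "p \<in> K" for p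
  proof -
    have "p \<in> topspace X" using K that compactin_subset_topspace by blast
    then obtain c where c: "c \<in> \<A>" "p \<in> fst c" using charts_cover by blast
    from bump_at[OF this] show ?thesis using c by metis
  qed
  then obtain ch f N where *: "\<And>p. p \<in> K \<Longrightarrow> ch p \<in> \<A> \<and> bump_in (ch p) (f p) \<and> (\<forall>q. f p q \<le> 1) \<and>
      openin X (N p) \<and> p \<in> N p \<and> (\<forall>q\<in>N p. f p q = 1)"
    by metis
  have "\<exists>\<F>. finite \<F> \<and> \<F> \<subseteq> N ` K \<and> K \<subseteq> \<Union>\<F>"
    by (rule compactinD[OF K]) (use * in auto)
  then obtain P where P: "finite P" "P \<subseteq> K" "K \<subseteq> (\<Union>p\<in>P. N p)"
    by (metis finite_subset_image)
  obtain C \<rho> where C: "finite C" "C \<subseteq> \<A>" "\<And>c. bump_in c (\<rho> c)"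
    "\<And>q. (\<Sum>c\<in>C. \<rho> c q) = 1 - (\<Prod>p\<in>P. 1 - f p q)"
    using partition_from_bumps[OF P(1), of ch f] * P(2) by blast
  have "(\<Sum>c\<in>C. \<rho> c q) = 1" if q: "q \<in> K" for q
  proof -
    obtain p where "p \<in> P" "q \<in> N p" using P(3) q by blast
    then have "1 - f p q = 0" using * P(2) by auto
    then have "(\<Prod>p\<in>P. 1 - f p q) = 0" using \<open>p \<in> P\<close> by (intro prod_zero P(1)) blast
    then show ?thesis unfolding C(4) by simp
  qed
  then have "partition_of_unity_on X \<A> K C \<rho>"
    using C(1-3) by (auto simp: partition_of_unity_on_def bump_in_def)
  then show ?thesis by blast
qed

section \<open>Independence of the integral from charts and partitions\<close>

lemma form_support_zero:
  assumes "c \<in> \<A>" "x \<in> chart_image c" "chart_inv c x \<notin> form_support X \<A> \<omega>"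
  shows "\<omega> c x v = 0"
proof -
  let ?S = "{p. \<exists>c\<in>\<A>. p \<in> fst c \<and> (\<exists>v. \<omega> c (snd c p) v \<noteq> 0)}"
  have "?S \<subseteq> topspace X" using chart_domain_subset by blast
  then have "?S \<subseteq> form_support X \<A> \<omega>" unfolding form_support_def by (rule closure_of_subset)
  then have "chart_inv c x \<notin> ?S" using assms(3) by blast
  then show ?thesis using assms(1,2) by auto
qed

lemma form_support_subset:
  assumes "closedin X K" "\<And>c x v. c \<in> \<A> \<Longrightarrow> x \<in> chart_image c \<Longrightarrow> chart_inv c x \<notin> K \<Longrightarrow> \<omega> c x v = 0"
  shows "form_support X \<A> \<omega> \<subseteq> K"
proof -
  have "p \<in> K" if "c \<in> \<A>" "p \<in> fst c" "\<omega> c (snd c p) v \<noteq> 0" for c p v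
    using assms(2)[of c "snd c p" v] that by auto
  then show ?thesis unfolding form_support_def using assms(1) by (intro closure_of_minimal) auto
qed

lemma absolutely_integrable_top_form:
  assumes \<omega>: "sform k \<omega>" and c: "c \<in> \<A>" and K: "compactin X K" "K \<subseteq> fst c"
    and z: "\<And>x. x \<in> chart_image c \<Longrightarrow> chart_inv c x \<notin> K \<Longrightarrow> \<omega> c x v = 0"
  shows "(\<lambda>x. \<omega> c x v) absolutely_integrable_on (chart_image c)"
proof (rule absolutely_integrable_on_compact_support[OF _ compact_chart_image[OF c K]])
  show "continuous_on (snd c ` K) (\<lambda>x. \<omega> c x v)"
    using smooth_on_imp_continuous_on[OF sform_smooth[OF \<omega> c]] compact_chart_image(2)[OF c K]
    by (rule continuous_on_subset)
  show "\<omega> c x v = 0" if "x \<in> chart_image c - snd c ` K" for x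
  proof (rule z)
    show "chart_inv c x \<notin> K" using that c by (metis DiffE chart_chart_inv image_eqI)
  qed (use that in auto)
qed

text \<open>The support lies over the overlap, where both integrals are compared by the change of
  variables formula. A 4-form transforms by the determinant of the Jacobian and the formula contains
  its absolute value; orientation makes them equal.\<close>

lemma integral_chart_change:
  assumes \<omega>: "sform 4 \<omega>" and c: "c \<in> \<A>" and d: "d \<in> \<A>" and K: "compactin X K" "K \<subseteq> fst c" "K \<subseteq> fst d"
    and z: "\<And>e x v. e \<in> \<A> \<Longrightarrow> x \<in> chart_image e \<Longrightarrow> chart_inv e x \<notin> K \<Longrightarrow> \<omega> e x v = 0"
  shows "integral (chart_image c) (\<lambda>x. \<omega> c x std_frame) = integral (chart_image d) (\<lambda>x. \<omega> d x std_frame)"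
proof -
  let ?S = "overlap c d" and ?T = "transition c d"
  \<comment> \<open>The integrand is lifted to \<open>real^1\<close>, since the change of variables
    formula used is for maps into Cartesian spaces.\<close>
  let ?f = "\<lambda>x. vec (\<omega> d x std_frame) :: real^1"
  have inj: "inj_on ?T ?S"
    by (rule inj_on_inverseI[of _ "transition d c"])
      (use c d in \<open>auto simp: overlap_iff[OF c d] local_rep_def\<close>)
  have img: "?T ` ?S = overlap d c"
  proof
    show "?T ` ?S \<subseteq> overlap d c" using transition_mem[OF c d] by blast
    show "overlap d c \<subseteq> ?T ` ?S"
    proof
      fix y assume y: "y \<in> overlap d c"
      then have "y = ?T (transition d c y)" using c d by (auto simp: overlap_iff[OF d c] local_rep_def)
      then show "y \<in> ?T ` ?S" using transition_mem[OF d c y] by blast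
    qed
  qed
  have der: "(?T has_derivative half_deriv ?T x) (at x within ?S)" if "x \<in> ?S" for x
    using smooth_on_has_half_deriv[OF smooth_transition[OF c d] overlap_open[OF c d] that]
      at_within_relopen[OF overlap_open[OF c d] that] by simp
  have "(\<lambda>x. \<omega> d x std_frame) absolutely_integrable_on (chart_image d)"
    by (rule absolutely_integrable_top_form[OF \<omega> d K(1,3)]) (rule z[OF d])
  then have "(\<lambda>x. \<omega> d x std_frame) absolutely_integrable_on (overlap d c)"
    by (rule set_integrable_subset[OF _ relopen_half_space_lebesgue[OF overlap_open[OF d c]] overlap_subset[OF d c]])
  then have "?f absolutely_integrable_on (?T ` ?S)"
    by (simp add: img absolutely_integrable_on_1_iff)
  then have "integral (?T ` ?S) ?f = integral ?S (\<lambda>x. \<bar>det (matrix (half_deriv ?T x))\<bar> *\<^sub>R ?f (?T x))"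
    by (intro integral_change_of_variables relopen_half_space_lebesgue overlap_open c d der inj) auto
  also have "integral ?S (\<lambda>x. \<bar>det (matrix (half_deriv ?T x))\<bar> *\<^sub>R ?f (?T x)) = integral ?S (\<lambda>x. vec (\<omega> c x std_frame))"
  proof (rule hk_integral_cong)
    fix x assume x: "x \<in> ?S"
    have "?T x \<in> chart_image d" using transition_mem[OF c d x] overlap_subset[OF d c] by blast
    then have "\<omega> c x std_frame = det (matrix (half_deriv ?T x)) * \<omega> d (?T x) std_frame"
      using sform_transition[OF \<omega> c d x, of std_frame]
        alternating_form_4_det[OF sform_alternating[OF \<omega> d] linear_transition_deriv[OF c d x]] by simp
    then show "\<bar>det (matrix (half_deriv ?T x))\<bar> *\<^sub>R ?f (?T x) = vec (\<omega> c x std_frame)"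
      using det_transition_pos[OF c d x] by (simp add: vec_eq_iff)
  qed
  finally have "integral (overlap d c) (\<lambda>x. \<omega> d x std_frame) = integral (overlap c d) (\<lambda>x. \<omega> c x std_frame)"
    by (simp add: img integral_on_1_eq)
  moreover have "integral (chart_image c) (\<lambda>x. \<omega> c x std_frame) = integral (overlap c d) (\<lambda>x. \<omega> c x std_frame)"
    by (rule integral_zero_outside[OF overlap_subset[OF c d]]) (use z[OF c] K(3) in \<open>auto simp: overlap_iff[OF c d]\<close>)
  moreover have "integral (chart_image d) (\<lambda>x. \<omega> d x std_frame) = integral (overlap d c) (\<lambda>x. \<omega> d x std_frame)"
    by (rule integral_zero_outside[OF overlap_subset[OF d c]]) (use z[OF d] K(2) in \<open>auto simp: overlap_iff[OF d c]\<close>)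
  ultimately show ?thesis by simp
qed

lemma partition_integral_expand:
  assumes \<omega>: "sform 4 \<omega>" and \<rho>: "partition_of_unity_on X \<A> K C \<rho>" and \<theta>: "partition_of_unity_on X \<A> K D \<theta>"
    and K: "form_support X \<A> \<omega> \<subseteq> K"
  shows "(\<Sum>c\<in>C. integral (chart_image c) (\<lambda>x. \<rho> c (chart_inv c x) * \<omega> c x std_frame)) =
    (\<Sum>c\<in>C. \<Sum>d\<in>D. integral (chart_image c) (\<lambda>x. fun_mult (\<lambda>p. \<rho> c p * \<theta> d p) \<omega> c x std_frame))"
proof (rule sum.cong[OF refl])
  fix c assume c: "c \<in> C"
  then have cA: "c \<in> \<A>" and \<rho>c: "bump_in c (\<rho> c)"
    using \<rho> by (auto simp: partition_of_unity_on_def bump_in_def)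
  have D: "finite D" and sD: "smooth_function \<A> (\<theta> d)" if "d \<in> D" for d
    using \<theta> that by (auto simp: partition_of_unity_on_def)
  have fD: "finite D" using \<theta> by (auto simp: partition_of_unity_on_def)
  have "integral (chart_image c) (\<lambda>x. \<rho> c (chart_inv c x) * \<omega> c x std_frame) =
      integral (chart_image c) (\<lambda>x. \<Sum>d\<in>D. fun_mult (\<lambda>p. \<rho> c p * \<theta> d p) \<omega> c x std_frame)"
  proof (rule hk_integral_cong)
    fix x assume x: "x \<in> chart_image c"
    show "\<rho> c (chart_inv c x) * \<omega> c x std_frame = (\<Sum>d\<in>D. fun_mult (\<lambda>p. \<rho> c p * \<theta> d p) \<omega> c x std_frame)"
    proof (cases "chart_inv c x \<in> form_support X \<A> \<omega>")
      case True
      then have "(\<Sum>d\<in>D. \<theta> d (chart_inv c x)) = 1" using \<theta> K by (auto simp: partition_of_unity_on_def)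
      then show ?thesis
        by (simp add: fun_mult_def mult.assoc sum_distrib_left[symmetric] sum_distrib_right[symmetric])
    next
      case False
      then show ?thesis using form_support_zero[OF cA x False] by (simp add: fun_mult_def)
    qed
  qed
  also have "\<dots> = (\<Sum>d\<in>D. integral (chart_image c) (\<lambda>x. fun_mult (\<lambda>p. \<rho> c p * \<theta> d p) \<omega> c x std_frame))"
  proof (rule hk_integral_sum[OF fD])
    fix d assume d: "d \<in> D"
    have "sform 4 (fun_mult (\<lambda>p. \<rho> c p * \<theta> d p) \<omega>)"
      using \<rho>c sD[OF d] by (intro sform_fun_mult smooth_function_mult \<omega>) (auto simp: bump_in_def)
    then have "(\<lambda>x. fun_mult (\<lambda>p. \<rho> c p * \<theta> d p) \<omega> c x std_frame) absolutely_integrable_on chart_image c"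
    proof (rule absolutely_integrable_top_form[OF _ cA])
      show "compactin X (function_support X (\<rho> c))" "function_support X (\<rho> c) \<subseteq> fst c"
        using \<rho>c by (auto simp: bump_in_def)
      show "fun_mult (\<lambda>p. \<rho> c p * \<theta> d p) \<omega> c x std_frame = 0"
        if "x \<in> chart_image c" "chart_inv c x \<notin> function_support X (\<rho> c)" for x
        using support_zero[OF _ that(2)] that(1) cA chart_domain_subset[OF cA] by (force simp: fun_mult_def)
    qed
    then show "(\<lambda>x. fun_mult (\<lambda>p. \<rho> c p * \<theta> d p) \<omega> c x std_frame) integrable_on chart_image c"
      by (rule set_lebesgue_integral_eq_integral(1))
  qed
  finally show "integral (chart_image c) (\<lambda>x. \<rho> c (chart_inv c x) * \<omega> c x std_frame) =
      (\<Sum>d\<in>D. integral (chart_image c) (\<lambda>x. fun_mult (\<lambda>p. \<rho> c p * \<theta> d p) \<omega> c x std_frame))" .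
qed

text \<open>Inserting the other partition expands either side into a double sum. Each product of two
  bumps has compact support in both chart domains, so its integral may be taken in either
  chart.\<close>

lemma partition_integral_unique:
  assumes \<omega>: "sform 4 \<omega>" and \<rho>: "partition_of_unity_on X \<A> K C \<rho>" and \<theta>: "partition_of_unity_on X \<A> K D \<theta>"
    and K: "form_support X \<A> \<omega> \<subseteq> K"
  shows "(\<Sum>c\<in>C. integral (chart_image c) (\<lambda>x. \<rho> c (chart_inv c x) * \<omega> c x std_frame)) =
    (\<Sum>d\<in>D. integral (chart_image d) (\<lambda>x. \<theta> d (chart_inv d x) * \<omega> d x std_frame))"
proof -
  have "integral (chart_image c) (\<lambda>x. fun_mult (\<lambda>p. \<rho> c p * \<theta> d p) \<omega> c x std_frame) =
      integral (chart_image d) (\<lambda>x. fun_mult (\<lambda>p. \<theta> d p * \<rho> c p) \<omega> d x std_frame)" if "c \<in> C" "d \<in> D" for c d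
  proof -
    have c: "c \<in> \<A>" "bump_in c (\<rho> c)" and d: "d \<in> \<A>" "bump_in d (\<theta> d)"
      using \<rho> \<theta> that by (auto simp: partition_of_unity_on_def bump_in_def)
    let ?K = "function_support X (\<rho> c) \<inter> function_support X (\<theta> d)"
    have comm: "(\<lambda>p. \<theta> d p * \<rho> c p) = (\<lambda>p. \<rho> c p * \<theta> d p)" by (simp add: mult.commute)
    show ?thesis
      unfolding comm
    proof (rule integral_chart_change[OF _ c(1) d(1), of _ ?K])
      show "sform 4 (fun_mult (\<lambda>p. \<rho> c p * \<theta> d p) \<omega>)"
        using c d by (intro sform_fun_mult smooth_function_mult \<omega>) (auto simp: bump_in_def)
      show "compactin X ?K"
        using c d by (intro compact_Int_closedin) (auto simp: bump_in_def function_support_def)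
      show "?K \<subseteq> fst c" "?K \<subseteq> fst d" using c d by (auto simp: bump_in_def)
      show "fun_mult (\<lambda>p. \<rho> c p * \<theta> d p) \<omega> e x v = 0" if "e \<in> \<A>" "x \<in> chart_image e" "chart_inv e x \<notin> ?K" for e x v
      proof -
        have "chart_inv e x \<in> topspace X" using that chart_domain_subset[OF that(1)] by force
        then show ?thesis using support_zero that(3) by (fastforce simp: fun_mult_def)
      qed
    qed
  qed
  then show ?thesis
    unfolding partition_integral_expand[OF \<omega> \<rho> \<theta> K] partition_integral_expand[OF \<omega> \<theta> \<rho> K]
    by (subst sum.swap) (simp cong: sum.cong)
qed

text \<open>This evaluates the definite description. \<eta> only has to agree with the smooth form
  \<omega> on the charts, which suits the first variation, defined pointwise by
  \<open>deriv\<close>. The set \<open>K\<close> may exceed the support, so that several forms can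
  be integrated with one partition.\<close>

lemma form_integral_partition:
  assumes \<omega>: "sform 4 \<omega>" and eq: "form_eq \<A> \<eta> \<omega>" and \<rho>: "partition_of_unity_on X \<A> K C \<rho>"
    and K: "form_support X \<A> \<omega> \<subseteq> K"
  shows "form_integral X \<A> \<eta> = (\<Sum>c\<in>C. integral (chart_image c) (\<lambda>x. \<rho> c (chart_inv c x) * \<omega> c x std_frame))"
proof -
  let ?K = "form_support X \<A> \<omega>"
  have supp: "form_support X \<A> \<eta> = ?K"
  proof -
    have "{p. \<exists>c\<in>\<A>. p \<in> fst c \<and> (\<exists>v. \<eta> c (snd c p) v \<noteq> 0)} = {p. \<exists>c\<in>\<A>. p \<in> fst c \<and> (\<exists>v. \<omega> c (snd c p) v \<noteq> 0)}"
      using eq chart_mem_image unfolding form_eq_def by (intro Collect_cong bex_cong refl) force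
    then show ?thesis by (simp add: form_support_def)
  qed
  have \<rho>': "partition_of_unity_on X \<A> ?K C \<rho>"
    using \<rho> K unfolding partition_of_unity_on_def by blast
  have same: "(\<Sum>c\<in>D. integral (chart_image c) (\<lambda>x. \<theta> c (chart_inv c x) * \<eta> c x std_frame)) =
      (\<Sum>c\<in>D. integral (chart_image c) (\<lambda>x. \<theta> c (chart_inv c x) * \<omega> c x std_frame))"
    if "partition_of_unity_on X \<A> ?K D \<theta>" for D \<theta>
  proof (intro sum.cong refl hk_integral_cong)
    fix c x assume "c \<in> D" "x \<in> chart_image c"
    then show "\<theta> c (chart_inv c x) * \<eta> c x std_frame = \<theta> c (chart_inv c x) * \<omega> c x std_frame"
      using that eq by (auto simp: partition_of_unity_on_def form_eq_def)
  qed
  show ?thesis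
    unfolding form_integral_def supp
  proof (rule the_equality)
    fix I assume "\<exists>D \<theta>. partition_of_unity_on X \<A> ?K D \<theta> \<and>
      I = (\<Sum>c\<in>D. integral (chart_image c) (\<lambda>x. \<theta> c (chart_inv c x) * \<eta> c x std_frame))"
    then show "I = (\<Sum>c\<in>C. integral (chart_image c) (\<lambda>x. \<rho> c (chart_inv c x) * \<omega> c x std_frame))"
      using same partition_integral_unique[OF \<omega> _ \<rho>' order_refl] by auto
  qed (use \<rho>' same in \<open>auto intro!: exI[of _ C] exI[of _ \<rho>]\<close>)
qed

end

section \<open>Integration by parts on the half-space\<close>

text \<open>The affine substitution rule concerns boxes; vanishing outside \<open>cbox a b\<close>
  reduces both integrals over the whole space to a box and its translate.\<close>

lemma integral_translation_compact:
  fixes g :: "'v::euclidean_space \<Rightarrow> real"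
  assumes z: "\<And>x. x \<notin> cbox a b \<Longrightarrow> g x = 0"
  shows "integral UNIV (\<lambda>x. g (x + c)) = integral UNIV g"
proof -
  have "integral UNIV g = integral (cbox a b) g"
    by (rule integral_zero_outside) (use z in auto)
  moreover have "integral UNIV (\<lambda>x. g (x + c)) = integral (cbox (a - c) (b - c)) (\<lambda>x. g (x + c))"
  proof (rule integral_zero_outside)
    show "g (x + c) = 0" if "x \<in> UNIV - cbox (a - c) (b - c)" for x
      using that by (intro z) (auto simp: mem_box algebra_simps)
  qed auto
  moreover have "((\<lambda>x. g (x + c)) has_integral i) (cbox (a - c) (b - c)) \<longleftrightarrow> (g has_integral i) (cbox a b)" for i
    using has_integral_affinity_iff[of 1 g c i a b] by simp
  ultimately show ?thesis
    unfolding integral_def integrable_on_def by simp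
qed

lemma half_space_nonneg: "x \<in> half_space \<Longrightarrow> 0 \<le> x $ 1"
  by (simp add: half_space_def)

lemma half_space_shift:
  "x \<in> half_space \<Longrightarrow> 0 \<le> s \<Longrightarrow> 0 \<le> u $ 1 \<Longrightarrow> x + s *\<^sub>R u \<in> half_space"
  by (simp add: half_space_def)

lemma openin_half_space_self: "relopen half_space"
  by simp

lemma DERIV_half_space_line:
  fixes G :: "real^4 \<Rightarrow> real"
  assumes G: "smooth_on half_space G" and x: "x \<in> half_space" and u: "0 \<le> u $ 1" and s: "0 \<le> s"
  shows "((\<lambda>s. G (x + s *\<^sub>R u)) has_field_derivative half_deriv G (x + s *\<^sub>R u) u) (at s within {0..})"
proof -
  have y: "x + s *\<^sub>R u \<in> half_space" by (rule half_space_shift[OF x s u])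
  have "((\<lambda>s. x + s *\<^sub>R u) has_derivative (\<lambda>h. h *\<^sub>R u)) (at s within {0..})"
    by (auto intro!: derivative_eq_intros)
  moreover have "(G has_derivative half_deriv G (x + s *\<^sub>R u)) (at (x + s *\<^sub>R u) within (\<lambda>s. x + s *\<^sub>R u) ` {0..})"
    by (rule has_derivative_subset[OF smooth_on_has_half_deriv[OF G openin_half_space_self y]])
      (use half_space_shift[OF x _ u] in auto)
  ultimately have "((\<lambda>s. G (x + s *\<^sub>R u)) has_derivative (\<lambda>h. half_deriv G (x + s *\<^sub>R u) (h *\<^sub>R u))) (at s within {0..})"
    by (rule has_derivative_in_compose)
  then show ?thesis
    using linear_scale[OF linear_half_deriv[OF G openin_half_space_self y]]
    by (simp add: has_field_derivative_def mult.commute[of _ "half_deriv G (x + s *\<^sub>R u) u"])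
qed

text \<open>The mean value inequality along a segment, which remains in the half-space because
  \<open>u\<close> does not point outwards. The constant bounds the directional derivative on a
  compact part of the half-space; it later supplies dominating functions.\<close>

lemma half_space_increment_bound:
  fixes G :: "real^4 \<Rightarrow> real"
  assumes G: "smooth_on half_space G" and u: "0 \<le> u $ 1"
  shows "\<exists>M. 0 \<le> M \<and> (\<forall>x\<in>half_space. \<forall>s\<ge>0. norm x + s * norm u \<le> R \<longrightarrow> \<bar>G (x + s *\<^sub>R u) - G x\<bar> \<le> M * s)"
proof -
  let ?D = "\<lambda>x. half_deriv G x u"
  let ?B = "cball 0 R \<inter> half_space"
  have "compact ?B" by (intro compact_Int_closed compact_cball closed_half_space)
  moreover have "continuous_on ?B ?D"
    by (rule continuous_on_subset[OF smooth_on_imp_continuous_on[OF smooth_on_half_deriv[OF G openin_half_space_self]]]) auto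
  ultimately have "bounded (?D ` ?B)" using compact_continuous_image compact_imp_bounded by blast
  then obtain M where M: "0 < M" "\<And>x. x \<in> ?B \<Longrightarrow> \<bar>?D x\<bar> \<le> M" by (auto simp: bounded_pos)
  have "\<bar>G (x + s *\<^sub>R u) - G x\<bar> \<le> M * s" if x: "x \<in> half_space" "0 \<le> s" "norm x + s * norm u \<le> R" for x s
  proof -
    have "norm (G (x + s *\<^sub>R u) - G (x + 0 *\<^sub>R u)) \<le> M * norm (s - 0)"
    proof (rule field_differentiable_bound[of "{0..s}" "\<lambda>s. G (x + s *\<^sub>R u)" "\<lambda>s. ?D (x + s *\<^sub>R u)"])
      fix r assume r: "r \<in> {0..s}"
      show "((\<lambda>s. G (x + s *\<^sub>R u)) has_field_derivative ?D (x + r *\<^sub>R u)) (at r within {0..s})"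
        by (rule has_field_derivative_subset[OF DERIV_half_space_line[OF G x(1) u]]) (use r in auto)
      have "norm (x + r *\<^sub>R u) \<le> norm x + r * norm u"
        using norm_triangle_ineq[of x "r *\<^sub>R u"] r by simp
      also have "\<dots> \<le> norm x + s * norm u" using r by (simp add: mult_right_mono)
      finally show "norm (?D (x + r *\<^sub>R u)) \<le> M"
        using M(2)[of "x + r *\<^sub>R u"] x half_space_shift[OF x(1) _ u, of r] r by simp
    qed (use x in auto)
    then show ?thesis using x by simp
  qed
  then show ?thesis using M(1) by (intro exI[of _ M]) auto
qed

section \<open>Integrals of tangential and normal derivatives on the half-space\<close>

context
  fixes G :: "real^4 \<Rightarrow> real" and K :: "(real^4) set"
  assumes G: "smooth_on half_space G" and K: "compact K" "K \<subseteq> half_space"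
    and zero: "\<And>x. x \<in> half_space \<Longrightarrow> x \<notin> K \<Longrightarrow> G x = 0"
begin

lemma support_radius: "\<exists>R>0. \<forall>x\<in>half_space. R < norm x \<longrightarrow> G x = 0"
proof -
  obtain R where "0 < R" "\<And>x. x \<in> K \<Longrightarrow> norm x \<le> R"
    using compact_imp_bounded[OF K(1)] unfolding bounded_pos by blast
  then show ?thesis using zero by (intro exI[of _ R]) (auto simp: not_le[symmetric])
qed

lemma integrable_half_space_shift:
  assumes u: "0 \<le> u $ 1" and s: "0 \<le> s"
  shows "(\<lambda>x. G (x + s *\<^sub>R u)) absolutely_integrable_on half_space"
proof -
  obtain R where R: "0 < R" "\<And>x. x \<in> half_space \<Longrightarrow> R < norm x \<Longrightarrow> G x = 0" using support_radius by blast
  show ?thesis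
  proof (rule absolutely_integrable_on_compact_support)
    let ?C = "cball 0 (R + s * norm u) \<inter> half_space"
    show "compact ?C" by (intro compact_Int_closed compact_cball closed_half_space)
    show "continuous_on ?C (\<lambda>x. G (x + s *\<^sub>R u))"
      by (rule continuous_on_compose2[OF smooth_on_imp_continuous_on[OF G]])
        (use half_space_shift[OF _ s u] in \<open>auto intro!: continuous_intros\<close>)
    show "G (x + s *\<^sub>R u) = 0" if "x \<in> half_space - ?C" for x
    proof (rule R(2))
      show "x + s *\<^sub>R u \<in> half_space" using that s u by (intro half_space_shift) auto
      have "norm x \<le> norm (x + s *\<^sub>R u) + norm (s *\<^sub>R u)" using norm_triangle_ineq4[of "x + s *\<^sub>R u" "s *\<^sub>R u"] by simp
      then show "R < norm (x + s *\<^sub>R u)" using that s by auto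
    qed
  qed auto
qed

lemma integrable_half_space: "G absolutely_integrable_on half_space"
  using integrable_half_space_shift[of 0 0] by simp

text \<open>Dominated convergence: the increment bound dominates the quotients by a constant on a
  fixed ball, outside which they vanish.\<close>

lemma integral_difference_quotient:
  assumes u: "0 \<le> u $ 1"
  shows "(\<lambda>n. integral half_space (\<lambda>x. (G (x + inverse (real (Suc n)) *\<^sub>R u) - G x) / inverse (real (Suc n))))
    \<longlonglongrightarrow> integral half_space (\<lambda>x. half_deriv G x u)"
proof -
  define t where "t n = inverse (real (Suc n))" for n
  have t: "0 < t n" "t n \<le> 1" for n by (auto simp: t_def inverse_le_1_iff)
  obtain R where R: "0 < R" "\<And>x. x \<in> half_space \<Longrightarrow> R < norm x \<Longrightarrow> G x = 0" using support_radius by blast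
  \<comment> \<open>A shift has length at most \<open>norm u\<close>, so only points within that
    distance of the original ball can be moved into the support.\<close>
  let ?R = "R + norm u"
  obtain M where M: "0 \<le> M" "\<And>x s. x \<in> half_space \<Longrightarrow> 0 \<le> s \<Longrightarrow> norm x + s * norm u \<le> ?R + norm u \<Longrightarrow> \<bar>G (x + s *\<^sub>R u) - G x\<bar> \<le> M * s"
    using half_space_increment_bound[OF G u, of "?R + norm u"] by blast
  have "(\<lambda>n. integral half_space (\<lambda>x. (G (x + t n *\<^sub>R u) - G x) / t n)) \<longlonglongrightarrow> integral half_space (\<lambda>x. half_deriv G x u)"
  proof (rule dominated_convergence(2)[where h="\<lambda>x. if x \<in> cball 0 ?R then M else 0"])
    show "(\<lambda>x. (G (x + t n *\<^sub>R u) - G x) / t n) integrable_on half_space" for n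
    proof -
      have "(\<lambda>x. G (x + t n *\<^sub>R u) - G x) absolutely_integrable_on half_space"
        using t(1)[of n] by (intro set_integral_diff(1) integrable_half_space_shift u integrable_half_space) auto
      then show ?thesis
        using integrable_on_divide[OF set_lebesgue_integral_eq_integral(1), of half_space _ "t n"] by blast
    qed
    have "(\<lambda>x. M) absolutely_integrable_on (cball 0 ?R \<inter> half_space :: (real^4) set)"
      by (rule absolutely_integrable_on_compact_support[where K="cball 0 ?R \<inter> half_space", OF continuous_on_const]) (auto intro!: compact_Int_closed closed_half_space)
    then show "(\<lambda>x. if x \<in> cball 0 ?R then M else 0) integrable_on half_space"
      by (simp only: integrable_restrict_Int set_lebesgue_integral_eq_integral(1))
    fix x assume x: "x \<in> half_space"
    show "norm ((G (x + t n *\<^sub>R u) - G x) / t n) \<le> (if x \<in> cball 0 ?R then M else 0)" for n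
    proof (cases "norm x \<le> ?R")
      case True
      have "t n * norm u \<le> norm u" using t[of n] by (simp add: mult_left_le_one_le)
      then have "\<bar>G (x + t n *\<^sub>R u) - G x\<bar> \<le> M * t n" using M(2)[of x "t n"] t(1)[of n] x True by simp
      then show ?thesis using True t(1)[of n] by (simp add: abs_divide field_simps)
    next
      case False
      have "norm x \<le> norm (x + t n *\<^sub>R u) + norm (t n *\<^sub>R u)" using norm_triangle_ineq4[of "x + t n *\<^sub>R u" "t n *\<^sub>R u"] by simp
      moreover have "norm (t n *\<^sub>R u) \<le> norm u" using t[of n] by (simp add: mult_left_le_one_le)
      ultimately have "R < norm (x + t n *\<^sub>R u)" "R < norm x" using False norm_ge_zero[of u] by linarith+
      then have "G (x + t n *\<^sub>R u) = 0" "G x = 0"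
        using R(2) x half_space_shift[OF x less_imp_le[OF t(1)] u] by auto
      then show ?thesis using M(1) by simp
    qed
    have "((\<lambda>s. G (x + s *\<^sub>R u)) has_field_derivative half_deriv G x u) (at 0 within {0..})"
      using DERIV_half_space_line[OF G x u, of 0] by simp
    then have "((\<lambda>s. (G (x + s *\<^sub>R u) - G x) / s) \<longlongrightarrow> half_deriv G x u) (at 0 within {0..})"
      by (simp add: has_field_derivative_iff)
    moreover have "filterlim t (at 0 within {0..}) sequentially"
      unfolding filterlim_at using LIMSEQ_inverse_real_of_nat t(1)
      by (auto simp: t_def[abs_def] less_imp_le intro!: always_eventually)
    ultimately show "(\<lambda>n. (G (x + t n *\<^sub>R u) - G x) / t n) \<longlonglongrightarrow> half_deriv G x u"
      by (rule filterlim_compose)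
  qed
  then show ?thesis by (simp add: t_def)
qed

text \<open>Formulated for any \<open>g\<close> living on the support of \<open>G\<close>, because
  it is applied to the zero extension of \<open>G\<close> and also to its part above a slab.\<close>

lemma integral_zero_extension_shift:
  assumes "\<And>x. g x \<noteq> 0 \<Longrightarrow> x \<in> half_space \<and> G x \<noteq> 0"
  shows "integral UNIV (\<lambda>x. g (x + c)) = integral UNIV (g :: real^4 \<Rightarrow> real)"
proof -
  obtain R where R: "0 < R" "\<And>x. x \<in> half_space \<Longrightarrow> R < norm x \<Longrightarrow> G x = 0" using support_radius by blast
  obtain a b :: "real^4" where ab: "cball 0 R \<subseteq> cbox a b"
    using bounded_subset_cbox_symmetric[OF bounded_cball, of 0 R] by metis
  show ?thesis
  proof (rule integral_translation_compact[of a b])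
    show "g x = 0" if "x \<notin> cbox a b" for x
    proof (rule ccontr)
      assume "g x \<noteq> 0"
      then have "x \<in> half_space" "G x \<noteq> 0" using assms by auto
      then have "norm x \<le> R" using R(2) by force
      then show False using ab that by auto
    qed
  qed
qed

lemma integral_tangential_derivative:
  assumes u: "u $ 1 = 0"
  shows "integral half_space (\<lambda>x. half_deriv G x u) = 0"
proof -
  have "integral half_space (\<lambda>x. (G (x + s *\<^sub>R u) - G x) / s) = 0" if s: "0 < s" for s
  proof -
    let ?g = "\<lambda>x. if x \<in> half_space then G x else 0"
    have "integral half_space (\<lambda>x. G (x + s *\<^sub>R u)) = integral UNIV (\<lambda>x. ?g (x + s *\<^sub>R u))"
      unfolding hk_integral_restrict_UNIV[of half_space, symmetric]
      by (rule arg_cong[where f="integral UNIV"]) (use u in \<open>auto simp: half_space_def\<close>)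
    also have "\<dots> = integral UNIV ?g" by (rule integral_zero_extension_shift) (auto split: if_splits)
    also have "\<dots> = integral half_space G" by (rule hk_integral_restrict_UNIV)
    finally show ?thesis
      using set_lebesgue_integral_eq_integral(1)[OF integrable_half_space_shift[of u s]]
        set_lebesgue_integral_eq_integral(1)[OF integrable_half_space] u s
      by (simp add: hk_integral_diff)
  qed
  then have "(\<lambda>n. 0) \<longlonglongrightarrow> integral half_space (\<lambda>x. half_deriv G x u)"
    using integral_difference_quotient[of u] u by simp
  then show ?thesis using LIMSEQ_unique tendsto_const by blast
qed

lemma slab_integrable:
  "(\<lambda>x. if x $ 1 < s then G x else 0) integrable_on half_space" (is ?A)
  "(\<lambda>x. if s \<le> x $ 1 then G x else 0) integrable_on half_space" (is ?B)
proof -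
  have m: "{x :: real^4. x $ 1 < s} \<in> sets lebesgue" "{x :: real^4. s \<le> x $ 1} \<in> sets lebesgue"
    using borel_open[OF open_halfspace_component_lt_cart[of "1::4" s]]
      borel_closed[OF closed_halfspace_component_ge_cart[of s "1::4"]] by auto
  have h: "half_space \<in> sets lebesgue" using borel_closed[OF closed_half_space] by auto
  have "G absolutely_integrable_on (S \<inter> half_space)" if "S \<in> sets lebesgue" for S
    by (rule set_integrable_subset[OF integrable_half_space sets.Int[OF that h]]) auto
  from this[OF m(1)] this[OF m(2)] show ?A ?B
    using set_lebesgue_integral_eq_integral(1) integrable_restrict_Int[of "{x. x $ 1 < s}" G half_space]
      integrable_restrict_Int[of "{x. s \<le> x $ 1}" G half_space] by auto
qed

lemma integral_slab_limit:
  "(\<lambda>n. - (real (Suc n) * integral half_space (\<lambda>x. if x $ 1 < inverse (real (Suc n)) then G x else 0)))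
    \<longlonglongrightarrow> integral half_space (\<lambda>x. half_deriv G x (axis 1 1))"
proof -
  have "integral half_space (\<lambda>x. (G (x + s *\<^sub>R axis 1 1) - G x) / s) =
      - integral half_space (\<lambda>x. if x $ 1 < s then G x else 0) / s" if s: "0 < s" for s
  proof -
    let ?e = "axis 1 1 :: real^4"
    let ?g = "\<lambda>x. if s \<le> x $ 1 then G x else 0"
    \<comment> \<open>With \<open>G\<close> removed below height \<open>s\<close>, the zero
      extension shifted by \<open>s\<close> is x -> G(x + s e_1) on the half-space and 0 off it; the
      removed slab is what translation invariance leaves over.\<close>
    let ?h = "\<lambda>x. if x \<in> half_space then ?g x else 0"
    have "integral half_space (\<lambda>x. G (x + s *\<^sub>R ?e)) = integral UNIV (\<lambda>x. ?h (x + s *\<^sub>R ?e))"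
      unfolding hk_integral_restrict_UNIV[of half_space, symmetric]
      by (rule arg_cong[where f="integral UNIV"]) (use s in \<open>auto simp: half_space_def\<close>)
    also have "\<dots> = integral UNIV ?h" by (rule integral_zero_extension_shift) (auto split: if_splits)
    also have "\<dots> = integral half_space ?g" by (rule hk_integral_restrict_UNIV)
    also have "\<dots> = integral half_space (\<lambda>x. G x - (if x $ 1 < s then G x else 0))"
      by (rule arg_cong[where f="integral half_space"]) auto
    also have "\<dots> = integral half_space G - integral half_space (\<lambda>x. if x $ 1 < s then G x else 0)"
      by (intro hk_integral_diff slab_integrable set_lebesgue_integral_eq_integral(1)[OF integrable_half_space])
    finally show ?thesis
      using set_lebesgue_integral_eq_integral(1)[OF integrable_half_space_shift[of ?e s]]
        set_lebesgue_integral_eq_integral(1)[OF integrable_half_space] s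
      by (simp add: hk_integral_diff)
  qed
  from this[of "inverse (real (Suc _))"] show ?thesis
    using integral_difference_quotient[of "axis 1 1"] by (simp add: axis_def divide_inverse mult.commute)
qed

text \<open>A function vanishing on the boundary is bounded near it by M times the height. On a slab
  of thickness 1/(n+1) its multiple by n+1 is therefore at most M, and it tends to 0 pointwise, so
  dominated convergence annihilates the slab averages.\<close>

lemma integral_normal_derivative_zero:
  assumes bd: "\<And>x. x $ 1 = 0 \<Longrightarrow> G x = 0"
  shows "integral half_space (\<lambda>x. half_deriv G x (axis 1 1)) = 0"
proof -
  let ?e = "axis 1 1 :: real^4"
  define f where "f n x = real (Suc n) * (if x $ 1 < inverse (real (Suc n)) then G x else 0)" for n and x :: "real^4"
  obtain R where R: "0 < R" "\<And>x. x \<in> half_space \<Longrightarrow> R < norm x \<Longrightarrow> G x = 0" using support_radius by blast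
  \<comment> \<open>The radius 3R: the foot of the perpendicular from a point of norm at most R has
    norm at most 2R, and the segment back up has length at most R.\<close>
  obtain M where M: "0 \<le> M" "\<And>x s. x \<in> half_space \<Longrightarrow> 0 \<le> s \<Longrightarrow> norm x + s * norm ?e \<le> 3 * R \<Longrightarrow> \<bar>G (x + s *\<^sub>R ?e) - G x\<bar> \<le> M * s"
    using half_space_increment_bound[OF G, of ?e "3 * R"] by (auto simp: axis_def)
  have near: "\<bar>G x\<bar> \<le> M * x $ 1" if x: "x \<in> half_space" "norm x \<le> R" for x
  proof -
    define w where "w = x - x $ 1 *\<^sub>R ?e"
    have w: "w $ 1 = 0" "x = w + x $ 1 *\<^sub>R ?e" by (simp_all add: w_def axis_def)
    have "norm w \<le> norm x + \<bar>x $ 1\<bar>"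
      unfolding w_def using norm_triangle_ineq4[of x "x $ 1 *\<^sub>R ?e"] by (simp add: norm_axis_1)
    then have "norm w + x $ 1 * norm ?e \<le> 3 * R"
      using component_le_norm_cart[of x 1] x by (simp add: norm_axis_1)
    then have "\<bar>G (w + x $ 1 *\<^sub>R ?e) - G w\<bar> \<le> M * x $ 1"
      using w(1) half_space_nonneg[OF x(1)] by (intro M(2)) (auto simp: half_space_def)
    then show ?thesis using bd[OF w(1)] w(2) by simp
  qed
  have "(\<lambda>n. integral half_space (f n)) \<longlonglongrightarrow> integral half_space (\<lambda>x. 0)"
  proof (rule dominated_convergence(2)[where h="\<lambda>x. if x \<in> cball 0 R then M else 0"])
    show "f n integrable_on half_space" for n
      unfolding f_def by (intro integrable_on_mult_right slab_integrable)
    have "(\<lambda>x. M) absolutely_integrable_on (cball 0 R \<inter> half_space :: (real^4) set)"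
      by (rule absolutely_integrable_on_compact_support[where K="cball 0 R \<inter> half_space", OF continuous_on_const]) (auto intro!: compact_Int_closed closed_half_space)
    then show "(\<lambda>x. if x \<in> cball 0 R then M else 0) integrable_on half_space"
      by (simp only: integrable_restrict_Int set_lebesgue_integral_eq_integral(1))
    fix x assume x: "x \<in> half_space"
    show "norm (f n x) \<le> (if x \<in> cball 0 R then M else 0)" for n
    proof (cases "x $ 1 < inverse (real (Suc n)) \<and> norm x \<le> R")
      case True
      then have "\<bar>G x\<bar> \<le> M * inverse (real (Suc n))"
        using near[OF x] M(1) by (meson less_imp_le mult_left_mono order_trans)
      then have "real (Suc n) * \<bar>G x\<bar> \<le> real (Suc n) * (M * inverse (real (Suc n)))"
        by (intro mult_left_mono) auto
      also have "\<dots> = M" by simp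
      finally show ?thesis using True by (simp add: f_def abs_mult)
    next
      case False
      then have "f n x = 0" using R(2)[OF x] by (auto simp: f_def)
      then show ?thesis using M(1) by simp
    qed
    show "(\<lambda>n. f n x) \<longlonglongrightarrow> 0"
    proof (cases "x $ 1 = 0")
      case True
      then show ?thesis using bd by (simp add: f_def)
    next
      case False
      then have "0 < x $ 1" using half_space_nonneg[OF x] by simp
      then have "eventually (\<lambda>n. inverse (real (Suc n)) < x $ 1) sequentially"
        using order_tendstoD(2)[OF LIMSEQ_inverse_real_of_nat] by blast
      then have "eventually (\<lambda>n. 0 = f n x) sequentially"
        by eventually_elim (simp add: f_def)
      then show ?thesis by (rule Lim_transform_eventually[OF tendsto_const])
    qed
  qed
  then have "(\<lambda>n. - integral half_space (f n)) \<longlonglongrightarrow> 0" using tendsto_minus by fastforce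
  moreover have "- integral half_space (f n) =
      - (real (Suc n) * integral half_space (\<lambda>x. if x $ 1 < inverse (real (Suc n)) then G x else 0))" for n
    unfolding f_def by (simp only: hk_integral_mult_right)
  ultimately show ?thesis using LIMSEQ_unique integral_slab_limit by simp
qed

text \<open>By continuity \<open>G\<close> exceeds half its value at \<open>x0\<close> on a small
  box resting on the boundary. This bounds the slab averages below by a positive constant
  independent of the thickness, and the sign in \<open>integral_slab_limit\<close> makes the limit
  negative.\<close>

lemma integral_normal_derivative_neg:
  assumes nonneg: "\<And>x. x \<in> half_space \<Longrightarrow> 0 \<le> G x" and x0: "x0 $ 1 = 0" "0 < G x0"
  shows "integral half_space (\<lambda>x. half_deriv G x (axis 1 1)) < 0"
proof -
  have x0h: "x0 \<in> half_space" using x0(1) by (simp add: half_space_def)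
  define c where "c = G x0 / 2"
  have c: "0 < c" using x0 by (simp add: c_def)
  obtain e where e: "0 < e" "\<And>y. y \<in> half_space \<Longrightarrow> dist y x0 < e \<Longrightarrow> dist (G y) (G x0) < c"
    using smooth_on_imp_continuous_on[OF G] x0h c unfolding continuous_on_iff by blast
  \<comment> \<open>The coordinate sum bounds the norm of a point of the box, relative to x0, by
    4\<delta> = e/2, within the range of the continuity estimate.\<close>
  define \<delta> where "\<delta> = e / 8"
  have \<delta>: "0 < \<delta>" using e by (simp add: \<delta>_def)
  \<comment> \<open>The lower bound c on G times the volume of the box per unit of slab thickness,
    (1/2)(2\<delta>)^3 = 4\<delta>^3.\<close>
  define C where "C = c * (4 * \<delta> ^ 3)"
  have C: "0 < C" using c \<delta> by (simp add: C_def)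
  have lower: "C \<le> real (Suc n) * integral half_space (\<lambda>x. if x $ 1 < inverse (real (Suc n)) then G x else 0)"
    if n: "inverse (real (Suc n)) < \<delta>" for n
  proof -
    define t where "t = inverse (real (Suc n))"
    have t: "0 < t" "t < \<delta>" using n by (auto simp: t_def)
    \<comment> \<open>The height is half the slab thickness, so that even the top face satisfies the
      strict inequality defining the slab.\<close>
    define a b :: "real^4" where "a = (\<chi> i. if i = 1 then 0 else x0 $ i - \<delta>)"
      and "b = (\<chi> i. if i = 1 then t / 2 else x0 $ i + \<delta>)"
    have ab: "a $ i \<le> b $ i" for i using t \<delta> by (simp add: a_def b_def)
    have "measure lborel (cbox a b) = (\<Prod>i\<in>UNIV. b $ i - a $ i)"
      using ab by (intro content_cbox_cart) (simp add: interval_ne_empty_cart)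
    also have "\<dots> = (b $ 1 - a $ 1) * ((b $ 2 - a $ 2) * ((b $ 3 - a $ 3) * (b $ 4 - a $ 4)))"
      unfolding UNIV_4 by simp
    also have "\<dots> = t / 2 * (2 * \<delta> * (2 * \<delta> * (2 * \<delta>)))"
      by (simp add: a_def b_def)
    also have "\<dots> = t * (4 * \<delta> ^ 3)"
      by (simp add: power3_eq_cube)
    finally have cont: "measure lborel (cbox a b) = t * (4 * \<delta> ^ 3)" .
    have box: "x \<in> half_space \<and> x $ 1 < t \<and> c \<le> G x" if x: "x \<in> cbox a b" for x
    proof -
      have xi: "a $ i \<le> x $ i" "x $ i \<le> b $ i" for i using x by (auto simp: mem_box_cart)
      have h: "x \<in> half_space" using xi(1)[of 1] by (simp add: a_def half_space_def)
      have "\<bar>(x - x0) $ i\<bar> \<le> \<delta>" for i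
        using xi[of i] t x0(1) by (cases "i = 1") (auto simp: a_def b_def)
      then have "(\<Sum>i\<in>UNIV. \<bar>(x - x0) $ i\<bar>) \<le> (\<Sum>i\<in>(UNIV::4 set). \<delta>)" by (intro sum_mono)
      then have "norm (x - x0) \<le> 4 * \<delta>" using norm_le_l1_cart[of "x - x0"] by simp
      then have "dist x x0 < e" using e(1) by (simp add: \<delta>_def dist_norm)
      then have "dist (G x) (G x0) < c" using e(2)[OF h] by simp
      then have "c \<le> G x" unfolding dist_real_def c_def by linarith
      moreover have "x $ 1 < t" using xi(2)[of 1] t by (simp add: b_def)
      ultimately show ?thesis using h by simp
    qed
    have "integral (cbox a b) (\<lambda>x. c) = integral half_space (\<lambda>x. if x \<in> cbox a b then c else 0)"
      using box by (subst hk_integral_restrict_Int) (metis Int_absorb2 subsetI)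
    also have "\<dots> \<le> integral half_space (\<lambda>x. if x $ 1 < t then G x else 0)"
    proof (rule integral_le[OF _ slab_integrable(1)])
      have "cbox a b \<inter> half_space = cbox a b" using box by auto
      then show "(\<lambda>x. if x \<in> cbox a b then c else 0) integrable_on half_space"
        by (simp add: integrable_restrict_Int integrable_const)
      show "(if x \<in> cbox a b then c else 0) \<le> (if x $ 1 < t then G x else 0)" if "x \<in> half_space" for x
        using box[of x] nonneg[OF that] by auto
    qed
    finally have "c * (t * (4 * \<delta> ^ 3)) \<le> integral half_space (\<lambda>x. if x $ 1 < t then G x else 0)"
      using cont by (simp add: mult.commute)
    then have le: "real (Suc n) * (c * (t * (4 * \<delta> ^ 3))) \<le> real (Suc n) * integral half_space (\<lambda>x. if x $ 1 < t then G x else 0)"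
      by (intro mult_left_mono) auto
    have "real (Suc n) * (c * (t * (4 * \<delta> ^ 3))) = (real (Suc n) * t) * C"
      unfolding C_def by (simp only: mult.assoc mult.left_commute)
    also have "real (Suc n) * t = 1" by (simp add: t_def)
    finally show ?thesis using le unfolding t_def by (simp only: mult_1)
  qed
  have "eventually (\<lambda>n. inverse (real (Suc n)) < \<delta>) sequentially"
    using order_tendstoD(2)[OF LIMSEQ_inverse_real_of_nat \<delta>] .
  then have "eventually (\<lambda>n. - (real (Suc n) * integral half_space (\<lambda>x. if x $ 1 < inverse (real (Suc n)) then G x else 0)) \<le> - C) sequentially"
    by eventually_elim (use lower in force)
  then have "integral half_space (\<lambda>x. half_deriv G x (axis 1 1)) \<le> - C"
    by (intro tendsto_upperbound[OF integral_slab_limit]) auto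
  then show ?thesis using C by simp
qed

end

text \<open>The half-space is covered by \<open>U\<close>, where the extension is \<open>f\<close>,
  and by the complement of the compact set \<open>K\<close>, where it is 0; both are relatively
  open, so smoothness and derivatives can be checked on each.\<close>

lemma zero_extension:
  fixes f :: "real^4 \<Rightarrow> real"
  assumes U: "relopen U" and f: "smooth_on U f"
    and K: "compact K" "K \<subseteq> U" "\<And>x. x \<in> U \<Longrightarrow> x \<notin> K \<Longrightarrow> f x = 0"
  defines "G \<equiv> \<lambda>x. if x \<in> U then f x else 0"
  shows "smooth_on half_space G" "integral U (\<lambda>x. half_deriv f x u) = integral half_space (\<lambda>x. half_deriv G x u)"
proof -
  have UH: "U \<subseteq> half_space" using U by (rule openin_imp_subset)
  obtain V where V: "open V" "U = half_space \<inter> V" using U by (auto simp: openin_open)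
  have cK: "relopen (half_space - K)"
    using K(1) by (auto simp: openin_open intro!: exI[of _ "- K"] compact_imp_closed)
  show "smooth_on half_space G"
  proof (rule smooth_on_local)
    fix x assume "x \<in> half_space"
    have "smooth_on (half_space \<inter> V) G"
      by (rule smooth_on_cong[of _ f]) (use f V in \<open>auto simp: G_def\<close>)
    moreover have "smooth_on (half_space \<inter> - K) G"
      by (rule smooth_on_cong[OF smooth_on_const[of _ 0]]) (use K(3) in \<open>auto simp: G_def\<close>)
    moreover have "x \<in> V \<or> x \<in> - K" using K(2) V by auto
    ultimately show "\<exists>V. open V \<and> x \<in> V \<and> smooth_on (half_space \<inter> V) G"
      using V(1) K(1) compact_imp_closed open_Compl by blast
  qed
  have "integral half_space (\<lambda>x. half_deriv G x u) = integral U (\<lambda>x. half_deriv G x u)"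
  proof (rule integral_zero_outside[OF UH])
    fix x assume x: "x \<in> half_space - U"
    then have "half_deriv G x = half_deriv (\<lambda>_. 0) x"
      by (intro half_deriv_cong[OF cK]) (use K(2,3) in \<open>auto simp: G_def\<close>)
    then show "half_deriv G x u = 0" using x by (simp add: half_deriv_const)
  qed
  also have "\<dots> = integral U (\<lambda>x. half_deriv f x u)"
  proof (rule hk_integral_cong)
    fix x assume "x \<in> U"
    then have "half_deriv G x = half_deriv f x" by (intro half_deriv_cong[OF U]) (auto simp: G_def)
    then show "half_deriv G x u = half_deriv f x u" by simp
  qed
  finally show "integral U (\<lambda>x. half_deriv f x u) = integral half_space (\<lambda>x. half_deriv G x u)" ..
qed

section \<open>The first variation\<close>

context oriented_manifold
begin

lemma cov_d_1_at:
  assumes A: "so3form 1 A" and a: "so3form 1 a" and c: "c \<in> \<A>" "x \<in> chart_image c" and ijk: "cyc i j k"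
  shows "cov_d half_space A 1 a i c x v =
    half_deriv (\<lambda>y. ev1 (a i c y) (v 1)) x (v 0) - half_deriv (\<lambda>y. ev1 (a i c y) (v 0)) x (v 1)
    + (ev1 (A j c x) (v 0) * ev1 (a k c x) (v 1) - ev1 (A j c x) (v 1) * ev1 (a k c x) (v 0))
    - (ev1 (A k c x) (v 0) * ev1 (a j c x) (v 1) - ev1 (A k c x) (v 1) * ev1 (a j c x) (v 0))"
  by (simp only: cov_d_def plus_fun_apply eps_wedge_cyc[OF ijk] ext_d_1[OF so3form_sform[OF a] c]
      wedge_1_1_at[OF so3form_sform[OF A] so3form_sform[OF a] c] diff_conv_add_uminus add.assoc)

lemma ev2_cov_d_1:
  assumes "so3form 1 A" "so3form 1 a" "c \<in> \<A>" "x \<in> chart_image c" "cyc i j k"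
  shows "ev2 (cov_d half_space A 1 a i c x) u w =
    half_deriv (\<lambda>y. ev1 (a i c y) w) x u - half_deriv (\<lambda>y. ev1 (a i c y) u) x w
    + (ev1 (A j c x) u * ev1 (a k c x) w - ev1 (A j c x) w * ev1 (a k c x) u)
    - (ev1 (A k c x) u * ev1 (a j c x) w - ev1 (A k c x) w * ev1 (a j c x) u)"
  unfolding ev2_def cov_d_1_at[OF assms] by simp

lemma ev3_cov_d_2:
  assumes A: "so3form 1 A" and F: "so3form 2 F" and c: "c \<in> \<A>" "x \<in> chart_image c" and ijk: "cyc i j k"
  shows "ev3 (cov_d half_space A 2 F i c x) p q r =
    half_deriv (\<lambda>y. ev2 (F i c y) q r) x p - half_deriv (\<lambda>y. ev2 (F i c y) p r) x q + half_deriv (\<lambda>y. ev2 (F i c y) p q) x r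
    + (ev1 (A j c x) p * ev2 (F k c x) q r - ev1 (A j c x) q * ev2 (F k c x) p r + ev1 (A j c x) r * ev2 (F k c x) p q)
    - (ev1 (A k c x) p * ev2 (F j c x) q r - ev1 (A k c x) q * ev2 (F j c x) p r + ev1 (A k c x) r * ev2 (F j c x) p q)"
  unfolding ev3_def cov_d_def plus_fun_apply eps_wedge_1_2_at[OF A F c ijk] ext_d_2[OF so3form_sform[OF F] c]
  by simp

text \<open>The components of the 3-form \<open>a\<^sub>i \<and> F\<^sup>i\<close> and of the 4-form \<open>a\<^sub>i \<and> \<Theta>\<^sup>i\<close>.\<close>

definition boundary_term :: "('a, 4) so3_form \<Rightarrow> ('a, 4) so3_form \<Rightarrow> ('a, 4) chart \<Rightarrow> real^4 \<Rightarrow> real^4 \<Rightarrow> real^4 \<Rightarrow> real^4 \<Rightarrow> real" where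
  "boundary_term a F c p q r y = (\<Sum>i\<in>UNIV. ev1 (a i c y) p * ev2 (F i c y) q r - ev1 (a i c y) q * ev2 (F i c y) p r
    + ev1 (a i c y) r * ev2 (F i c y) p q)"

definition bulk_term :: "('a, 4) so3_form \<Rightarrow> ('a, 4) so3_form \<Rightarrow> ('a, 4) chart \<Rightarrow> real^4 \<Rightarrow> (nat \<Rightarrow> real^4) \<Rightarrow> real" where
  "bulk_term a \<Theta> c x v = (\<Sum>i\<in>UNIV. ev1 (a i c x) (v 0) * ev3 (\<Theta> i c x) (v 1) (v 2) (v 3)
     - ev1 (a i c x) (v 1) * ev3 (\<Theta> i c x) (v 0) (v 2) (v 3) + ev1 (a i c x) (v 2) * ev3 (\<Theta> i c x) (v 0) (v 1) (v 3)
     - ev1 (a i c x) (v 3) * ev3 (\<Theta> i c x) (v 0) (v 1) (v 2))"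

text \<open>Both halves of the first variation have this shape, each with one connection and the
  curvature of the other one; hence \<open>A\<close> and \<open>F\<close> are independent
  arguments.\<close>

definition variation_form :: "('a, 4) so3_form \<Rightarrow> ('a, 4) so3_form \<Rightarrow> ('a, 4) so3_form \<Rightarrow> ('a, 4) form" where
  "variation_form A F a = (\<Sum>i\<in>UNIV. wedge 2 2 (cov_d half_space A 1 a i) (F i))"

lemma sform_variation_form:
  assumes "so3form 1 A" "so3form 2 F" "so3form 1 a"
  shows "sform 4 (variation_form A F a)"
proof -
  have "sform (2 + 2) (wedge 2 2 (cov_d half_space A 1 a i) (F i))" for i
    by (intro sform_wedge sform_cov_d_1 so3form_sform assms)
  then show ?thesis unfolding variation_form_def sum_3 by (intro sform_add) simp_all
qed

lemma variation_form_at: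
  assumes "so3form 1 A" "so3form 2 F" "so3form 1 a" "c \<in> \<A>" "x \<in> chart_image c"
  shows "variation_form A F a c x v = (\<Sum>i\<in>UNIV. w22 (ev2 (cov_d half_space A 1 a i c x)) (ev2 (F i c x)) v)"
  unfolding variation_form_def sum_3 plus_fun_apply
    wedge_2_2_at[OF sform_cov_d_1[OF assms(1,3)] so3form_sform[OF assms(2)] assms(4,5)] ..

lemma smooth_boundary_term:
  assumes "so3form 1 a" "so3form 2 F" "c \<in> \<A>"
  shows "smooth_on (chart_image c) (boundary_term a F c p q r)"
proof -
  have "smooth_on (chart_image c) (\<lambda>y. ev1 (a i c y) u)" "smooth_on (chart_image c) (\<lambda>y. ev2 (F i c y) u w)" for i u w
    using smooth_ev[OF assms(3)] so3form_sform assms(1,2) by blast+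
  then show ?thesis
    unfolding boundary_term_def[abs_def]
    by (intro smooth_on_sum smooth_on_add smooth_on_diff smooth_on_mult)
qed

lemma half_deriv_boundary_term:
  assumes a: "so3form 1 a" and F: "so3form 2 F" and c: "c \<in> \<A>" and x: "x \<in> chart_image c"
  shows "half_deriv (boundary_term a F c p q r) x t = (\<Sum>i\<in>UNIV.
    (ev1 (a i c x) p * half_deriv (\<lambda>y. ev2 (F i c y) q r) x t + half_deriv (\<lambda>y. ev1 (a i c y) p) x t * ev2 (F i c x) q r)
    - (ev1 (a i c x) q * half_deriv (\<lambda>y. ev2 (F i c y) p r) x t + half_deriv (\<lambda>y. ev1 (a i c y) q) x t * ev2 (F i c x) p r)
    + (ev1 (a i c x) r * half_deriv (\<lambda>y. ev2 (F i c y) p q) x t + half_deriv (\<lambda>y. ev1 (a i c y) r) x t * ev2 (F i c x) p q))"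
proof -
  note S = chart_image_open[OF c] x
  have sa: "smooth_on (chart_image c) (\<lambda>y. ev1 (a i c y) u)" and sF: "smooth_on (chart_image c) (\<lambda>y. ev2 (F i c y) u w)" for i u w
    using smooth_ev[OF c] so3form_sform a F by blast+
  show ?thesis
    unfolding boundary_term_def[abs_def]
    by (simp only: half_deriv_sum[OF finite[of "UNIV :: 3 set"] _ S] half_deriv_add[OF _ _ S] half_deriv_diff[OF _ _ S]
        half_deriv_mult[OF _ _ S] sa sF smooth_on_mult smooth_on_diff smooth_on_add)
qed

text \<open>The covariant Leibniz rule. The four derivatives form the exterior derivative of a_i
  F^i; the connection does not enter it, because its contributions to D a_i F^i and to a_i D F^i
  coincide by the total antisymmetry of \<epsilon>.\<close>

lemma variation_form_decomposition:
  assumes A: "so3form 1 A" and F: "so3form 2 F" and a: "so3form 1 a" and c: "c \<in> \<A>" and x: "x \<in> chart_image c"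
  shows "variation_form A F a c x v =
    half_deriv (boundary_term a F c (v 1) (v 2) (v 3)) x (v 0) - half_deriv (boundary_term a F c (v 0) (v 2) (v 3)) x (v 1)
    + half_deriv (boundary_term a F c (v 0) (v 1) (v 3)) x (v 2) - half_deriv (boundary_term a F c (v 0) (v 1) (v 2)) x (v 3)
    + bulk_term a (cov_d half_space A 2 F) c x v"
proof -
  \<comment> \<open>Values and first derivatives are named as atoms, after which the claim is a
    polynomial identity.\<close>
  define d where "d i u w = half_deriv (\<lambda>y. ev1 (a i c y) u) x w" for i u w
  define D where "D i u w z = half_deriv (\<lambda>y. ev2 (F i c y) u w) x z" for i u w z
  define f where "f i = ev1 (a i c x)" for i
  define g where "g i = ev1 (A i c x)" for i
  define P where "P i = ev2 (F i c x)" for i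
  note ijk = cyc_def[of 1 2 3, simplified] cyc_def[of 2 3 1, simplified] cyc_def[of 3 1 2, simplified]
  have e2: "ev2 (cov_d half_space A 1 a 1 c x) u w = d 1 w u - d 1 u w + (g 2 u * f 3 w - g 2 w * f 3 u) - (g 3 u * f 2 w - g 3 w * f 2 u)"
    "ev2 (cov_d half_space A 1 a 2 c x) u w = d 2 w u - d 2 u w + (g 3 u * f 1 w - g 3 w * f 1 u) - (g 1 u * f 3 w - g 1 w * f 3 u)"
    "ev2 (cov_d half_space A 1 a 3 c x) u w = d 3 w u - d 3 u w + (g 1 u * f 2 w - g 1 w * f 2 u) - (g 2 u * f 1 w - g 2 w * f 1 u)" for u w
    unfolding d_def f_def g_def by (rule ev2_cov_d_1[OF A a c x]; simp add: cyc_def)+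
  have e3: "ev3 (cov_d half_space A 2 F 1 c x) p q r = D 1 q r p - D 1 p r q + D 1 p q r
      + (g 2 p * P 3 q r - g 2 q * P 3 p r + g 2 r * P 3 p q) - (g 3 p * P 2 q r - g 3 q * P 2 p r + g 3 r * P 2 p q)"
    "ev3 (cov_d half_space A 2 F 2 c x) p q r = D 2 q r p - D 2 p r q + D 2 p q r
      + (g 3 p * P 1 q r - g 3 q * P 1 p r + g 3 r * P 1 p q) - (g 1 p * P 3 q r - g 1 q * P 3 p r + g 1 r * P 3 p q)"
    "ev3 (cov_d half_space A 2 F 3 c x) p q r = D 3 q r p - D 3 p r q + D 3 p q r
      + (g 1 p * P 2 q r - g 1 q * P 2 p r + g 1 r * P 2 p q) - (g 2 p * P 1 q r - g 2 q * P 1 p r + g 2 r * P 1 p q)" for p q r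
    unfolding D_def P_def g_def by (rule ev3_cov_d_2[OF A F c x]; simp add: cyc_def)+
  show ?thesis
    unfolding variation_form_at[OF A F a c x] half_deriv_boundary_term[OF a F c x] bulk_term_def
      d_def[symmetric] D_def[symmetric] f_def[symmetric] P_def[symmetric] sum_3 w22_def e2 e3
    by (simp add: algebra_simps)
qed

lemma chart_complement_open:
  assumes "closedin X K" "c \<in> \<A>"
  shows "relopen {x \<in> chart_image c. chart_inv c x \<notin> K}"
proof -
  have "{x \<in> chart_image c. chart_inv c x \<notin> K} = snd c ` (fst c - K)"
    using assms(2) by (force simp: chart_image_def)
  moreover have "openin X (fst c - K)" using assms chart_domain_open by blast
  ultimately show ?thesis using openin_chart_image[OF assms(2)] by auto
qed

text \<open>The covariant derivative also involves derivatives of \<open>a\<close>; these vanish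
  too, since the complement of the closed set \<open>K\<close> is open.\<close>

lemma variation_form_zero:
  assumes A: "so3form 1 A" and F: "so3form 2 F" and a: "so3form 1 a" and c: "c \<in> \<A>" and x: "x \<in> chart_image c"
    and K: "closedin X K" "chart_inv c x \<notin> K"
    and z: "\<And>i x v. x \<in> chart_image c \<Longrightarrow> chart_inv c x \<notin> K \<Longrightarrow> a i c x v = 0"
  shows "variation_form A F a c x v = 0"
proof -
  have "half_deriv (\<lambda>y. ev1 (a i c y) u) x w = 0" for i u w
  proof -
    have "half_deriv (\<lambda>y. ev1 (a i c y) u) x = half_deriv (\<lambda>y. 0) x"
      by (rule half_deriv_cong[OF chart_complement_open[OF K(1) c]]) (use x K z in \<open>auto simp: ev1_def\<close>)
    then show ?thesis using chart_image_half_space[OF c x] by (simp add: half_deriv_const)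
  qed
  moreover have "ev1 (a i c x) u = 0" for i u using z x K(2) by (simp add: ev1_def)
  ultimately have "ev2 (cov_d half_space A 1 a i c x) u w = 0" for i u w
    using cycE[of i] ev2_cov_d_1[OF A a c x] by (metis (no_types, lifting) add.right_neutral diff_self mult_zero_right)
  then show ?thesis unfolding variation_form_at[OF A F a c x] by (simp add: w22_def)
qed

lemma variation_form_sum:
  assumes A: "so3form 1 A" and F: "so3form 2 F" and a: "so3form 1 a" and c: "c \<in> \<A>" and x: "x \<in> chart_image c"
    and C: "finite C" "\<And>d. d \<in> C \<Longrightarrow> so3form 1 (g d)"
    and eq: "\<And>i x v. x \<in> chart_image c \<Longrightarrow> a i c x v = (\<Sum>d\<in>C. g d i c x v)"
  shows "variation_form A F a c x v = (\<Sum>d\<in>C. variation_form A F (g d) c x v)"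
proof -
  note S = chart_image_open[OF c] x
  have ev: "ev1 (a i c y) u = (\<Sum>d\<in>C. ev1 (g d i c y) u)" if "y \<in> chart_image c" for i y u
    using eq[OF that] by (simp add: ev1_def)
  have dev: "half_deriv (\<lambda>y. ev1 (a i c y) u) x w = (\<Sum>d\<in>C. half_deriv (\<lambda>y. ev1 (g d i c y) u) x w)" for i u w
  proof -
    have "half_deriv (\<lambda>y. ev1 (a i c y) u) x = half_deriv (\<lambda>y. \<Sum>d\<in>C. ev1 (g d i c y) u) x"
      by (rule half_deriv_cong[OF S]) (rule ev)
    then show ?thesis
      using half_deriv_sum[OF C(1) smooth_ev(1)[OF c so3form_sform[OF C(2)]] S] by simp
  qed
  have cov: "ev2 (cov_d half_space A 1 a i c x) u w = (\<Sum>d\<in>C. ev2 (cov_d half_space A 1 (g d) i c x) u w)" for i u w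
  proof -
    obtain j k where ijk: "cyc i j k" by (rule cycE)
    have "(\<Sum>d\<in>C. ev2 (cov_d half_space A 1 (g d) i c x) u w) = (\<Sum>d\<in>C.
        half_deriv (\<lambda>y. ev1 (g d i c y) w) x u - half_deriv (\<lambda>y. ev1 (g d i c y) u) x w
        + (ev1 (A j c x) u * ev1 (g d k c x) w - ev1 (A j c x) w * ev1 (g d k c x) u)
        - (ev1 (A k c x) u * ev1 (g d j c x) w - ev1 (A k c x) w * ev1 (g d j c x) u))"
      by (intro sum.cong refl ev2_cov_d_1[OF A C(2) c x ijk])
    then show ?thesis
      unfolding ev2_cov_d_1[OF A a c x ijk] dev ev[OF x]
      by (simp add: sum.distrib sum_subtractf sum_distrib_left)
  qed
  have "variation_form A F a c x v = (\<Sum>i\<in>UNIV. \<Sum>d\<in>C. w22 (ev2 (cov_d half_space A 1 (g d) i c x)) (ev2 (F i c x)) v)"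
    unfolding variation_form_at[OF A F a c x] w22_def cov
    by (simp add: sum.distrib sum_subtractf sum_distrib_right)
  also have "\<dots> = (\<Sum>d\<in>C. \<Sum>i\<in>UNIV. w22 (ev2 (cov_d half_space A 1 (g d) i c x)) (ev2 (F i c x)) v)"
    by (rule sum.swap)
  also have "\<dots> = (\<Sum>d\<in>C. variation_form A F (g d) c x v)"
    by (intro sum.cong refl) (simp only: variation_form_at[OF A F C(2) c x])
  finally show ?thesis .
qed

text \<open>Of the four derivative terms three are in tangential directions and integrate to 0. The
  remaining one, in the normal direction, carries exactly the tangential components of a_i
  F^i.\<close>

lemma chart_integral_by_parts:
  assumes A: "so3form 1 A" and F: "so3form 2 F" and a: "so3form 1 a" and c: "c \<in> \<A>"
    and K: "compact K" "K \<subseteq> chart_image c" "\<And>i x v. x \<in> chart_image c \<Longrightarrow> x \<notin> K \<Longrightarrow> a i c x v = 0"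
  defines "\<eta> \<equiv> boundary_term a F c (std_frame 1) (std_frame 2) (std_frame 3)"
  shows "integral (chart_image c) (\<lambda>x. variation_form A F a c x std_frame) =
    integral (chart_image c) (\<lambda>x. half_deriv \<eta> x (axis 1 1))
    + integral (chart_image c) (\<lambda>x. bulk_term a (cov_d half_space A 2 F) c x std_frame)"
proof -
  let ?U = "chart_image c"
  let ?e = std_frame
  note U = chart_image_open[OF c]
  let ?b = "boundary_term a F c"
  have s: "smooth_on ?U (?b p q r)" for p q r by (rule smooth_boundary_term[OF a F c])
  have b0: "?b p q r x = 0" if "x \<in> ?U" "x \<notin> K" for p q r x
    using K(3)[OF that] by (simp add: boundary_term_def ev1_def)
  have d0: "half_deriv (?b p q r) x u = 0" if x: "x \<in> ?U" "x \<notin> K" for p q r u x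
  proof -
    have "relopen (?U - K)"
      using U openin_diff[OF U, of K] K by (metis closedin_closed_subset closed_subset compact_imp_closed openin_imp_subset subset_trans)
    then have "half_deriv (?b p q r) x = half_deriv (\<lambda>_. 0) x"
      by (rule half_deriv_cong) (use x b0 in auto)
    then show ?thesis using chart_image_half_space[OF c x(1)] by (simp add: half_deriv_const)
  qed
  have int: "(\<lambda>x. half_deriv (?b p q r) x u) integrable_on ?U" for p q r u
  proof (rule set_lebesgue_integral_eq_integral(1), rule absolutely_integrable_on_compact_support[OF _ K(1,2)])
    show "continuous_on K (\<lambda>x. half_deriv (?b p q r) x u)"
      by (rule continuous_on_subset[OF smooth_on_imp_continuous_on[OF smooth_on_half_deriv[OF s U]] K(2)])
  qed (use d0 in auto)
  have tang: "integral ?U (\<lambda>x. half_deriv (?b p q r) x u) = 0" if "u $ 1 = 0" for p q r u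
  proof -
    let ?G = "\<lambda>x. if x \<in> ?U then ?b p q r x else 0"
    have G: "smooth_on half_space ?G"
      by (rule zero_extension(1)[OF U s K(1,2)]) (rule b0)
    have "integral ?U (\<lambda>x. half_deriv (?b p q r) x u) = integral half_space (\<lambda>x. half_deriv ?G x u)"
      by (rule zero_extension(2)[OF U s K(1,2)]) (rule b0)
    also have "\<dots> = 0"
      by (rule integral_tangential_derivative[OF G K(1) _ _ that])
        (use K(2) chart_image_half_space[OF c] b0 in auto)
    finally show ?thesis .
  qed
  have V: "(\<lambda>x. variation_form A F a c x ?e) integrable_on ?U"
  proof (rule set_lebesgue_integral_eq_integral(1), rule absolutely_integrable_on_compact_support[OF _ K(1,2)])
    show "continuous_on K (\<lambda>x. variation_form A F a c x ?e)"
      by (rule continuous_on_subset[OF smooth_on_imp_continuous_on[OF sform_smooth[OF sform_variation_form[OF A F a] c]] K(2)])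
    fix x assume x: "x \<in> ?U - K"
    have "bulk_term a (cov_d half_space A 2 F) c x ?e = 0"
      using K(3)[of x] x by (simp add: bulk_term_def ev1_def)
    then show "variation_form A F a c x ?e = 0"
      using x d0 by (simp add: variation_form_decomposition[OF A F a c])
  qed
  have B: "bulk_term a (cov_d half_space A 2 F) c x ?e = variation_form A F a c x ?e
      - half_deriv \<eta> x (?e 0) + half_deriv (?b (?e 0) (?e 2) (?e 3)) x (?e 1)
      - half_deriv (?b (?e 0) (?e 1) (?e 3)) x (?e 2) + half_deriv (?b (?e 0) (?e 1) (?e 2)) x (?e 3)" if "x \<in> ?U" for x
    unfolding variation_form_decomposition[OF A F a c that] \<eta>_def by simp
  have "integral ?U (\<lambda>x. bulk_term a (cov_d half_space A 2 F) c x ?e) =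
      integral ?U (\<lambda>x. variation_form A F a c x ?e
      - half_deriv \<eta> x (?e 0) + half_deriv (?b (?e 0) (?e 2) (?e 3)) x (?e 1)
      - half_deriv (?b (?e 0) (?e 1) (?e 3)) x (?e 2) + half_deriv (?b (?e 0) (?e 1) (?e 2)) x (?e 3))"
    by (rule hk_integral_cong) (rule B)
  also have "\<dots> = integral ?U (\<lambda>x. variation_form A F a c x ?e)
      - integral ?U (\<lambda>x. half_deriv \<eta> x (?e 0)) + integral ?U (\<lambda>x. half_deriv (?b (?e 0) (?e 2) (?e 3)) x (?e 1))
      - integral ?U (\<lambda>x. half_deriv (?b (?e 0) (?e 1) (?e 3)) x (?e 2)) + integral ?U (\<lambda>x. half_deriv (?b (?e 0) (?e 1) (?e 2)) x (?e 3))"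
    unfolding \<eta>_def
    by (simp only: hk_integral_add hk_integral_diff
        integrable_add integrable_diff V int)
  also have "\<dots> = integral ?U (\<lambda>x. variation_form A F a c x ?e) - integral ?U (\<lambda>x. half_deriv \<eta> x (?e 0))"
    by (simp add: tang std_frame_simps[unfolded One_nat_def] axis_def)
  finally show ?thesis by (simp add: std_frame_simps)
qed

text \<open>Each piece of the partition is supported in \<open>c\<close> as well as in its own chart
  and can be moved to \<open>c\<close>; there the pieces add up to the whole form.\<close>

lemma form_integral_chart:
  assumes \<omega>: "sform 4 \<omega>" and c: "c \<in> \<A>" and K: "compactin X K" "K \<subseteq> fst c"
    and z: "\<And>e x v. e \<in> \<A> \<Longrightarrow> x \<in> chart_image e \<Longrightarrow> chart_inv e x \<notin> K \<Longrightarrow> \<omega> e x v = 0"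
  shows "form_integral X \<A> \<omega> = integral (chart_image c) (\<lambda>x. \<omega> c x std_frame)"
proof -
  have cK: "closedin X K" by (rule compactin_imp_closedin[OF hausdorff K(1)])
  have supp: "form_support X \<A> \<omega> \<subseteq> K" using cK z by (rule form_support_subset)
  obtain D \<rho> where \<rho>: "partition_of_unity_on X \<A> K D \<rho>" using partition_of_unity_exists[OF K(1)] by blast
  have D: "finite D" "\<And>d. d \<in> D \<Longrightarrow> d \<in> \<A> \<and> bump_in d (\<rho> d)" "\<And>p. p \<in> K \<Longrightarrow> (\<Sum>d\<in>D. \<rho> d p) = 1"
    using \<rho> by (auto simp: partition_of_unity_on_def bump_in_def)
  have s: "sform 4 (fun_mult (\<rho> d) \<omega>)" if "d \<in> D" for d
    using D(2)[OF that] by (intro sform_fun_mult \<omega>) (simp add: bump_in_def)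
  have zK: "fun_mult (\<rho> d) \<omega> e x v = 0" if "e \<in> \<A>" "x \<in> chart_image e" "chart_inv e x \<notin> K" for d e x v
    using z[OF that] by (simp add: fun_mult_def)
  have "form_integral X \<A> \<omega> = (\<Sum>d\<in>D. integral (chart_image d) (\<lambda>x. fun_mult (\<rho> d) \<omega> d x std_frame))"
    using form_integral_partition[OF \<omega> _ \<rho> supp, of \<omega>] by (simp add: form_eq_def fun_mult_def)
  also have "\<dots> = (\<Sum>d\<in>D. integral (chart_image c) (\<lambda>x. fun_mult (\<rho> d) \<omega> c x std_frame))"
  proof (rule sum.cong[OF refl])
    fix d assume d: "d \<in> D"
    note d' = D(2)[OF d]
    let ?K = "K \<inter> function_support X (\<rho> d)"
    show "integral (chart_image d) (\<lambda>x. fun_mult (\<rho> d) \<omega> d x std_frame) = integral (chart_image c) (\<lambda>x. fun_mult (\<rho> d) \<omega> c x std_frame)"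
    proof (rule integral_chart_change[OF s[OF d], of _ _ ?K])
      show "compactin X ?K" using K d' by (intro compact_Int_closedin) (auto simp: function_support_def)
      show "?K \<subseteq> fst d" "?K \<subseteq> fst c" using K d' by (auto simp: bump_in_def)
      show "fun_mult (\<rho> d) \<omega> e x v = 0" if "e \<in> \<A>" "x \<in> chart_image e" "chart_inv e x \<notin> ?K" for e x v
      proof (cases "chart_inv e x \<in> K")
        case True
        then have "chart_inv e x \<notin> function_support X (\<rho> d)" using that by blast
        moreover have "chart_inv e x \<in> topspace X" using that chart_domain_subset[OF that(1)] by force
        ultimately show ?thesis by (simp add: fun_mult_def support_zero)
      qed (use zK that in auto)
    qed (use c d' in auto)
  qed
  also have "\<dots> = integral (chart_image c) (\<lambda>x. \<Sum>d\<in>D. fun_mult (\<rho> d) \<omega> c x std_frame)"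
  proof (rule hk_integral_sum[symmetric, OF D(1)])
    fix d assume d: "d \<in> D"
    show "(\<lambda>x. fun_mult (\<rho> d) \<omega> c x std_frame) integrable_on chart_image c"
      by (rule set_lebesgue_integral_eq_integral(1), rule absolutely_integrable_top_form[OF s[OF d] c K]) (rule zK[OF c])
  qed
  also have "\<dots> = integral (chart_image c) (\<lambda>x. \<omega> c x std_frame)"
  proof (rule hk_integral_cong)
    fix x assume x: "x \<in> chart_image c"
    show "(\<Sum>d\<in>D. fun_mult (\<rho> d) \<omega> c x std_frame) = \<omega> c x std_frame"
      using z[OF c x] D(3) by (cases "chart_inv c x \<in> K") (auto simp: fun_mult_def sum_distrib_right[symmetric])
  qed
  finally show ?thesis .
qed

end

lemma boundary_frame:
  "std_frame 1 = boundary_incl (axis 1 1)" "std_frame 2 = boundary_incl (axis 2 1)" "std_frame 3 = boundary_incl (axis 3 1)"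
  unfolding std_frame_simps by (simp_all add: vec_eq_iff forall_4 axis_def)

lemma boundary_incl_surj:
  assumes "x $ 1 = 0" obtains y where "x = boundary_incl y"
  using assms by (intro that[of "vector [x $ 2, x $ 3, x $ 4]"]) (simp add: vec_eq_iff forall_4 vector_3)

text \<open>A 3-form on a 4-dimensional space is determined by four components, one for each omitted
  axis; all others are zero or signed copies of these.\<close>

lemma alternating_form_3_eq_0:
  fixes w :: "(nat \<Rightarrow> real^4) \<Rightarrow> real"
  assumes w: "alternating_form 3 w"
    and z: "ev3 w (axis 2 1) (axis 3 1) (axis 4 1) = 0" "ev3 w (axis 1 1) (axis 3 1) (axis 4 1) = 0"
      "ev3 w (axis 1 1) (axis 2 1) (axis 4 1) = 0" "ev3 w (axis 1 1) (axis 2 1) (axis 3 1) = 0"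
  shows "w v = 0"
proof -
  define W where "W i j k = ev3 w (axis i 1) (axis j 1) (axis k 1)" for i j k :: 4
  have lin: "linear (\<lambda>a. ev3 w a b c)" "linear (\<lambda>b. ev3 w a b c)" "linear (\<lambda>c. ev3 w a b c)" for a b c
    using alternating_form_linear[OF w, of 0 "(\<lambda>_. b)(2 := c)"]
      alternating_form_linear[OF w, of 1 "(\<lambda>_. a)(2 := c)"]
      alternating_form_linear[OF w, of 2 "(\<lambda>_. a)(1 := b)"]
    by (simp_all add: ev3[OF w])
  have s: "ev3 w a b c = (\<Sum>i\<in>UNIV. a $ i *\<^sub>R ev3 w (axis i 1) b c)"
    "ev3 w a b c = (\<Sum>i\<in>UNIV. b $ i *\<^sub>R ev3 w a (axis i 1) c)"
    "ev3 w a b c = (\<Sum>i\<in>UNIV. c $ i *\<^sub>R ev3 w a b (axis i 1))" for a b c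
    by (rule linear_axis_expansion, rule lin)+
  have E: "ev3 w a b c = (\<Sum>i\<in>UNIV. a $ i * (\<Sum>j\<in>UNIV. b $ j * (\<Sum>k\<in>UNIV. c $ k * W i j k)))" for a b c
    unfolding W_def by (subst s(1), subst s(2), subst s(3)) simp
  have zero: "W i i k = 0" "W i k i = 0" "W k i i = 0" for i k
    unfolding W_def by (rule ev3_alt[OF w])+
  have sw: "W i j k = - W j i k" "W i j k = - W i k j" for i j k
    unfolding W_def by (rule ev3_alt[OF w])+
  note sw' = sw(1)[of 2 1] sw(1)[of 3 1] sw(1)[of 4 1] sw(1)[of 3 2] sw(1)[of 4 2] sw(1)[of 4 3]
    sw(2)[of _ 2 1] sw(2)[of _ 3 1] sw(2)[of _ 4 1] sw(2)[of _ 3 2] sw(2)[of _ 4 2] sw(2)[of _ 4 3]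
  have "W 2 3 4 = 0" "W 1 3 4 = 0" "W 1 2 4 = 0" "W 1 2 3 = 0" using z by (simp_all add: W_def)
  then have "ev3 w a b c = 0" for a b c
    unfolding E by (simp add: sum_4 zero sw')
  then show ?thesis using ev3[OF w] by simp
qed

context oriented_manifold
begin

section \<open>Sufficiency of the equations and boundary conditions\<close>

lemma support_zero_chart:
  assumes "d \<in> \<A>" "x \<in> chart_image d" "chart_inv d x \<notin> function_support X f"
  shows "f (chart_inv d x) = 0"
proof (rule support_zero[OF _ assms(3)])
  show "chart_inv d x \<in> topspace X"
    using chart_domain_subset[OF assms(1)] chart_inv_mem[OF assms(1,2)] by blast
qed

lemma variationD:
  assumes "variation X \<A> a"
  shows "so3form 1 a" "compactin X (\<Union>i. form_support X \<A> (a i))" "closedin X (\<Union>i. form_support X \<A> (a i))"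
    "\<And>c x i v. c \<in> \<A> \<Longrightarrow> x \<in> chart_image c \<Longrightarrow> chart_inv c x \<notin> (\<Union>i. form_support X \<A> (a i)) \<Longrightarrow> a i c x v = 0"
proof -
  show "so3form 1 a" using assms by (simp add: variation_def)
  show *: "compactin X (\<Union>i. form_support X \<A> (a i))"
    using assms by (intro compactin_Union) (auto simp: variation_def)
  show "closedin X (\<Union>i. form_support X \<A> (a i))" by (rule compactin_imp_closedin[OF hausdorff *])
qed (auto intro: form_support_zero)

text \<open>One partition of unity on a compact set containing both supports evaluates all three
  integrals.\<close>

lemma form_integral_add:
  assumes \<omega>: "sform 4 \<omega>\<^sub>1" "sform 4 \<omega>\<^sub>2" and eq: "form_eq \<A> \<eta> (\<omega>\<^sub>1 + \<omega>\<^sub>2)" and K: "compactin X K"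
    and z: "\<And>c x v. c \<in> \<A> \<Longrightarrow> x \<in> chart_image c \<Longrightarrow> chart_inv c x \<notin> K \<Longrightarrow> \<omega>\<^sub>1 c x v = 0 \<and> \<omega>\<^sub>2 c x v = 0"
  shows "form_integral X \<A> \<eta> = form_integral X \<A> \<omega>\<^sub>1 + form_integral X \<A> \<omega>\<^sub>2"
proof -
  have cK: "closedin X K" by (rule compactin_imp_closedin[OF hausdorff K])
  obtain D \<rho> where \<rho>: "partition_of_unity_on X \<A> K D \<rho>" using partition_of_unity_exists[OF K] by blast
  have D: "d \<in> \<A>" "bump_in d (\<rho> d)" if "d \<in> D" for d
    using \<rho> that by (auto simp: partition_of_unity_on_def bump_in_def)
  have int: "(\<lambda>x. \<rho> d (chart_inv d x) * \<omega> d x std_frame) integrable_on chart_image d"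
    if \<omega>: "sform 4 \<omega>" and d: "d \<in> D" for \<omega> d
  proof -
    have s: "sform 4 (fun_mult (\<rho> d) \<omega>)" using D[OF d] by (intro sform_fun_mult \<omega>) (simp add: bump_in_def)
    have "(\<lambda>x. fun_mult (\<rho> d) \<omega> d x std_frame) absolutely_integrable_on chart_image d"
    proof (rule absolutely_integrable_top_form[OF s D(1)[OF d]])
      show "compactin X (function_support X (\<rho> d))" "function_support X (\<rho> d) \<subseteq> fst d"
        using D[OF d] by (auto simp: bump_in_def)
      fix x assume "x \<in> chart_image d" "chart_inv d x \<notin> function_support X (\<rho> d)"
      then show "fun_mult (\<rho> d) \<omega> d x std_frame = 0"
        using support_zero_chart[OF D(1)[OF d]] by (simp add: fun_mult_def)
    qed
    then show ?thesis using set_lebesgue_integral_eq_integral(1) by (simp add: fun_mult_def)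
  qed
  have "form_integral X \<A> \<eta> = (\<Sum>d\<in>D. integral (chart_image d) (\<lambda>x. \<rho> d (chart_inv d x) * (\<omega>\<^sub>1 + \<omega>\<^sub>2) d x std_frame))"
    by (rule form_integral_partition[OF sform_add[OF \<omega>] eq \<rho> form_support_subset[OF cK]]) (use z in simp)
  also have "\<dots> = (\<Sum>d\<in>D. integral (chart_image d) (\<lambda>x. \<rho> d (chart_inv d x) * \<omega>\<^sub>1 d x std_frame)) +
      (\<Sum>d\<in>D. integral (chart_image d) (\<lambda>x. \<rho> d (chart_inv d x) * \<omega>\<^sub>2 d x std_frame))"
    unfolding sum.distrib[symmetric]
    by (rule sum.cong[OF refl]) (simp add: distrib_left hk_integral_add int \<omega>)
  also have "(\<Sum>d\<in>D. integral (chart_image d) (\<lambda>x. \<rho> d (chart_inv d x) * \<omega>\<^sub>1 d x std_frame)) = form_integral X \<A> \<omega>\<^sub>1"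
    by (rule form_integral_partition[symmetric, OF \<omega>(1) _ \<rho> form_support_subset[OF cK]]) (use z in \<open>auto simp: form_eq_def\<close>)
  also have "(\<Sum>d\<in>D. integral (chart_image d) (\<lambda>x. \<rho> d (chart_inv d x) * \<omega>\<^sub>2 d x std_frame)) = form_integral X \<A> \<omega>\<^sub>2"
    by (rule form_integral_partition[symmetric, OF \<omega>(2) _ \<rho> form_support_subset[OF cK]]) (use z in \<open>auto simp: form_eq_def\<close>)
  finally show ?thesis .
qed

text \<open>Additivity gives I = I + I.\<close>

lemma form_integral_zero:
  assumes \<omega>: "sform 4 \<omega>" and z: "\<And>c x v. c \<in> \<A> \<Longrightarrow> x \<in> chart_image c \<Longrightarrow> \<omega> c x v = 0"
  shows "form_integral X \<A> \<omega> = 0"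
proof -
  have "form_integral X \<A> \<omega> = form_integral X \<A> \<omega> + form_integral X \<A> \<omega>"
    by (rule form_integral_add[OF \<omega> \<omega>, of _ "{}"]) (use z in \<open>auto simp: form_eq_def\<close>)
  then show ?thesis by simp
qed

lemma boundary_tangential_zero:
  assumes F: "sform 2 \<omega>" and bd: "form_eq (boundary_atlas \<A>) (boundary_pullback \<A> \<omega>) 0"
    and c: "c \<in> \<A>" "x \<in> chart_image c" "x $ 1 = 0"
  shows "ev2 (\<omega> c x) (boundary_incl u) (boundary_incl w) = 0"
proof -
  obtain y where y: "x = boundary_incl y" using c(3) by (rule boundary_incl_surj)
  have "\<omega> c (boundary_incl y) (\<lambda>i. boundary_incl ((if i = 0 then u else w))) = 0"
    using bd c y unfolding form_eq_boundary_iff[OF F] by simp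
  then show ?thesis by (simp add: ev2_def y if_distrib[of boundary_incl])
qed

lemma local_variation_integral:
  assumes A: "so3form 1 A" and F: "so3form 2 F" and a: "so3form 1 a" and c: "c \<in> \<A>"
    and K: "compactin X K" "K \<subseteq> fst c"
    and z: "\<And>d i x v. d \<in> \<A> \<Longrightarrow> x \<in> chart_image d \<Longrightarrow> chart_inv d x \<notin> K \<Longrightarrow> a i d x v = 0"
  shows "form_integral X \<A> (variation_form A F a) =
    integral (chart_image c) (\<lambda>x. half_deriv (boundary_term a F c (std_frame 1) (std_frame 2) (std_frame 3)) x (axis 1 1))
    + integral (chart_image c) (\<lambda>x. bulk_term a (cov_d half_space A 2 F) c x std_frame)"
proof -
  have cK: "closedin X K" by (rule compactin_imp_closedin[OF hausdorff K(1)])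
  have "form_integral X \<A> (variation_form A F a) = integral (chart_image c) (\<lambda>x. variation_form A F a c x std_frame)"
    by (rule form_integral_chart[OF sform_variation_form[OF A F a] c K])
      (rule variation_form_zero[OF A F a _ _ cK _ z])
  also have "\<dots> = integral (chart_image c) (\<lambda>x. half_deriv (boundary_term a F c (std_frame 1) (std_frame 2) (std_frame 3)) x (axis 1 1))
    + integral (chart_image c) (\<lambda>x. bulk_term a (cov_d half_space A 2 F) c x std_frame)"
  proof (rule chart_integral_by_parts[OF A F a c compact_chart_image[OF c K]])
    show "a i c x v = 0" if "x \<in> chart_image c" "x \<notin> snd c ` K" for i x v
    proof (rule z[OF c that(1)])
      show "chart_inv c x \<notin> K" using that c by (metis chart_chart_inv image_eqI)
    qed
  qed
  finally show ?thesis .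
qed

text \<open>The bulk integrand vanishes by the field equation. On the boundary the normal derivative
  term only sees \<open>F\<close> on the last three frame vectors; these are tangential, so the
  pullback condition makes that term vanish there.\<close>

lemma local_variation_integral_zero:
  assumes A: "so3form 1 A" and F: "so3form 2 F"
    and EL: "\<And>i c x v. c \<in> \<A> \<Longrightarrow> x \<in> chart_image c \<Longrightarrow> cov_d half_space A 2 F i c x v = 0"
    and bd: "\<And>i. form_eq (boundary_atlas \<A>) (boundary_pullback \<A> (F i)) 0"
    and a: "so3form 1 a" and c: "c \<in> \<A>" and K: "compactin X K" "K \<subseteq> fst c"
    and z: "\<And>d i x v. d \<in> \<A> \<Longrightarrow> x \<in> chart_image d \<Longrightarrow> chart_inv d x \<notin> K \<Longrightarrow> a i d x v = 0"
  shows "form_integral X \<A> (variation_form A F a) = 0"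
proof -
  let ?\<eta> = "boundary_term a F c (std_frame 1) (std_frame 2) (std_frame 3)"
  let ?U = "chart_image c"
  let ?G = "\<lambda>x. if x \<in> ?U then ?\<eta> x else 0"
  note U = chart_image_open[OF c]
  note K' = compact_chart_image[OF c K]
  have \<eta>0: "?\<eta> x = 0" if "x \<in> ?U" "x \<notin> snd c ` K" for x
  proof -
    have "chart_inv c x \<notin> K" using that c by (metis chart_chart_inv image_eqI)
    then show ?thesis using z[OF c that(1)] by (simp add: boundary_term_def ev1_def)
  qed
  have s: "smooth_on ?U ?\<eta>" by (rule smooth_boundary_term[OF a F c])
  have G: "smooth_on half_space ?G" by (rule zero_extension(1)[OF U s K']) (rule \<eta>0)
  have "integral ?U (\<lambda>x. half_deriv ?\<eta> x (axis 1 1)) = integral half_space (\<lambda>x. half_deriv ?G x (axis 1 1))"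
    by (rule zero_extension(2)[OF U s K']) (rule \<eta>0)
  also have "\<dots> = 0"
  proof (rule integral_normal_derivative_zero[OF G K'(1)])
    show "snd c ` K \<subseteq> half_space" using K'(2) chart_image_half_space[OF c] by blast
    show "?G x = 0" if "x $ 1 = 0" for x
      using boundary_tangential_zero[OF so3form_sform[OF F] bd c _ that]
      unfolding boundary_frame boundary_term_def by simp
  qed (use \<eta>0 in auto)
  finally have 1: "integral ?U (\<lambda>x. half_deriv ?\<eta> x (axis 1 1)) = 0" .
  have "integral ?U (\<lambda>x. bulk_term a (cov_d half_space A 2 F) c x std_frame) = integral ?U (\<lambda>x. 0)"
    by (rule hk_integral_cong) (simp add: bulk_term_def ev3_def EL[OF c])
  then show ?thesis using local_variation_integral[OF A F a c K z] 1 by simp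
qed

text \<open>The partition is applied to the variation rather than to the integrand, since D(\<rho>
  a) contains the derivative of \<rho>. Each \<rho> a is itself a variation supported in one chart,
  and the integral depends linearly on the variation.\<close>

lemma variation_integral_zero:
  assumes A: "so3form 1 A" and F: "so3form 2 F"
    and EL: "\<And>i c x v. c \<in> \<A> \<Longrightarrow> x \<in> chart_image c \<Longrightarrow> cov_d half_space A 2 F i c x v = 0"
    and bd: "\<And>i. form_eq (boundary_atlas \<A>) (boundary_pullback \<A> (F i)) 0"
    and a: "variation X \<A> a"
  shows "form_integral X \<A> (variation_form A F a) = 0"
proof -
  define K where "K = (\<Union>i. form_support X \<A> (a i))"
  note a' = variationD[OF a, folded K_def]
  let ?W = "variation_form A F"
  obtain C \<rho> where \<rho>: "partition_of_unity_on X \<A> K C \<rho>" using partition_of_unity_exists[OF a'(2)] by blast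
  have C: "finite C" "\<And>d. d \<in> C \<Longrightarrow> d \<in> \<A>" "\<And>d. d \<in> C \<Longrightarrow> bump_in d (\<rho> d)" "\<And>p. p \<in> K \<Longrightarrow> (\<Sum>d\<in>C. \<rho> d p) = 1"
    using \<rho> by (auto simp: partition_of_unity_on_def bump_in_def)
  define g where "g d i = fun_mult (\<rho> d) (a i)" for d i
  have g: "so3form 1 (g d)" if "d \<in> C" for d
    using C(3)[OF that] so3form_sform[OF a'(1)] unfolding so3_smooth_form_def g_def
    by (auto intro: sform_fun_mult simp: bump_in_def)
  have gz: "g d i c x v = 0" if "c \<in> \<A>" "x \<in> chart_image c" "chart_inv c x \<notin> K" for d i c x v
    using a'(4)[OF that] by (simp add: g_def fun_mult_def)
  have gz': "g d i c x v = 0" if "d \<in> C" "c \<in> \<A>" "x \<in> chart_image c" "chart_inv c x \<notin> function_support X (\<rho> d)" for d i c x v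
    using support_zero_chart[OF that(2-4)] by (simp add: g_def fun_mult_def)
  have ag: "a i c x v = (\<Sum>d\<in>C. g d i c x v)" if "c \<in> \<A>" "x \<in> chart_image c" for i c x v
    using a'(4)[OF that, of i v] C(4) by (cases "chart_inv c x \<in> K") (auto simp: g_def fun_mult_def sum_distrib_right[symmetric])
  have supp: "form_support X \<A> (?W b) \<subseteq> K"
    if b: "so3form 1 b" and bz: "\<And>i c x v. c \<in> \<A> \<Longrightarrow> x \<in> chart_image c \<Longrightarrow> chart_inv c x \<notin> K \<Longrightarrow> b i c x v = 0" for b
  proof (rule form_support_subset[OF a'(3)])
    show "?W b c x v = 0" if "c \<in> \<A>" "x \<in> chart_image c" "chart_inv c x \<notin> K" for c x v
      by (rule variation_form_zero[OF A F b that(1,2) a'(3) that(3)]) (rule bz[OF that(1)])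
  qed
  have part: "form_integral X \<A> (?W b) = (\<Sum>c\<in>C. integral (chart_image c) (\<lambda>x. \<rho> c (chart_inv c x) * ?W b c x std_frame))"
    if "so3form 1 b" "form_support X \<A> (?W b) \<subseteq> K" for b
    by (rule form_integral_partition[OF sform_variation_form[OF A F that(1)] _ \<rho> that(2)]) (simp add: form_eq_def)
  have int: "(\<lambda>x. \<rho> c (chart_inv c x) * ?W (g d) c x std_frame) integrable_on chart_image c" if cd: "c \<in> C" "d \<in> C" for c d
  proof -
    have s: "sform 4 (fun_mult (\<rho> c) (?W (g d)))"
      using C(3)[OF cd(1)] by (intro sform_fun_mult sform_variation_form A F g cd) (simp add: bump_in_def)
    have "(\<lambda>x. fun_mult (\<rho> c) (?W (g d)) c x std_frame) absolutely_integrable_on chart_image c"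
    proof (rule absolutely_integrable_top_form[OF s C(2)[OF cd(1)]])
      show "compactin X (function_support X (\<rho> c))" "function_support X (\<rho> c) \<subseteq> fst c"
        using C(3)[OF cd(1)] by (auto simp: bump_in_def)
      fix x assume "x \<in> chart_image c" "chart_inv c x \<notin> function_support X (\<rho> c)"
      then show "fun_mult (\<rho> c) (?W (g d)) c x std_frame = 0"
        using support_zero_chart[OF C(2)[OF cd(1)]] by (simp add: fun_mult_def)
    qed
    then show ?thesis using set_lebesgue_integral_eq_integral(1) by (simp add: fun_mult_def)
  qed
  have "form_integral X \<A> (?W a) = (\<Sum>c\<in>C. integral (chart_image c) (\<lambda>x. \<rho> c (chart_inv c x) * ?W a c x std_frame))"
    by (rule part[OF a'(1) supp[OF a'(1) a'(4)]])
  also have "\<dots> = (\<Sum>c\<in>C. \<Sum>d\<in>C. integral (chart_image c) (\<lambda>x. \<rho> c (chart_inv c x) * ?W (g d) c x std_frame))"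
  proof (rule sum.cong[OF refl])
    fix c assume c: "c \<in> C"
    have "integral (chart_image c) (\<lambda>x. \<rho> c (chart_inv c x) * ?W a c x std_frame) =
        integral (chart_image c) (\<lambda>x. \<Sum>d\<in>C. \<rho> c (chart_inv c x) * ?W (g d) c x std_frame)"
    proof (rule hk_integral_cong)
      fix x assume x: "x \<in> chart_image c"
      have "?W a c x std_frame = (\<Sum>d\<in>C. ?W (g d) c x std_frame)"
        by (rule variation_form_sum[OF A F a'(1) C(2)[OF c] x C(1) g]) (use ag[OF C(2)[OF c]] in auto)
      then show "\<rho> c (chart_inv c x) * ?W a c x std_frame = (\<Sum>d\<in>C. \<rho> c (chart_inv c x) * ?W (g d) c x std_frame)"
        by (simp add: sum_distrib_left)
    qed
    also have "\<dots> = (\<Sum>d\<in>C. integral (chart_image c) (\<lambda>x. \<rho> c (chart_inv c x) * ?W (g d) c x std_frame))"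
      by (rule hk_integral_sum[OF C(1)]) (rule int[OF c])
    finally show "integral (chart_image c) (\<lambda>x. \<rho> c (chart_inv c x) * ?W a c x std_frame) =
      (\<Sum>d\<in>C. integral (chart_image c) (\<lambda>x. \<rho> c (chart_inv c x) * ?W (g d) c x std_frame))" .
  qed
  \<comment> \<open>For fixed \<open>d\<close> the sum over \<open>c\<close> is the integral of the
    form belonging to \<open>g d\<close>, evaluated with the same partition.\<close>
  also have "\<dots> = (\<Sum>d\<in>C. form_integral X \<A> (?W (g d)))"
    by (subst sum.swap) (simp add: part[OF g supp[OF g gz]])
  also have "\<dots> = 0"
  proof (rule sum.neutral, rule ballI)
    fix d assume d: "d \<in> C"
    have "compactin X (function_support X (\<rho> d))" "function_support X (\<rho> d) \<subseteq> fst d"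
      using C(3)[OF d] by (auto simp: bump_in_def)
    from local_variation_integral_zero[OF A F EL bd g[OF d] C(2)[OF d] this gz'[OF d]]
    show "form_integral X \<A> (?W (g d)) = 0" .
  qed
  finally show ?thesis .
qed

subsection \<open>Test variations\<close>

text \<open>The coordinate 1-form h dx^k of chart \<open>c\<close>, extended by zero. In another
  chart \<open>d\<close> it is expressed through the k-th component of the Jacobian of the
  transition from \<open>d\<close> to \<open>c\<close>.\<close>

definition test_form :: "('a, 4) chart \<Rightarrow> (real^4 \<Rightarrow> real) \<Rightarrow> 4 \<Rightarrow> ('a, 4) form" where
  "test_form c h k = (\<lambda>d x v. (if chart_inv d x \<in> fst c then h (snd c (chart_inv d x)) else 0) *
     half_deriv (transition d c) x (v 0) $ k)"

context
  fixes c and h :: "real^4 \<Rightarrow> real" and K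
  assumes c: "c \<in> \<A>" and h: "smooth_on (chart_image c) h" and K: "compact K" "K \<subseteq> chart_image c"
    and z: "\<And>x. x \<in> chart_image c \<Longrightarrow> x \<notin> K \<Longrightarrow> h x = 0"
begin

lemma test_form_zero:
  assumes "d \<in> \<A>" "x \<in> chart_image d" "chart_inv d x \<notin> chart_inv c ` K"
  shows "test_form c h k d x v = 0"
proof -
  have "h (snd c (chart_inv d x)) = 0" if "chart_inv d x \<in> fst c"
  proof (rule z)
    show "snd c (chart_inv d x) \<in> chart_image c" using that c by simp
    show "snd c (chart_inv d x) \<notin> K" using assms(3) that c by (metis chart_inv_chart image_eqI)
  qed
  then show ?thesis by (simp add: test_form_def)
qed

lemma sform_test_form: "sform 1 (test_form c h k)"
proof (rule sformI)
  fix d x assume d: "d \<in> \<A>" "x \<in> chart_image d"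
  show "alternating_form 1 (test_form c h k d x)"
  proof (cases "x \<in> overlap d c")
    case True
    have "linear (\<lambda>u. h (snd c (chart_inv d x)) *\<^sub>R half_deriv (transition d c) x u $ k)"
      using linear_transition_deriv[OF d(1) c True]
      by (intro linear_compose_scale_right linear_compose[unfolded o_def, OF _ bounded_linear.linear[OF bounded_linear_vec_nth], of "half_deriv (transition d c) x"])
    then show ?thesis unfolding alternating_form_def test_form_def by (auto simp: linear_zero)
  next
    case False
    then have "test_form c h k d x = (\<lambda>_. 0)" using d by (simp add: test_form_def overlap_iff[OF d(1) c] fun_eq_iff)
    then show ?thesis by (simp add: alternating_form_def linear_zero)
  qed
next
  fix d v assume d: "d \<in> \<A>"
  note K' = compactin_chart_inv_image[OF c K]
  show "smooth_on (chart_image d) (\<lambda>x. test_form c h k d x v)"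
  proof (rule smooth_on_chart_extend[OF c d K'(2,3)])
    have "smooth_on (overlap d c) (\<lambda>x. h (transition d c x))"
      by (rule smooth_on_compose[OF smooth_transition[OF d c] h])
        (use transition_mem[OF d c] overlap_subset[OF c d] in blast)
    moreover have "smooth_on (overlap d c) (\<lambda>x. half_deriv (transition d c) x (v 0) $ k)"
      by (intro smooth_on_bounded_linear[OF bounded_linear_vec_nth] smooth_on_half_deriv smooth_transition overlap_open d c)
    ultimately have "smooth_on (overlap d c) (\<lambda>x. h (transition d c x) * half_deriv (transition d c) x (v 0) $ k)"
      by (rule smooth_on_mult)
    then show "smooth_on (overlap d c) (\<lambda>x. test_form c h k d x v)"
      by (rule smooth_on_cong) (simp add: test_form_def overlap_iff[OF d c] local_rep_def)
  qed (rule test_form_zero[OF d])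
next
  fix d e x v assume d: "d \<in> \<A>" and e: "e \<in> \<A>" and x: "x \<in> overlap d e"
  have p: "chart_inv e (transition d e x) = chart_inv d x" by (rule chart_inv_transition[OF d e x])
  show "test_form c h k d x v = test_form c h k e (transition d e x) (\<lambda>i. half_deriv (transition d e) x (v i))"
  proof (cases "chart_inv d x \<in> fst c")
    case True
    have x': "x \<in> chart_image d" "chart_inv d x \<in> fst d" "chart_inv d x \<in> fst e" using x d by (auto simp: overlap_iff[OF d e])
    have "half_deriv (transition d c) x (v 0) = half_deriv (transition e c) (snd e (chart_inv d x)) (half_deriv (transition d e) x (v 0))"
      using half_deriv_transition_comp[OF d e c x'(2,3) True] x'(1) d by simp
    moreover have "transition d e x = snd e (chart_inv d x)" by (simp add: local_rep_def)
    ultimately show ?thesis using p by (simp add: test_form_def)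
  qed (simp add: test_form_def p)
qed

lemma test_form_chart: "x \<in> chart_image c \<Longrightarrow> test_form c h k c x v = h x * v 0 $ k"
  using c half_deriv_transition_self[OF c] by (simp add: test_form_def)

end


text \<open>A box around the point carries a zero integral of a nonnegative continuous function. The
  box must fit into the domain, which fails at boundary points of the half-space; hence the open set
  \<open>W\<close>.\<close>

lemma continuous_nonneg_integral_zero:
  fixes f :: "real^4 \<Rightarrow> real"
  assumes f: "continuous_on U f" "f integrable_on U" "integral U f = 0" "\<And>x. x \<in> U \<Longrightarrow> 0 \<le> f x"
    and W: "open W" "W \<subseteq> U" "y \<in> W"
  shows "f y = 0"
proof -
  obtain a b where ab: "cbox a b \<subseteq> W" "y \<in> box a b"
    using open_contains_cbox W by (metis (no_types, lifting))
  have sub: "cbox a b \<subseteq> U" using ab W by blast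
  have cont: "continuous_on (cbox a b) f" by (rule continuous_on_subset[OF f(1) sub])
  have int: "f integrable_on cbox a b" by (rule integrable_continuous[OF cont])
  have "integral (cbox a b) f \<le> integral U f"
    by (rule integral_subset_le[OF sub int f(2)]) (use f(4) in blast)
  moreover have "0 \<le> integral (cbox a b) f"
    by (rule hk_integral_nonneg[OF int]) (use sub f(4) in auto)
  ultimately have "integral (cbox a b) f = 0" using f(3) by simp
  then have 0: "(f has_integral 0) (cbox a b)" using int by (metis integrable_integral)
  show ?thesis
    by (rule has_integral_0_cbox_imp_0[OF cont _ 0]) (use sub f(4) ab(2) box_subset_cbox[of a b] in \<open>auto simp: subset_iff\<close>)
qed

definition test_variation :: "('a, 4) chart \<Rightarrow> (real^4 \<Rightarrow> real) \<Rightarrow> 3 \<Rightarrow> 4 \<Rightarrow> ('a, 4) so3_form" where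
  "test_variation c h i k = (\<lambda>j. (if j = i then 1 else 0) \<odot> test_form c h k)"

text \<open>The value of dx^k wedge \<theta> on the standard frame. The factors
  \<open>std_frame m $ k\<close> are 0 or 1, so up to sign this is the component of \<theta> that
  omits axis k.\<close>

definition bulk_coeff :: "('a, 4) form \<Rightarrow> ('a, 4) chart \<Rightarrow> 4 \<Rightarrow> real^4 \<Rightarrow> real" where
  "bulk_coeff \<theta> c k x = std_frame 0 $ k * ev3 (\<theta> c x) (std_frame 1) (std_frame 2) (std_frame 3)
    - std_frame 1 $ k * ev3 (\<theta> c x) (std_frame 0) (std_frame 2) (std_frame 3)
    + std_frame 2 $ k * ev3 (\<theta> c x) (std_frame 0) (std_frame 1) (std_frame 3)
    - std_frame 3 $ k * ev3 (\<theta> c x) (std_frame 0) (std_frame 1) (std_frame 2)"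

text \<open>The value of dx^k wedge \<omega> on the three tangential frame vectors; it is a signed
  tangential component of \<omega> for k = 2, 3, 4 and zero for k = 1.\<close>

definition boundary_coeff :: "('a, 4) form \<Rightarrow> ('a, 4) chart \<Rightarrow> 4 \<Rightarrow> real^4 \<Rightarrow> real" where
  "boundary_coeff \<omega> c k x = std_frame 1 $ k * ev2 (\<omega> c x) (std_frame 2) (std_frame 3)
    - std_frame 2 $ k * ev2 (\<omega> c x) (std_frame 1) (std_frame 3)
    + std_frame 3 $ k * ev2 (\<omega> c x) (std_frame 1) (std_frame 2)"

lemma smooth_bulk_coeff:
  assumes "sform 3 \<theta>" "c \<in> \<A>" shows "smooth_on (chart_image c) (bulk_coeff \<theta> c k)"
proof -
  have "smooth_on (chart_image c) (\<lambda>x. ev3 (\<theta> c x) p q r)" for p q r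
    unfolding ev3_def by (rule sform_smooth[OF assms])
  then show ?thesis
    unfolding bulk_coeff_def[abs_def] by (intro smooth_on_add smooth_on_diff smooth_on_mult smooth_on_const)
qed

lemma smooth_boundary_coeff:
  assumes "sform 2 \<omega>" "c \<in> \<A>" shows "smooth_on (chart_image c) (boundary_coeff \<omega> c k)"
  unfolding boundary_coeff_def[abs_def]
  by (intro smooth_on_add smooth_on_diff smooth_on_mult smooth_on_const smooth_ev assms)

text \<open>Testing with h dx^k in the single component i turns stationarity into a scalar weak
  equation for arbitrary \<open>h\<close> of compact support. \<Theta> is a smooth form that agrees
  with D F on the charts, which gives the coefficients the regularity used later.\<close>

lemma test_identity:
  assumes A: "so3form 1 A" and F: "so3form 2 F" and \<Theta>: "so3form 3 \<Theta>"
    and EL: "\<And>i c x v. c \<in> \<A> \<Longrightarrow> x \<in> chart_image c \<Longrightarrow> cov_d half_space A 2 F i c x v = \<Theta> i c x v"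
    and stat: "\<And>a. variation X \<A> a \<Longrightarrow> form_integral X \<A> (variation_form A F a) = 0"
    and c: "c \<in> \<A>" and h: "smooth_on (chart_image c) h" and K: "compact K" "K \<subseteq> chart_image c"
    and z: "\<And>x. x \<in> chart_image c \<Longrightarrow> x \<notin> K \<Longrightarrow> h x = 0"
  shows "integral (chart_image c) (\<lambda>x. half_deriv (\<lambda>x. h x * boundary_coeff (F i) c k x) x (axis 1 1))
    + integral (chart_image c) (\<lambda>x. h x * bulk_coeff (\<Theta> i) c k x) = 0"
proof -
  let ?a = "test_variation c h i k"
  let ?U = "chart_image c"
  note K' = compactin_chart_inv_image[OF c K]
  have a: "so3form 1 ?a"
    unfolding so3_smooth_form_def test_variation_def using sform_scale[OF sform_test_form[OF c h K z]] by blast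
  have az: "?a j d x v = 0" if "d \<in> \<A>" "x \<in> chart_image d" "chart_inv d x \<notin> chart_inv c ` K" for j d x v
    using test_form_zero[OF c h K z that] by (simp add: test_variation_def form_scale_def)
  have "compactin X (form_support X \<A> (?a j))" for j
  proof (rule closed_compactin[OF K'(1)])
    show "form_support X \<A> (?a j) \<subseteq> chart_inv c ` K" by (rule form_support_subset[OF K'(2)]) (rule az)
    show "closedin X (form_support X \<A> (?a j))" by (simp add: form_support_def)
  qed
  then have "variation X \<A> ?a" using a by (simp add: variation_def)
  then have "form_integral X \<A> (variation_form A F ?a) = 0" by (rule stat)
  then have 0: "integral ?U (\<lambda>x. half_deriv (boundary_term ?a F c (std_frame 1) (std_frame 2) (std_frame 3)) x (axis 1 1))
    + integral ?U (\<lambda>x. bulk_term ?a (cov_d half_space A 2 F) c x std_frame) = 0"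
    using local_variation_integral[OF A F a c K'(1,3) az] by simp
  have ev: "ev1 (?a j c x) u = (if j = i then h x * u $ k else 0)" if "x \<in> ?U" for j x u
    using test_form_chart[OF c h K z that, of k "\<lambda>_. u"] by (simp add: ev1_def test_variation_def form_scale_def)
  have "boundary_term ?a F c (std_frame 1) (std_frame 2) (std_frame 3) x = h x * boundary_coeff (F i) c k x" if "x \<in> ?U" for x
    unfolding boundary_term_def ev[OF that] boundary_coeff_def
    by (simp add: if_distrib[of "\<lambda>t. t * _"] sum.delta sum_subtractf sum.distrib cong: if_cong) (simp add: algebra_simps)
  then have "half_deriv (boundary_term ?a F c (std_frame 1) (std_frame 2) (std_frame 3)) x (axis 1 1) =
      half_deriv (\<lambda>x. h x * boundary_coeff (F i) c k x) x (axis 1 1)" if "x \<in> ?U" for x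
    by (intro half_deriv_cong[OF chart_image_open[OF c] that, THEN fun_cong])
  then have 1: "integral ?U (\<lambda>x. half_deriv (boundary_term ?a F c (std_frame 1) (std_frame 2) (std_frame 3)) x (axis 1 1)) =
      integral ?U (\<lambda>x. half_deriv (\<lambda>x. h x * boundary_coeff (F i) c k x) x (axis 1 1))"
    by (rule hk_integral_cong)
  have "bulk_term ?a (cov_d half_space A 2 F) c x std_frame = h x * bulk_coeff (\<Theta> i) c k x" if "x \<in> ?U" for x
  proof -
    have e3: "ev3 (cov_d half_space A 2 F i c x) p q r = ev3 (\<Theta> i c x) p q r" for p q r
      unfolding ev3_def by (rule EL[OF c that])
    show ?thesis
      unfolding bulk_term_def ev[OF that] bulk_coeff_def e3[symmetric]
      by (simp add: if_distrib[of "\<lambda>t. t * _"] sum.delta sum_subtractf sum.distrib cong: if_cong) (simp add: algebra_simps)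
  qed
  then have 2: "integral ?U (\<lambda>x. bulk_term ?a (cov_d half_space A 2 F) c x std_frame) = integral ?U (\<lambda>x. h x * bulk_coeff (\<Theta> i) c k x)"
    by (rule hk_integral_cong)
  show ?thesis using 0 unfolding 1 2 .
qed

lemma chart_bump:
  assumes c: "c \<in> \<A>" and x0: "x0 \<in> chart_image c"
  obtains b :: "real^4 \<Rightarrow> real" and r where "0 < r" "\<And>k. Ck_on k UNIV b" "\<And>x. 0 \<le> b x"
    "\<And>x. dist x0 x \<le> r \<Longrightarrow> b x = 1" "\<And>x. dist x0 x \<le> r \<Longrightarrow> x \<in> half_space \<Longrightarrow> x \<in> chart_image c"
    "compact (cball x0 (2 * r) \<inter> half_space)" "cball x0 (2 * r) \<inter> half_space \<subseteq> chart_image c"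
    "\<And>x. x \<in> chart_image c \<Longrightarrow> x \<notin> cball x0 (2 * r) \<inter> half_space \<Longrightarrow> b x = 0"
proof -
  obtain s where s: "s > 0" "\<And>t. t \<le> s \<Longrightarrow> cball x0 t \<inter> half_space \<subseteq> chart_image c"
    by (rule chart_ball[OF c x0]) (rule that)
  have r: "0 < s / 2" using s by simp
  obtain b :: "real^4 \<Rightarrow> real" where b: "\<forall>k. Ck_on k UNIV b" "\<forall>x. 0 \<le> b x \<and> b x \<le> 1"
    "\<forall>x\<in>cball x0 (s / 2). b x = 1" "\<forall>x. x \<notin> cball x0 (2 * (s / 2)) \<longrightarrow> b x = 0"
    using Ck_bump[OF r, of x0] by blast
  show ?thesis
  proof (rule that[OF r, of b])
    show "x \<in> chart_image c" if "dist x0 x \<le> s / 2" "x \<in> half_space" for x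
      using s(2)[of "s / 2"] that r by auto
    show "compact (cball x0 (2 * (s / 2)) \<inter> half_space)"
      by (intro compact_Int_closed compact_cball closed_half_space)
    show "cball x0 (2 * (s / 2)) \<inter> half_space \<subseteq> chart_image c" using s(2)[of s] by simp
    show "b x = 0" if "x \<in> chart_image c" "x \<notin> cball x0 (2 * (s / 2)) \<inter> half_space" for x
      using b(4) that chart_image_half_space[OF c that(1)] by blast
  qed (use b in auto)
qed

text \<open>The weight \<open>x $ 1\<close> also vanishes at \<open>x0\<close> when this is a
  boundary point, so a square integrand alone would not decide the value there. Positivity is
  exploited at an interior point near \<open>x0\<close>, and continuity of the coefficient brings
  the contradiction back.\<close>

lemma bulk_coeff_zero:
  assumes A: "so3form 1 A" and F: "so3form 2 F" and \<Theta>: "so3form 3 \<Theta>"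
    and EL: "\<And>i c x v. c \<in> \<A> \<Longrightarrow> x \<in> chart_image c \<Longrightarrow> cov_d half_space A 2 F i c x v = \<Theta> i c x v"
    and stat: "\<And>a. variation X \<A> a \<Longrightarrow> form_integral X \<A> (variation_form A F a) = 0"
    and c: "c \<in> \<A>" and x0: "x0 \<in> chart_image c"
  shows "bulk_coeff (\<Theta> i) c k x0 = 0"
proof (rule ccontr)
  assume ne: "bulk_coeff (\<Theta> i) c k x0 \<noteq> 0"
  let ?U = "chart_image c" and ?\<theta> = "bulk_coeff (\<Theta> i) c k" and ?\<phi> = "boundary_coeff (F i) c k"
  note U = chart_image_open[OF c]
  obtain b :: "real^4 \<Rightarrow> real" and r where b: "0 < r" "\<And>k. Ck_on k UNIV b" "\<And>x. 0 \<le> b x"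
    "\<And>x. dist x0 x \<le> r \<Longrightarrow> b x = 1" "\<And>x. dist x0 x \<le> r \<Longrightarrow> x \<in> half_space \<Longrightarrow> x \<in> chart_image c"
    "compact (cball x0 (2 * r) \<inter> half_space)" "cball x0 (2 * r) \<inter> half_space \<subseteq> chart_image c"
    "\<And>x. x \<in> chart_image c \<Longrightarrow> x \<notin> cball x0 (2 * r) \<inter> half_space \<Longrightarrow> b x = 0"
    by (rule chart_bump[OF c x0]) (rule that)
  let ?K = "cball x0 (2 * r) \<inter> half_space"
  have \<theta>: "smooth_on ?U ?\<theta>" by (rule smooth_bulk_coeff[OF so3form_sform[OF \<Theta>] c])
  have \<phi>: "smooth_on ?U ?\<phi>" by (rule smooth_boundary_coeff[OF so3form_sform[OF F] c])
  \<comment> \<open>The factor \<open>x $ 1\<close> kills the boundary integral, and the factor \<open>bulk_coeff\<close> makes the bulk integrand a square.\<close>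
  define h where "h x = b x * ?\<theta> x * x $ 1" for x
  have h: "smooth_on ?U h"
    unfolding h_def by (intro smooth_on_mult \<theta> smooth_on_UNIV_Ck[OF b(2)] smooth_on_linear bounded_linear_vec_nth)
  have hz: "h x = 0" if "x \<in> ?U" "x \<notin> ?K" for x using b(8)[OF that] by (simp add: h_def)
  let ?f = "\<lambda>x. h x * ?\<phi> x"
  let ?G = "\<lambda>x. if x \<in> ?U then ?f x else 0"
  have f: "smooth_on ?U ?f" by (rule smooth_on_mult[OF h \<phi>])
  have fz: "?f x = 0" if "x \<in> ?U" "x \<notin> ?K" for x using hz[OF that] by simp
  have G: "smooth_on half_space ?G" by (rule zero_extension(1)[OF U f b(6,7)]) (rule fz)
  have "integral ?U (\<lambda>x. half_deriv ?f x (axis 1 1)) = integral half_space (\<lambda>x. half_deriv ?G x (axis 1 1))"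
    by (rule zero_extension(2)[OF U f b(6,7)]) (rule fz)
  also have "\<dots> = 0"
    by (rule integral_normal_derivative_zero[OF G b(6)]) (use fz in \<open>auto simp: h_def\<close>)
  finally have 0: "integral ?U (\<lambda>x. h x * ?\<theta> x) = 0"
    using test_identity[OF A F \<Theta> EL stat c h b(6,7) hz, of i k] by simp
  have cont: "continuous_on ?U (\<lambda>x. h x * ?\<theta> x)"
    by (rule smooth_on_imp_continuous_on[OF smooth_on_mult[OF h \<theta>]])
  have int: "(\<lambda>x. h x * ?\<theta> x) integrable_on ?U"
    by (rule set_lebesgue_integral_eq_integral(1),
      rule absolutely_integrable_on_compact_support[OF continuous_on_subset[OF cont b(7)] b(6,7)]) (use hz in auto)
  have nonneg: "0 \<le> h x * ?\<theta> x" if "x \<in> ?U" for x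
  proof -
    have "h x * ?\<theta> x = b x * x $ 1 * (?\<theta> x)\<^sup>2" by (simp add: h_def power2_eq_square)
    then show ?thesis using b(3)[of x] half_space_nonneg[OF chart_image_half_space[OF c that]] by simp
  qed
  obtain \<delta> where \<delta>: "\<delta> > 0" "\<And>y. y \<in> ?U \<Longrightarrow> dist y x0 < \<delta> \<Longrightarrow> dist (?\<theta> y) (?\<theta> x0) < \<bar>?\<theta> x0\<bar>"
    using smooth_on_imp_continuous_on[OF \<theta>] x0 ne unfolding continuous_on_iff by (metis zero_less_abs_iff)
  \<comment> \<open>Moving inwards by \<open>s\<close> reaches a point of positive height where the
    bump is still 1 and the coefficient is still nonzero.\<close>
  define s where "s = min \<delta> r / 2"
  have s: "0 < s" "s < \<delta>" "s < r" using \<delta>(1) b(1) by (auto simp: s_def)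
  define y where "y = x0 + s *\<^sub>R axis 1 1"
  have yd: "dist y x0 = s" "dist x0 y = s" using s by (simp_all add: y_def dist_norm norm_axis_1)
  have "0 \<le> x0 $ 1" by (rule half_space_nonneg[OF chart_image_half_space[OF c x0]])
  then have y1: "0 < y $ 1" using s by (simp add: y_def axis_def)
  have yU: "y \<in> ?U" by (rule b(5)) (use yd s y1 in \<open>auto simp: half_space_def\<close>)
  obtain V where V: "open V" "?U = half_space \<inter> V" using U by (auto simp: openin_open)
  have "open {x :: real^4. 0 < x $ 1}" using open_halfspace_component_gt_cart[of 0 "1::4"] by simp
  then have "open (V \<inter> {x. 0 < x $ 1})" by (rule open_Int[OF V(1)])
  moreover have "V \<inter> {x. 0 < x $ 1} \<subseteq> ?U" unfolding V(2) half_space_def by auto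
  moreover have "y \<in> V \<inter> {x. 0 < x $ 1}" using yU y1 V(2) by simp
  ultimately have "h y * ?\<theta> y = 0"
    by (intro continuous_nonneg_integral_zero[OF cont int 0, of "V \<inter> {x. 0 < x $ 1}" y] nonneg)
  then have "?\<theta> y = 0" using b(4)[of y] yd s y1 by (simp add: h_def)
  then show False using \<delta>(2)[OF yU] yd s by simp
qed

text \<open>The bulk integral drops out by \<open>bulk_coeff_zero\<close>, so the weight is no
  longer called for. What remains is the normal derivative of the nonnegative function b \<phi>^2,
  whose integral would be strictly negative if \<phi> were nonzero at the boundary point
  \<open>x0\<close>.\<close>

lemma boundary_coeff_zero:
  assumes A: "so3form 1 A" and F: "so3form 2 F" and \<Theta>: "so3form 3 \<Theta>"
    and EL: "\<And>i c x v. c \<in> \<A> \<Longrightarrow> x \<in> chart_image c \<Longrightarrow> cov_d half_space A 2 F i c x v = \<Theta> i c x v"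
    and stat: "\<And>a. variation X \<A> a \<Longrightarrow> form_integral X \<A> (variation_form A F a) = 0"
    and c: "c \<in> \<A>" and x0: "x0 \<in> chart_image c" "x0 $ 1 = 0"
  shows "boundary_coeff (F i) c k x0 = 0"
proof (rule ccontr)
  assume ne: "boundary_coeff (F i) c k x0 \<noteq> 0"
  let ?U = "chart_image c" and ?\<phi> = "boundary_coeff (F i) c k"
  note U = chart_image_open[OF c]
  obtain b :: "real^4 \<Rightarrow> real" and r where b: "0 < r" "\<And>k. Ck_on k UNIV b" "\<And>x. 0 \<le> b x"
    "\<And>x. dist x0 x \<le> r \<Longrightarrow> b x = 1" "\<And>x. dist x0 x \<le> r \<Longrightarrow> x \<in> half_space \<Longrightarrow> x \<in> chart_image c"
    "compact (cball x0 (2 * r) \<inter> half_space)" "cball x0 (2 * r) \<inter> half_space \<subseteq> chart_image c"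
    "\<And>x. x \<in> chart_image c \<Longrightarrow> x \<notin> cball x0 (2 * r) \<inter> half_space \<Longrightarrow> b x = 0"
    by (rule chart_bump[OF c x0(1)]) (rule that)
  let ?K = "cball x0 (2 * r) \<inter> half_space"
  have \<phi>: "smooth_on ?U ?\<phi>" by (rule smooth_boundary_coeff[OF so3form_sform[OF F] c])
  define h where "h x = b x * ?\<phi> x" for x
  have h: "smooth_on ?U h" unfolding h_def by (intro smooth_on_mult \<phi> smooth_on_UNIV_Ck[OF b(2)])
  have hz: "h x = 0" if "x \<in> ?U" "x \<notin> ?K" for x using b(8)[OF that] by (simp add: h_def)
  let ?f = "\<lambda>x. h x * ?\<phi> x"
  let ?G = "\<lambda>x. if x \<in> ?U then ?f x else 0"
  have f: "smooth_on ?U ?f" by (rule smooth_on_mult[OF h \<phi>])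
  have fz: "?f x = 0" if "x \<in> ?U" "x \<notin> ?K" for x using hz[OF that] by simp
  have G: "smooth_on half_space ?G" by (rule zero_extension(1)[OF U f b(6,7)]) (rule fz)
  have "integral ?U (\<lambda>x. h x * bulk_coeff (\<Theta> i) c k x) = integral ?U (\<lambda>x. 0)"
    by (rule hk_integral_cong) (simp add: bulk_coeff_zero[OF A F \<Theta> EL stat c])
  then have "integral ?U (\<lambda>x. half_deriv ?f x (axis 1 1)) = 0"
    using test_identity[OF A F \<Theta> EL stat c h b(6,7) hz, of i k] by simp
  moreover have "integral ?U (\<lambda>x. half_deriv ?f x (axis 1 1)) = integral half_space (\<lambda>x. half_deriv ?G x (axis 1 1))"
    by (rule zero_extension(2)[OF U f b(6,7)]) (rule fz)
  moreover have "integral half_space (\<lambda>x. half_deriv ?G x (axis 1 1)) < 0"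
  proof (rule integral_normal_derivative_neg[OF G b(6)])
    have sq: "?f x = b x * (?\<phi> x)\<^sup>2" for x by (simp add: h_def power2_eq_square)
    show "0 \<le> ?G x" for x unfolding sq using b(3)[of x] by simp
    show "0 < ?G x0" unfolding sq using x0 ne b(1) b(4)[of x0] by simp
  qed (use fz x0 in auto)
  ultimately show False by simp
qed

lemma variational_equations_iff:
  assumes A: "so3form 1 A" and F: "so3form 2 F" and \<Theta>: "so3form 3 \<Theta>"
    and EL: "\<And>i c x v. c \<in> \<A> \<Longrightarrow> x \<in> chart_image c \<Longrightarrow> cov_d half_space A 2 F i c x v = \<Theta> i c x v"
  shows "(\<forall>a. variation X \<A> a \<longrightarrow> form_integral X \<A> (variation_form A F a) = 0) \<longleftrightarrow>
    (\<forall>i. form_eq \<A> (cov_d half_space A 2 F i) 0) \<and>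
    (\<forall>i. form_eq (boundary_atlas \<A>) (boundary_pullback \<A> (F i)) 0)"
proof (intro iffI conjI allI)
  assume "(\<forall>i. form_eq \<A> (cov_d half_space A 2 F i) 0) \<and>
    (\<forall>i. form_eq (boundary_atlas \<A>) (boundary_pullback \<A> (F i)) 0)"
  then show "variation X \<A> a \<longrightarrow> form_integral X \<A> (variation_form A F a) = 0" for a
    using variation_integral_zero[OF A F] by (simp add: form_eq_def[of \<A>])
next
  assume "\<forall>a. variation X \<A> a \<longrightarrow> form_integral X \<A> (variation_form A F a) = 0"
  then have stat: "\<And>a. variation X \<A> a \<Longrightarrow> form_integral X \<A> (variation_form A F a) = 0" by blast
  fix i
  show "form_eq \<A> (cov_d half_space A 2 F i) 0"
    unfolding form_eq_def
  proof (intro ballI allI)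
    fix c x v assume c: "c \<in> \<A>" and x: "x \<in> chart_image c"
    have "bulk_coeff (\<Theta> i) c k x = 0" for k by (rule bulk_coeff_zero[OF A F \<Theta> EL stat c x])
    from this[of 1] this[of 2] this[of 3] this[of 4] have "\<Theta> i c x v = 0"
      by (intro alternating_form_3_eq_0[OF sform_alternating[OF so3form_sform[OF \<Theta>] c x]])
        (simp_all add: bulk_coeff_def std_frame_simps[unfolded One_nat_def] axis_def[of _ "1::real", THEN arg_cong[where f="\<lambda>u. u $ _"]])
    then show "cov_d half_space A 2 F i c x v = 0 c x v" using EL[OF c x] by simp
  qed
  show "form_eq (boundary_atlas \<A>) (boundary_pullback \<A> (F i)) 0"
    unfolding form_eq_boundary_iff[OF so3form_sform[OF F]]
  proof (intro ballI allI impI)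
    fix c y v assume c: "c \<in> \<A>" and y: "boundary_incl y \<in> chart_image c"
    let ?w = "F i c (boundary_incl y)"
    have a: "alternating_form 2 ?w" by (rule sform_alternating[OF so3form_sform[OF F] c y])
    have bc: "boundary_coeff (F i) c k (boundary_incl y) = 0" for k
      by (rule boundary_coeff_zero[OF A F \<Theta> EL stat c y]) simp_all
    \<comment> \<open>The index 1 gives no information, dx^1 being zero on tangential vectors; the
      indices 2, 3 and 4 give the three independent components up to sign.\<close>
    have E: "ev2 ?w (boundary_incl (axis 2 1)) (boundary_incl (axis 3 1)) = 0"
      "ev2 ?w (boundary_incl (axis 1 1)) (boundary_incl (axis 3 1)) = 0"
      "ev2 ?w (boundary_incl (axis 1 1)) (boundary_incl (axis 2 1)) = 0"
      using bc[of 2] bc[of 3] bc[of 4] unfolding boundary_coeff_def boundary_frame by (simp_all add: axis_def)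
    have E': "ev2 ?w (boundary_incl (axis 3 1)) (boundary_incl (axis 2 1)) = 0"
      "ev2 ?w (boundary_incl (axis 3 1)) (boundary_incl (axis 1 1)) = 0"
      "ev2 ?w (boundary_incl (axis 2 1)) (boundary_incl (axis 1 1)) = 0"
      by (subst ev2_alt(2)[OF a], simp add: E)+
    have Z: "ev2 ?w (boundary_incl (axis j 1)) (boundary_incl (axis k 1)) = 0" for j k
      using exhaust_3[of j] exhaust_3[of k] E E' ev2_alt(1)[OF a] by auto
    have l1: "linear (\<lambda>u. ev2 ?w (boundary_incl u) b)" for b
      using linear_compose[OF linear_boundary_incl linear_ev2(1)[OF a]] by (simp add: o_def)
    have l2: "linear (\<lambda>u. ev2 ?w b (boundary_incl u))" for b
      using linear_compose[OF linear_boundary_incl linear_ev2(2)[OF a]] by (simp add: o_def)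
    have "ev2 ?w (boundary_incl p) (boundary_incl q) = 0" for p q
    proof -
      have "ev2 ?w (boundary_incl (axis j 1)) (boundary_incl q) = 0" for j
        by (subst linear_axis_expansion[OF l2]) (simp add: Z)
      then show ?thesis by (subst linear_axis_expansion[OF l1]) simp
    qed
    then show "?w (\<lambda>i. boundary_incl (v i)) = 0" by (subst ev2[OF a])
  qed
qed

section \<open>The first variation of the Lagrangian\<close>

lemma first_variation_lagrangian:
  assumes Ap: "so3form 1 A\<^sub>p" and Am: "so3form 1 A\<^sub>m" and a: "so3form 1 a" and b: "so3form 1 b"
  shows "form_eq \<A> (first_variation lagrangian A\<^sub>p A\<^sub>m a b)
    (variation_form A\<^sub>p (curvature half_space A\<^sub>m) a + variation_form A\<^sub>m (curvature half_space A\<^sub>p) b)"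
  unfolding form_eq_def
proof (intro ballI allI)
  fix c x v assume c: "c \<in> \<A>" "x \<in> chart_image c"
  define P where "P i = ev2 (curvature half_space A\<^sub>p i c x)" for i
  define Q where "Q i = ev2 (curvature half_space A\<^sub>m i c x)" for i
  define Da where "Da i = ev2 (cov_d half_space A\<^sub>p 1 a i c x)" for i
  define Db where "Db i = ev2 (cov_d half_space A\<^sub>m 1 b i c x)" for i
  define Ea where "Ea i = ev2 (eps_wedge 1 1 a a i c x)" for i
  define Eb where "Eb i = ev2 (eps_wedge 1 1 b b i c x)" for i
  \<comment> \<open>The curvature of A + t a is an exact quadratic polynomial in t, so the
    Lagrangian is a quartic one and its derivative at 0 is the linear coefficient; no limit is
    interchanged with the exterior derivative.\<close>
  have L: "lagrangian (\<lambda>i. A\<^sub>p i + t \<odot> a i) (\<lambda>i. A\<^sub>m i + t \<odot> b i) c x v = (\<Sum>i\<in>UNIV.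
      w22 (P i) (Q i) v + t * w22 (P i) (Db i) v + t\<^sup>2 / 2 * w22 (P i) (Eb i) v
      + t * (w22 (Da i) (Q i) v + t * w22 (Da i) (Db i) v + t\<^sup>2 / 2 * w22 (Da i) (Eb i) v)
      + t\<^sup>2 / 2 * (w22 (Ea i) (Q i) v + t * w22 (Ea i) (Db i) v + t\<^sup>2 / 2 * w22 (Ea i) (Eb i) v))" for t
    unfolding lagrangian_def sum_3 plus_fun_apply
      wedge_2_2_at[OF sform_curvature[OF so3form_add_scale[OF Ap a]] sform_curvature[OF so3form_add_scale[OF Am b]] c]
      ev2_curvature_add_scale[OF Ap a c] ev2_curvature_add_scale[OF Am b c] w22_add_left w22_add_right
      P_def Q_def Da_def Db_def Ea_def Eb_def ..
  have "((\<lambda>t. lagrangian (\<lambda>i. A\<^sub>p i + t \<odot> a i) (\<lambda>i. A\<^sub>m i + t \<odot> b i) c x v) has_real_derivative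
      (\<Sum>i\<in>UNIV. w22 (P i) (Db i) v + w22 (Da i) (Q i) v)) (at 0)"
    unfolding L by (auto intro!: derivative_eq_intros)
  then have "first_variation lagrangian A\<^sub>p A\<^sub>m a b c x v = (\<Sum>i\<in>UNIV. w22 (P i) (Db i) v + w22 (Da i) (Q i) v)"
    unfolding first_variation_def by (rule DERIV_imp_deriv)
  then show "first_variation lagrangian A\<^sub>p A\<^sub>m a b c x v =
      (variation_form A\<^sub>p (curvature half_space A\<^sub>m) a + variation_form A\<^sub>m (curvature half_space A\<^sub>p) b) c x v"
    unfolding plus_fun_apply variation_form_at[OF Ap so3form_curvature[OF Am] a c]
      variation_form_at[OF Am so3form_curvature[OF Ap] b c] P_def Q_def Da_def Db_def
    by (simp add: sum.distrib w22_commute[of "ev2 (curvature half_space A\<^sub>p _ c x)"])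
qed

text \<open>The two variations are independent: setting one of them to zero isolates the condition
  on the other, and additivity of the integral gives the converse.\<close>

lemma stationary_lagrangian_iff:
  assumes Ap: "so3form 1 A\<^sub>p" and Am: "so3form 1 A\<^sub>m"
  shows "stationary X \<A> lagrangian A\<^sub>p A\<^sub>m \<longleftrightarrow>
    (\<forall>a. variation X \<A> a \<longrightarrow> form_integral X \<A> (variation_form A\<^sub>p (curvature half_space A\<^sub>m) a) = 0) \<and>
    (\<forall>b. variation X \<A> b \<longrightarrow> form_integral X \<A> (variation_form A\<^sub>m (curvature half_space A\<^sub>p) b) = 0)"
proof -
  note Fp = so3form_curvature[OF Ap] and Fm = so3form_curvature[OF Am]
  let ?V = "variation_form A\<^sub>p (curvature half_space A\<^sub>m)" and ?W = "variation_form A\<^sub>m (curvature half_space A\<^sub>p)"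
  have add: "form_integral X \<A> (first_variation lagrangian A\<^sub>p A\<^sub>m a b) = form_integral X \<A> (?V a) + form_integral X \<A> (?W b)"
    if a: "variation X \<A> a" and b: "variation X \<A> b" for a b
  proof -
    note a' = variationD[OF a] and b' = variationD[OF b]
    let ?K = "(\<Union>i. form_support X \<A> (a i)) \<union> (\<Union>i. form_support X \<A> (b i))"
    show ?thesis
    proof (rule form_integral_add[OF sform_variation_form[OF Ap Fm a'(1)] sform_variation_form[OF Am Fp b'(1)]
          first_variation_lagrangian[OF Ap Am a'(1) b'(1)]])
      show "compactin X ?K" by (rule compactin_Un[OF a'(2) b'(2)])
      fix c x v assume x: "c \<in> \<A>" "x \<in> chart_image c" "chart_inv c x \<notin> ?K"
      have "?V a c x v = 0"
        by (rule variation_form_zero[OF Ap Fm a'(1) x(1,2) a'(3)]) (use x(3) a'(4)[OF x(1)] in auto)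
      moreover have "?W b c x v = 0"
        by (rule variation_form_zero[OF Am Fp b'(1) x(1,2) b'(3)]) (use x(3) b'(4)[OF x(1)] in auto)
      ultimately show "?V a c x v = 0 \<and> ?W b c x v = 0" ..
    qed
  qed
  \<comment> \<open>The zero variation, written as a multiple of a given one so that its smoothness
    follows from that of \<open>a\<close>.\<close>
  define z where "z a = (\<lambda>i. 0 \<odot> a i)" for a :: "('a, 4) so3_form"
  have z: "variation X \<A> (z a)" if a: "variation X \<A> a" for a
  proof -
    have "form_support X \<A> (z a i) = {}" for i
      using form_support_subset[of "{}" "z a i"] by (auto simp: z_def form_scale_def)
    moreover have "so3form 1 (z a)"
      using variationD(1)[OF a] by (simp add: so3_smooth_form_def z_def sform_scale)
    ultimately show ?thesis by (simp add: variation_def)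
  qed
  have zero: "form_integral X \<A> (variation_form A F (z a)) = 0"
    if "so3form 1 A" "so3form 2 F" "variation X \<A> a" for A F a
    by (rule form_integral_zero[OF sform_variation_form[OF that(1,2) variationD(1)[OF z[OF that(3)]]]])
      (rule variation_form_zero[OF that(1,2) variationD(1)[OF z[OF that(3)]], of _ _ "{}"],
        auto simp: z_def form_scale_def)
  show ?thesis
  proof (intro iffI conjI allI impI)
    assume s: "stationary X \<A> lagrangian A\<^sub>p A\<^sub>m"
    show "form_integral X \<A> (?V a) = 0" if a: "variation X \<A> a" for a
      using s add[OF a z[OF a]] zero[OF Am Fp a] a z[OF a] by (simp add: stationary_def)
    show "form_integral X \<A> (?W b) = 0" if b: "variation X \<A> b" for b
      using s add[OF z[OF b] b] zero[OF Ap Fm b] b z[OF b] by (simp add: stationary_def)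
  qed (use add in \<open>auto simp: stationary_def\<close>)
qed

end

theorem mainTheorem1:
  fixes X :: "'a topology" and \<A> :: "('a, 4) chart set"
    and A\<^sub>p A\<^sub>m e A :: "('a, 4) so3_form" and \<alpha> :: real
  defines "F\<^sub>p \<equiv> curvature half_space A\<^sub>p"
    and "F\<^sub>m \<equiv> curvature half_space A\<^sub>m"
    and "F \<equiv> curvature half_space A"
    and "De \<equiv> cov_d half_space A 1 e"
    and "jj \<equiv> boundary_pullback \<A>"
    and "\<B> \<equiv> boundary_atlas \<A>"
  assumes manifold: "oriented_smooth_4_manifold X \<A>"
    and connection_p: "so3_smooth_form half_space \<A> 1 A\<^sub>p"
    and connection_m: "so3_smooth_form half_space \<A> 1 A\<^sub>m"
    and e: "e = (\<lambda>i. A\<^sub>p i - A\<^sub>m i)"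
    and A: "A = (\<lambda>i. \<alpha> \<odot> A\<^sub>m i + (1 - \<alpha>) \<odot> A\<^sub>p i)"
  shows
    "(stationary X \<A> lagrangian A\<^sub>p A\<^sub>m \<longleftrightarrow>
        (\<forall>i. form_eq \<A> (cov_d half_space A\<^sub>m 2 F\<^sub>p i) 0) \<and>
        (\<forall>i. form_eq \<A> (cov_d half_space A\<^sub>p 2 F\<^sub>m i) 0) \<and>
        (\<forall>i. form_eq \<B> (jj (F\<^sub>p i)) 0) \<and>
        (\<forall>i. form_eq \<B> (jj (F\<^sub>m i)) 0))
     \<and>
     form_eq \<A>
       (\<Sum>i\<in>UNIV. wedge 2 2 (F\<^sub>m i) (F\<^sub>p i))
       ((((1 - \<alpha>)\<^sup>2 + \<alpha>\<^sup>2) / 2) \<odot>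
          (\<Sum>i\<in>UNIV. \<Sum>j\<in>UNIV. \<Sum>k\<in>UNIV.
             levi_civita i j k \<odot> wedge 2 2 (wedge 1 1 (e i) (e j)) (F k))
        + (\<alpha> * (1 - \<alpha>) * (1 - 2 * \<alpha>) / 2) \<odot>
          (\<Sum>i\<in>UNIV. \<Sum>j\<in>UNIV. \<Sum>k\<in>UNIV.
             levi_civita i j k \<odot> wedge 3 1 (wedge 2 1 (De i) (e j)) (e k))
        + (\<alpha> * (\<alpha> - 1)) \<odot> (\<Sum>i\<in>UNIV. wedge 2 2 (De i) (De i))
        + (2 * \<alpha> - 1) \<odot> (\<Sum>i\<in>UNIV. wedge 2 2 (De i) (F i))
        + (\<Sum>i\<in>UNIV. wedge 2 2 (F i) (F i)))
     \<and>
     ((\<forall>i. form_eq \<A> (cov_d half_space A\<^sub>m 2 F\<^sub>p i) 0) \<and>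
      (\<forall>i. form_eq \<A> (cov_d half_space A\<^sub>p 2 F\<^sub>m i) 0) \<and>
      (\<forall>i. form_eq \<B> (jj (F\<^sub>p i)) 0) \<and>
      (\<forall>i. form_eq \<B> (jj (F\<^sub>m i)) 0)
      \<longleftrightarrow>
      (\<forall>i. form_eq \<A> (eps_wedge 1 2 e F i) 0) \<and>
      (\<forall>i. form_eq \<A> (eps_wedge 2 1 De e i) 0) \<and>
      (\<forall>i. form_eq \<B> (jj (De i - ((1/2) * (1 - 2 * \<alpha>)) \<odot> eps_wedge 1 1 e e i)) 0) \<and>
      (\<forall>i. form_eq \<B> (jj (F i - ((1/2) * \<alpha> * (\<alpha> - 1)) \<odot> eps_wedge 1 1 e e i)) 0))
     \<and>
     (\<alpha> = 1/2 \<longrightarrow>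
       ((\<forall>i. form_eq \<B> (jj (De i - ((1/2) * (1 - 2 * \<alpha>)) \<odot> eps_wedge 1 1 e e i)) 0) \<and>
        (\<forall>i. form_eq \<B> (jj (F i - ((1/2) * \<alpha> * (\<alpha> - 1)) \<odot> eps_wedge 1 1 e e i)) 0)
        \<longleftrightarrow>
        (\<forall>i. form_eq \<B> (jj (De i)) 0) \<and>
        (\<forall>i. form_eq \<B> (jj (F i + (1/8) \<odot> eps_wedge 1 1 e e i)) 0)) \<and>
       ((\<forall>i. form_eq \<B> (jj (De i)) 0) \<and>
        (\<forall>i. form_eq \<B> (jj (F i + (1/8) \<odot> eps_wedge 1 1 e e i)) 0)
        \<longleftrightarrow>
        gr3_field_equations \<B> (1/4) (\<lambda>i. jj (e i)) (\<lambda>i. jj (A i))))"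
proof -
  interpret oriented_manifold X \<A> by (rule oriented_manifold.intro[OF manifold])
  have se: "so3form 1 e"
    using connection_p connection_m unfolding e so3_smooth_form_def by (blast intro: sform_diff)
  have sA: "so3form 1 A"
    using connection_p connection_m unfolding A so3_smooth_form_def by (blast intro: sform_add sform_scale)
  have Ap: "A\<^sub>p = (\<lambda>i. A i + \<alpha> \<odot> e i)" and Am: "A\<^sub>m = (\<lambda>i. A i + (\<alpha> - 1) \<odot> e i)"
    by (simp_all add: A e form_scale_def fun_eq_iff algebra_simps)
  note sF = so3form_curvature[OF connection_p] so3form_curvature[OF connection_m]
  have ApAm: "A\<^sub>p = (\<lambda>i. A\<^sub>m i + 1 \<odot> e i)" and AmAp: "A\<^sub>m = (\<lambda>i. A\<^sub>p i + (-1) \<odot> e i)"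
    by (simp_all add: e form_scale_def fun_eq_iff)
  have EL_m: "cov_d half_space A\<^sub>p 2 F\<^sub>m i c x v = eps_wedge 1 2 e F\<^sub>m i c x v" if "c \<in> \<A>" "x \<in> chart_image c" for i c x v
    using cov_d_add_scale[of A\<^sub>m 1 e F\<^sub>m i c x v] Bianchi[OF connection_m that, of i v] ApAm by (simp add: F\<^sub>m_def)
  have EL_p: "cov_d half_space A\<^sub>m 2 F\<^sub>p i c x v = ((-1) \<odot> eps_wedge 1 2 e F\<^sub>p i) c x v" if "c \<in> \<A>" "x \<in> chart_image c" for i c x v
    using cov_d_add_scale[of A\<^sub>p "-1" e F\<^sub>p i c x v] Bianchi[OF connection_p that, of i v] AmAp
    by (simp add: F\<^sub>p_def form_scale_def)
  \<comment> \<open>Wedge products of smooth forms, hence smooth 3-forms; by the two preceding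
    equations they stand in for the covariant derivatives of the curvatures.\<close>
  have \<Theta>: "so3form 3 (eps_wedge 1 2 e F\<^sub>m)" "so3form 3 (\<lambda>i. (-1) \<odot> eps_wedge 1 2 e F\<^sub>p i)"
    using so3form_eps_wedge[OF se sF(1)] so3form_eps_wedge[OF se sF(2)]
    by (simp_all add: F\<^sub>p_def F\<^sub>m_def so3_smooth_form_def sform_scale numeral_3_eq_3)
  \<comment> \<open>The fields are exchanged: varying A_+ yields the equation and boundary condition
    for F_-, and varying A_- those for F_+.\<close>
  have Vp: "(\<forall>a. variation X \<A> a \<longrightarrow> form_integral X \<A> (variation_form A\<^sub>p F\<^sub>m a) = 0) \<longleftrightarrow>
      (\<forall>i. form_eq \<A> (cov_d half_space A\<^sub>p 2 F\<^sub>m i) 0) \<and> (\<forall>i. form_eq (boundary_atlas \<A>) (boundary_pullback \<A> (F\<^sub>m i)) 0)"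
    by (rule variational_equations_iff[OF connection_p sF(2)[folded F\<^sub>m_def] \<Theta>(1)]) (rule EL_m)
  have Vm: "(\<forall>a. variation X \<A> a \<longrightarrow> form_integral X \<A> (variation_form A\<^sub>m F\<^sub>p a) = 0) \<longleftrightarrow>
      (\<forall>i. form_eq \<A> (cov_d half_space A\<^sub>m 2 F\<^sub>p i) 0) \<and> (\<forall>i. form_eq (boundary_atlas \<A>) (boundary_pullback \<A> (F\<^sub>p i)) 0)"
    by (rule variational_equations_iff[OF connection_m sF(1)[folded F\<^sub>p_def] \<Theta>(2)]) (rule EL_p)
  have 1: "stationary X \<A> lagrangian A\<^sub>p A\<^sub>m \<longleftrightarrow>
        (\<forall>i. form_eq \<A> (cov_d half_space A\<^sub>m 2 F\<^sub>p i) 0) \<and>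
        (\<forall>i. form_eq \<A> (cov_d half_space A\<^sub>p 2 F\<^sub>m i) 0) \<and>
        (\<forall>i. form_eq \<B> (jj (F\<^sub>p i)) 0) \<and>
        (\<forall>i. form_eq \<B> (jj (F\<^sub>m i)) 0)"
    unfolding stationary_lagrangian_iff[OF connection_p connection_m] F\<^sub>p_def[symmetric] F\<^sub>m_def[symmetric] Vp Vm jj_def \<B>_def
    by blast
  have 2: "De i - ((1/2) * (1 - 2 * \<alpha>)) \<odot> eps_wedge 1 1 e e i = De i"
    "F i - ((1/2) * \<alpha> * (\<alpha> - 1)) \<odot> eps_wedge 1 1 e e i = F i + (1/8) \<odot> eps_wedge 1 1 e e i" if "\<alpha> = 1/2" for i
    unfolding that by (simp_all add: form_scale_def fun_eq_iff)
  have half: "(\<forall>i. form_eq \<B> (jj (De i - ((1/2) * (1 - 2 * \<alpha>)) \<odot> eps_wedge 1 1 e e i)) 0) \<longleftrightarrow> (\<forall>i. form_eq \<B> (jj (De i)) 0)"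
    "(\<forall>i. form_eq \<B> (jj (F i - ((1/2) * \<alpha> * (\<alpha> - 1)) \<odot> eps_wedge 1 1 e e i)) 0) \<longleftrightarrow>
      (\<forall>i. form_eq \<B> (jj (F i + (1/8) \<odot> eps_wedge 1 1 e e i)) 0)" if "\<alpha> = 1/2"
    using 2[OF that] by (simp_all only:)
  note eqs = field_equations_iff[OF sA se, of \<alpha>, folded Ap Am F_def De_def F\<^sub>p_def F\<^sub>m_def]
  note bds = boundary_conditions_iff[OF sA se, of \<alpha>, folded Ap Am F_def De_def F\<^sub>p_def F\<^sub>m_def \<B>_def jj_def]
  \<comment> \<open>The field equations contain \<Lambda>/2, and \<alpha>(\<alpha> - 1)/2 = -1/8 at
    \<alpha> = 1/2; this is where \<Lambda> = 1/4 comes from.\<close>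
  have "(1/4 :: real) / 2 = 1/8" by simp
  note gr3 = gr3_field_equations_boundary[OF sA se, of "1/4", folded F_def De_def \<B>_def jj_def, unfolded this]
  show ?thesis
  proof (intro conjI impI)
    show "form_eq \<A>
       (\<Sum>i\<in>UNIV. wedge 2 2 (F\<^sub>m i) (F\<^sub>p i))
       ((((1 - \<alpha>)\<^sup>2 + \<alpha>\<^sup>2) / 2) \<odot>
          (\<Sum>i\<in>UNIV. \<Sum>j\<in>UNIV. \<Sum>k\<in>UNIV.
             levi_civita i j k \<odot> wedge 2 2 (wedge 1 1 (e i) (e j)) (F k))
        + (\<alpha> * (1 - \<alpha>) * (1 - 2 * \<alpha>) / 2) \<odot>
          (\<Sum>i\<in>UNIV. \<Sum>j\<in>UNIV. \<Sum>k\<in>UNIV.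
             levi_civita i j k \<odot> wedge 3 1 (wedge 2 1 (De i) (e j)) (e k))
        + (\<alpha> * (\<alpha> - 1)) \<odot> (\<Sum>i\<in>UNIV. wedge 2 2 (De i) (De i))
        + (2 * \<alpha> - 1) \<odot> (\<Sum>i\<in>UNIV. wedge 2 2 (De i) (F i))
        + (\<Sum>i\<in>UNIV. wedge 2 2 (F i) (F i)))"
      by (rule lagrangian_decomposition[OF sA se, of \<alpha>, folded Ap Am F_def De_def F\<^sub>p_def F\<^sub>m_def])
  qed (use 1 eqs bds half gr3 in blast)+
qed

end
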